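(* Let $d\ge 1$ and let $E\subset\mathbb{R}^d$ be a measurable set satisfying the $1$-GCC. Then for any $\beta>0$ and $\delta>0$ there exists a constant $C>0$ such that for every $R>0$, $$\|f\|_{L^2(\mathbb{R}^d)}\le C\,\|f\|_{L^2(\mathcal{U}_\delta(E))}$$ whenever $f\in L^2(\mathbb{R}^d)$ satisfies $\operatorname{spec}(f)\subset\{\xi\in\mathbb{R}^d:\ R-\beta\le|\xi|\le R+\beta\}$. In particular, $C$ does not depend on $R$.
   Context: For $k\in\{1,\dots,d\}$, $\ell>0$, $\gamma>0$, a set $E\subset\mathbb{R}^d$ satisfies the $k$-dimensional $(\ell,\gamma)$-geometric control condition (GCC) if for every $k$-dimensional cube $Q\subset\mathbb{R}^d$ (a cube lying in some $k$-dimensional affine plane, of arbitrary position and orientation) of side-length at least $\ell$, one has $\mathcal{H}^k(Q\cap E)\ge\gamma\ell^k$, where $\mathcal{H}^k$ is $k$-dimensional Hausdorff measure. $E$ satisfies the $k$-GCC if it satisfies the $k$-dimensional $(\ell,\gamma)$-GCC for some $\ell>0,\gamma>0$. For $A\subset\mathbb{R}^d$ and $\delta>0$, $\mathcal{U}_\delta(A)$ denotes the open $\delta$-neighborhood of $A$. For $f\in L^2(\mathbb{R}^d)$, $\operatorname{spec}(f)$ denotes the support of the Fourier transform $\widehat f$. *)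

theory Defs
  imports "HOL-Analysis.Analysis"
begin

definition hausdorff_pre :: "nat \<Rightarrow> real \<Rightarrow> 'a::euclidean_space set \<Rightarrow> ennreal" where
  "hausdorff_pre k \<delta> A =
     Inf {(\<Sum>i. ennreal (unit_ball_vol (real k) * (diameter (C i) / 2) ^ k)) | C :: nat \<Rightarrow> 'a set.
            (\<forall>i. bounded (C i) \<and> diameter (C i) \<le> \<delta>) \<and> A \<subseteq> (\<Union>i. C i)}"

definition hausdorff_measure :: "nat \<Rightarrow> 'a::euclidean_space set \<Rightarrow> ennreal" where
  "hausdorff_measure k A = (SUP \<delta>\<in>{0<..}. hausdorff_pre k \<delta> A)"

definition orthonormal_family :: "nat \<Rightarrow> (nat \<Rightarrow> 'a::euclidean_space) \<Rightarrow> bool" where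
  "orthonormal_family k v \<longleftrightarrow> (\<forall>i<k. \<forall>j<k. v i \<bullet> v j = (if i = j then 1 else 0))"

definition k_cube :: "nat \<Rightarrow> 'a::euclidean_space \<Rightarrow> (nat \<Rightarrow> 'a) \<Rightarrow> real \<Rightarrow> 'a set" where
  "k_cube k a v s = {a + (\<Sum>i<k. t i *\<^sub>R v i) | t. \<forall>i<k. 0 \<le> t i \<and> t i \<le> s}"

definition GCC_params :: "nat \<Rightarrow> real \<Rightarrow> real \<Rightarrow> 'a::euclidean_space set \<Rightarrow> bool" where
  "GCC_params k l \<gamma> E \<longleftrightarrow>
     (\<forall>a v s. orthonormal_family k v \<and> s \<ge> l \<longrightarrow>
        hausdorff_measure k (k_cube k a v s \<inter> E) \<ge> ennreal (\<gamma> * l ^ k))"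

definition GCC :: "nat \<Rightarrow> 'a::euclidean_space set \<Rightarrow> bool" where
  "GCC k E \<longleftrightarrow> (\<exists>l>0. \<exists>\<gamma>>0. GCC_params k l \<gamma> E)"

definition nbhd :: "real \<Rightarrow> 'a::metric_space set \<Rightarrow> 'a set" where
  "nbhd \<delta> A = (\<Union>y\<in>A. ball y \<delta>)"

definition L2 :: "('a::euclidean_space \<Rightarrow> complex) \<Rightarrow> bool" where
  "L2 f \<longleftrightarrow> f \<in> borel_measurable lebesgue \<and> integrable lebesgue (\<lambda>x. (cmod (f x))\<^sup>2)"

definition L2_norm_on :: "'a::euclidean_space set \<Rightarrow> ('a \<Rightarrow> complex) \<Rightarrow> real" where
  "L2_norm_on S f = sqrt (LINT x:S|lebesgue. (cmod (f x))\<^sup>2)"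

definition fourier_L1 :: "('a::euclidean_space \<Rightarrow> complex) \<Rightarrow> 'a \<Rightarrow> complex" where
  "fourier_L1 g \<xi> = (LINT x|lebesgue. g x * cis (- 2 * pi * (x \<bullet> \<xi>)))"

text \<open>g is (a representative of) the L2 (Plancherel) Fourier transform of f: the L2-limit
  of the Fourier transforms of the truncations of f to the balls of radius n.\<close>
definition is_fourier_L2 :: "('a::euclidean_space \<Rightarrow> complex) \<Rightarrow> ('a \<Rightarrow> complex) \<Rightarrow> bool" where
  "is_fourier_L2 f g \<longleftrightarrow> L2 g \<and>
     ((\<lambda>n::nat. \<integral>\<^sup>+ \<xi>. ennreal ((cmod (fourier_L1 (\<lambda>x. indicator (ball 0 (real n)) x * f x) \<xi> - g \<xi>))\<^sup>2) \<partial>lebesgue)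
        \<longlonglongrightarrow> 0)"

definition fourier_L2 :: "('a::euclidean_space \<Rightarrow> complex) \<Rightarrow> 'a \<Rightarrow> complex" where
  "fourier_L2 f = (SOME g. is_fourier_L2 f g)"

text \<open>Support of a measurable function (defined up to null sets): the complement of the largest
  open set on which it vanishes almost everywhere.\<close>
definition ess_support :: "('a::euclidean_space \<Rightarrow> complex) \<Rightarrow> 'a set" where
  "ess_support g = {\<xi>. \<forall>\<epsilon>>0. emeasure lebesgue {\<eta> \<in> ball \<xi> \<epsilon>. g \<eta> \<noteq> 0} > 0}"

definition spec :: "('a::euclidean_space \<Rightarrow> complex) \<Rightarrow> 'a set" where
  "spec f = ess_support (fourier_L2 f)"

end

theory Submission
  imports Defs "HOL-Probability.Characteristic_Functions"
begin

text \<open>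
  Every segment of length l meets E, so along any line the neighbourhood of E contains a fixed
  proportion of the points of an arithmetic progression, in runs of consecutive points. A function
  whose spectrum lies in a slab of width 2 M orthogonal to a unit vector \<omega> has a very small n-th
  twisted difference in the direction \<omega>: the multiplier of the difference with step t is at most
  (2 \<pi> t M)^n. Newton extrapolation from a run inside the neighbourhood therefore recovers it with
  an error of relative size X^n / n!, where X depends only on M and l.

  A thin annulus is not contained in a slab, but its intersection with a ball of fixed radius \<rho> is
  contained in a slab of width 4 \<beta> once R is large. So f is replaced by the pieces f * \<Psi>_\<eta>, where
  \<Psi>_\<eta>(z) = 1_{B(0,r)}(z) exp(2 \<pi> i z \<bullet> \<eta>). In frequency, \<Psi>_\<eta> is the transform \<phi> of the indicator of
  the ball translated by \<eta>; as \<phi> is square integrable, the part beyond distance \<rho> is negligible. In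
  space, by Plancherel in \<eta>, the square norms of the pieces over a set S integrate to at most the
  volume of B(0,r) times the square norm of f over the r-neighbourhood of S, with equality for the
  whole space. For bounded R the annulus itself lies in a slab of bounded width.
\<close>

section \<open>Translations and the L1 Fourier transform\<close>

text \<open>Two choices threaten to be circular: the order n has to beat the slab half-width M, the
  radius \<rho> depends on n, and the slab has to contain a cap of radius \<rho>. Curvature breaks
  the circle: on a sphere of radius R such a cap deviates from its tangent plane by about \<rho>^2 /
  R, so beyond a threshold R0 depending on \<rho> the half-width 2 \<beta> suffices whatever \<rho>
  is. Below R0 the half-width R0 + \<beta> is large but fixed. For a single \<eta> the far
  frequencies are not small: the multiplier there is only bounded by 2^(n+1), and F may live there.
  Only after integration over \<eta> is the error a small multiple of the square norm of f, because
  the far part then contributes the tail of \<phi> times the square norm of F. So the estimates for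
  the pieces are integrated before anything is absorbed. The direction \<omega> of the slab turns
  with \<eta>, which is why all directions are sampled with the same l. The sharp cutoff keeps the
  pieces local in space; its transform decays slowly, but an average over \<eta> asks only for
  square integrability.\<close>

lemma ennreal_tendsto_0_le:
  fixes f g :: "nat \<Rightarrow> ennreal"
  assumes "g \<longlonglongrightarrow> 0" "\<And>n. f n \<le> g n"
  shows "f \<longlonglongrightarrow> 0"
  by (rule tendsto_sandwich[where f="\<lambda>_. 0" and h=g]) (use assms in auto)

section \<open>Affine substitutions and continuity of translations in L1\<close>

lemma nn_integral_lborel_affine:
  fixes f :: "'a::euclidean_space \<Rightarrow> ennreal"
  assumes [measurable]: "f \<in> borel_measurable borel" and "c \<noteq> 0"
  shows "(\<integral>\<^sup>+x. f x \<partial>lborel) = ennreal (\<bar>c\<bar> ^ DIM('a)) * (\<integral>\<^sup>+x. f (t + c *\<^sub>R x) \<partial>lborel)"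
  by (subst lborel_affine[OF \<open>c \<noteq> 0\<close>, of t])
     (simp add: nn_integral_density nn_integral_distr nn_integral_cmult)

lemma integral_lborel_affine:
  fixes f :: "'a::euclidean_space \<Rightarrow> 'b::{banach, second_countable_topology}"
  assumes [measurable]: "f \<in> borel_measurable borel" and "c \<noteq> 0"
  shows "(LINT x|lborel. f x) = (\<bar>c\<bar> ^ DIM('a)) *\<^sub>R (LINT x|lborel. f (t + c *\<^sub>R x))"
  by (subst lborel_affine[OF \<open>c \<noteq> 0\<close>, of t])
     (simp add: integral_density integral_distr)

lemma integrable_lborel_affine:
  fixes f :: "'a::euclidean_space \<Rightarrow> 'b::{banach, second_countable_topology}"
  assumes "integrable lborel f" and "c \<noteq> 0"
  shows "integrable lborel (\<lambda>x. f (t + c *\<^sub>R x))"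
  using assms(1) borel_measurable_integrable[OF assms(1)]
  unfolding integrable_iff_bounded
  by (subst (asm) nn_integral_lborel_affine[where c=c and t=t])
     (auto simp: ennreal_mult_less_top \<open>c \<noteq> 0\<close>)

text \<open>The identity |1_U - 1_U(. + h)| = 1_U + 1_U(. + h) - 2 1_U 1_U(. + h) and translation
  invariance leave only the product. It is dominated by 1_U and tends to it pointwise: at points of
  U because U is open, elsewhere trivially. So boundary points cause no trouble.\<close>

lemma tendsto_integral_translation_open:
  fixes U :: "'a::euclidean_space set"
  assumes U: "open U" "emeasure lborel U < \<infinity>" and h: "h \<longlonglongrightarrow> (0::'a)"
  shows "(\<lambda>n. LINT x|lborel. \<bar>indicator U x - indicator U (x + h n)\<bar> :: real) \<longlonglongrightarrow> 0"
proof -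
  have [measurable]: "U \<in> sets borel" using U by auto
  have i1: "integrable lborel (indicator U :: 'a \<Rightarrow> real)" using U by (simp add: integrable_real_indicator)
  have i2: "integrable lborel (\<lambda>x. indicator U (x + h n) :: real)" for n
    using integrable_lborel_affine[OF i1, of 1 "h n"] by (simp add: add.commute)
  have i3: "integrable lborel (\<lambda>x. indicator U x * indicator U (x + h n) :: real)" for n
    by (rule Bochner_Integration.integrable_bound[OF i1]) (auto simp: indicator_def)
  have e2: "(LINT x|lborel. indicator U (x + h n) :: real) = (LINT x|lborel. indicator U x)" for n
    by (subst (2) integral_lborel_affine[of _ 1 "h n"]) (auto simp: add.commute)
  have eq: "(LINT x|lborel. \<bar>indicator U x - indicator U (x + h n)\<bar> :: real) =
      2 * (LINT x|lborel. indicator U x) - 2 * (LINT x|lborel. indicator U x * indicator U (x + h n))" for n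
  proof -
    have "(LINT x|lborel. \<bar>indicator U x - indicator U (x + h n)\<bar> :: real) =
      (LINT x|lborel. indicator U x + indicator U (x + h n) - 2 * (indicator U x * indicator U (x + h n)))"
      by (intro Bochner_Integration.integral_cong) (auto simp: indicator_def)
    also have "\<dots> = (LINT x|lborel. indicator U x) + (LINT x|lborel. indicator U (x + h n))
        - 2 * (LINT x|lborel. (indicator U x * indicator U (x + h n)))"
      using i1 i2 i3 by simp
    finally show ?thesis by (simp add: e2)
  qed
  have "(\<lambda>n. LINT x|lborel. indicator U x * indicator U (x + h n) :: real) \<longlonglongrightarrow> (LINT x|lborel. indicator U x)"
  proof (rule integral_dominated_convergence[where w="indicator U"])
    show "AE x in lborel. (\<lambda>n. indicator U x * indicator U (x + h n) :: real) \<longlonglongrightarrow> indicator U x"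
    proof (intro AE_I2)
      fix x
      show "(\<lambda>n. indicator U x * indicator U (x + h n) :: real) \<longlonglongrightarrow> indicator U x"
      proof (cases "x \<in> U")
        case True
        have "(\<lambda>n. x + h n) \<longlonglongrightarrow> x + 0" by (intro tendsto_intros h)
        then have "\<forall>\<^sub>F n in sequentially. x + h n \<in> U"
          using U True by (auto dest: topological_tendstoD)
        then show ?thesis
          by (intro tendsto_eventually) (auto elim: eventually_mono simp: True)
      qed simp
    qed
  qed (use i1 in \<open>auto simp: indicator_def\<close>)
  then have "(\<lambda>n. LINT x|lborel. \<bar>indicator U x - indicator U (x + h n)\<bar> :: real) \<longlonglongrightarrow>
     2 * (LINT x|lborel. indicator U x) - 2 * (LINT x|lborel. indicator U x)"
    unfolding eq by (intro tendsto_intros)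
  then show ?thesis by simp
qed

text \<open>Three-epsilon argument: the error u - v has the same integral before and after
  translation. The approximants are multiples of indicators of open sets in one use and simple
  functions in the other.\<close>

lemma tendsto_integral_translation_approx:
  fixes u :: "'a::euclidean_space \<Rightarrow> real"
  assumes u: "integrable lborel u"
    and ap: "\<And>e. 0 < e \<Longrightarrow> \<exists>v. integrable lborel v \<and> (LINT x|lborel. \<bar>u x - v x\<bar>) < e \<and>
       (\<lambda>n. LINT x|lborel. \<bar>v x - v (x + h n)\<bar>) \<longlonglongrightarrow> 0"
  shows "(\<lambda>n. LINT x|lborel. \<bar>u x - u (x + h n)\<bar>) \<longlonglongrightarrow> 0"
proof (rule LIMSEQ_I)
  fix e :: real assume "0 < e"
  then obtain v where v: "integrable lborel v" and d: "(LINT x|lborel. \<bar>u x - v x\<bar>) < e/3"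
    and l: "(\<lambda>n. LINT x|lborel. \<bar>v x - v (x + h n)\<bar>) \<longlonglongrightarrow> 0"
    using ap[of "e/3"] by auto
  from LIMSEQ_D[OF l, of "e/3"] \<open>0 < e\<close> obtain N where
    N: "\<And>n. n \<ge> N \<Longrightarrow> (LINT x|lborel. \<bar>v x - v (x + h n)\<bar>) < e/3"
    by (auto simp: integral_nonneg_AE)
  have tr: "integrable lborel (\<lambda>x. w (x + t))" if "integrable lborel w" for w :: "'a \<Rightarrow> real" and t
    using integrable_lborel_affine[OF that, of 1 t] by (simp add: add.commute)
  have [measurable]: "u \<in> borel_measurable borel" "v \<in> borel_measurable borel"
    using u v by auto
  have "(LINT x|lborel. \<bar>u x - u (x + h n)\<bar>) < e" if n: "n \<ge> N" for n
  proof -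
    have i: "integrable lborel (\<lambda>x. \<bar>u x - v x\<bar>)" "integrable lborel (\<lambda>x. \<bar>u (x + h n) - v (x + h n)\<bar>)"
        "integrable lborel (\<lambda>x. \<bar>v x - v (x + h n)\<bar>)" "integrable lborel (\<lambda>x. \<bar>u x - u (x + h n)\<bar>)"
      using u v by (intro Bochner_Integration.integrable_diff integrable_abs tr; simp)+
    have "(LINT x|lborel. \<bar>u x - u (x + h n)\<bar>) \<le>
       (LINT x|lborel. \<bar>u x - v x\<bar> + \<bar>v x - v (x + h n)\<bar> + \<bar>u (x + h n) - v (x + h n)\<bar>)"
      using i by (intro integral_mono) auto
    also have "\<dots> = (LINT x|lborel. \<bar>u x - v x\<bar>) + (LINT x|lborel. \<bar>v x - v (x + h n)\<bar>)
       + (LINT x|lborel. \<bar>u (x + h n) - v (x + h n)\<bar>)"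
      using i by simp
    also have "(LINT x|lborel. \<bar>u (x + h n) - v (x + h n)\<bar>) = (LINT x|lborel. \<bar>u x - v x\<bar>)"
      by (subst (2) integral_lborel_affine[of _ 1 "h n"]) (auto simp: add.commute)
    finally show ?thesis using d N[OF n] by simp
  qed
  then show "\<exists>no. \<forall>n\<ge>no. norm ((LINT x|lborel. \<bar>u x - u (x + h n)\<bar>) - 0) < e"
    by (auto simp: integral_nonneg_AE)
qed

text \<open>Induction over integrable functions: outer regularity replaces a Borel set by an open
  one, sums follow from the triangle inequality, limits from approximation in L1.\<close>

lemma tendsto_integral_translation:
  fixes u :: "'a::euclidean_space \<Rightarrow> real"
  assumes "integrable lborel u" and h: "h \<longlonglongrightarrow> (0::'a)"
  shows "(\<lambda>n. LINT x|lborel. \<bar>u x - u (x + h n)\<bar>) \<longlonglongrightarrow> 0"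
  using assms(1)
proof (induction rule: integrable_induct)
  case (base A c)
  have "integrable lborel (\<lambda>x. indicator A x *\<^sub>R c)"
    using base by (intro integrable_scaleR_left integrable_real_indicator) auto
  then show ?case
  proof (rule tendsto_integral_translation_approx)
    fix e :: real assume "0 < e"
    \<comment> \<open>The added 1 covers c = 0.\<close>
    define e' where "e' = e / (\<bar>c\<bar> + 1)"
    have "e' > 0" using \<open>0 < e\<close> by (simp add: e'_def)
    from outer_regular_lborel[OF _ this] base obtain U where
      U: "open U" "A \<subseteq> U" "emeasure lborel (U - A) < e'" by (metis sets_lborel)
    have [measurable]: "A \<in> sets borel" "U \<in> sets borel" using base U by auto
    have "emeasure lborel U \<le> emeasure lborel A + emeasure lborel (U - A)"
      using U by (subst plus_emeasure) (auto simp: Un_absorb1)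
    also have "\<dots> < \<infinity>" using U base by (auto simp: less_top[symmetric])
    finally have Uf: "emeasure lborel U < \<infinity>" .
    let ?v = "\<lambda>x. indicator U x *\<^sub>R c"
    have iv: "integrable lborel ?v"
      using Uf by (intro integrable_scaleR_left integrable_real_indicator) auto
    have "(LINT x|lborel. \<bar>indicator A x *\<^sub>R c - ?v x\<bar>) = (LINT x|lborel. \<bar>c\<bar> * indicator (U - A) x)"
      using U by (intro Bochner_Integration.integral_cong) (auto simp: indicator_def)
    also have "\<dots> = \<bar>c\<bar> * measure lborel (U - A)" by simp
    also have "measure lborel (U - A) < e'"
      using U(3) \<open>e' > 0\<close> unfolding measure_def
      by (metis enn2real_less_iff ennreal_less_top order_less_trans)
    then have "\<bar>c\<bar> * measure lborel (U - A) \<le> \<bar>c\<bar> * e'" by (intro mult_left_mono) auto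
    also have "\<dots> < e" using \<open>0 < e\<close> by (simp add: e'_def field_simps)
    finally have 1: "(LINT x|lborel. \<bar>indicator A x *\<^sub>R c - ?v x\<bar>) < e" .
    have "(\<lambda>n. \<bar>c\<bar> * (LINT x|lborel. \<bar>indicator U x - indicator U (x + h n)\<bar>)) \<longlonglongrightarrow> \<bar>c\<bar> * 0"
      by (intro tendsto_intros tendsto_integral_translation_open U Uf h)
    also have "(\<lambda>n. \<bar>c\<bar> * (LINT x|lborel. \<bar>indicator U x - indicator U (x + h n)\<bar>)) =
      (\<lambda>n. LINT x|lborel. \<bar>?v x - ?v (x + h n)\<bar>)"
      by (subst integral_mult_right_zero[symmetric])
         (auto simp: fun_eq_iff abs_mult[symmetric] algebra_simps simp del: integral_mult_right_zero
            intro!: Bochner_Integration.integral_cong)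
    finally show "\<exists>v. integrable lborel v \<and> (LINT x|lborel. \<bar>indicator A x *\<^sub>R c - v x\<bar>) < e \<and>
       (\<lambda>n. LINT x|lborel. \<bar>v x - v (x + h n)\<bar>) \<longlonglongrightarrow> 0"
      using iv 1 by (intro exI[of _ ?v]) auto
  qed
next
  case (add f g)
  have tr: "integrable lborel (\<lambda>x. w (x + t))" if "integrable lborel w" for w :: "'a \<Rightarrow> real" and t
    using integrable_lborel_affine[OF that, of 1 t] by (simp add: add.commute)
  have "(\<lambda>n. (LINT x|lborel. \<bar>f x - f (x + h n)\<bar>) + (LINT x|lborel. \<bar>g x - g (x + h n)\<bar>)) \<longlonglongrightarrow> 0 + 0"
    using add by (intro tendsto_intros)
  then have "(\<lambda>n. (LINT x|lborel. \<bar>f x - f (x + h n)\<bar>) + (LINT x|lborel. \<bar>g x - g (x + h n)\<bar>)) \<longlonglongrightarrow> 0" by simp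
  moreover have "(LINT x|lborel. \<bar>f x + g x - (f (x + h n) + g (x + h n))\<bar>)
         \<le> (LINT x|lborel. \<bar>f x - f (x + h n)\<bar>) + (LINT x|lborel. \<bar>g x - g (x + h n)\<bar>)" for n
  proof -
    have i: "integrable lborel (\<lambda>x. \<bar>f x - f (x + h n)\<bar>)" "integrable lborel (\<lambda>x. \<bar>g x - g (x + h n)\<bar>)"
      "integrable lborel (\<lambda>x. \<bar>f x + g x - (f (x + h n) + g (x + h n))\<bar>)"
      using add by (intro Bochner_Integration.integrable_diff Bochner_Integration.integrable_add integrable_abs tr; simp)+
    have "(LINT x|lborel. \<bar>f x + g x - (f (x + h n) + g (x + h n))\<bar>)
         \<le> (LINT x|lborel. \<bar>f x - f (x + h n)\<bar> + \<bar>g x - g (x + h n)\<bar>)"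
      using i by (intro integral_mono) auto
    also have "\<dots> = (LINT x|lborel. \<bar>f x - f (x + h n)\<bar>) + (LINT x|lborel. \<bar>g x - g (x + h n)\<bar>)"
      using i by (intro Bochner_Integration.integral_add)
    finally show ?thesis .
  qed
  ultimately show ?case
    by (intro Lim_null_comparison[rotated, where f="\<lambda>n. LINT x|lborel. \<bar>f x + g x - (f (x + h n) + g (x + h n))\<bar>"])
       (auto simp: integral_nonneg_AE)
next
  case (lim f s)
  show ?case using lim.hyps(4)
  proof (rule tendsto_integral_translation_approx)
    fix e :: real assume "0 < e"
    have "(\<lambda>i. LINT x|lborel. \<bar>f x - s i x\<bar>) \<longlonglongrightarrow> (LINT x::'a|lborel. (0::real))"
    \<comment> \<open>The approximating simple functions satisfy |s i| \<le> 2 |f|, whence the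
      factor 3.\<close>
    proof (rule integral_dominated_convergence[where w="\<lambda>x. 3 * \<bar>f x\<bar>"])
      show "AE x in lborel. (\<lambda>i. \<bar>f x - s i x\<bar>) \<longlonglongrightarrow> 0"
      proof (intro AE_I2)
        fix x
        have "(\<lambda>i. \<bar>f x - s i x\<bar>) \<longlonglongrightarrow> \<bar>f x - f x\<bar>" by (intro tendsto_intros lim.hyps(2)) auto
        then show "(\<lambda>i. \<bar>f x - s i x\<bar>) \<longlonglongrightarrow> 0" by simp
      qed
      show "AE x in lborel. norm \<bar>f x - s i x\<bar> \<le> 3 * \<bar>f x\<bar>" for i
        using lim.hyps(3)[of _ i] by (intro AE_I2) (smt (verit) real_norm_def space_lborel UNIV_I)
    qed (use lim in \<open>auto intro!: borel_measurable_abs borel_measurable_diff\<close>)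
    then have "\<forall>\<^sub>F i in sequentially. (LINT x|lborel. \<bar>f x - s i x\<bar>) < e"
      using \<open>0 < e\<close> by (auto dest: order_tendstoD)
    then obtain i where "(LINT x|lborel. \<bar>f x - s i x\<bar>) < e"
      by (auto simp: eventually_sequentially)
    then show "\<exists>v. integrable lborel v \<and> (LINT x|lborel. \<bar>f x - v x\<bar>) < e \<and>
       (\<lambda>n. LINT x|lborel. \<bar>v x - v (x + h n)\<bar>) \<longlonglongrightarrow> 0"
      using lim by blast
  qed
qed

section \<open>Square norms, continuity of translations in L2 and the Cauchy-Schwarz
  inequality\<close>

lemma borel_measurable_cis [measurable (raw)]:
  "f \<in> borel_measurable M \<Longrightarrow> (\<lambda>x. cis (f x)) \<in> borel_measurable M"
  by (rule borel_measurable_continuous_on[where f=cis]) (auto intro!: continuous_intros)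

lemma borel_measurable_cnj [measurable (raw)]:
  "f \<in> borel_measurable M \<Longrightarrow> (\<lambda>x. cnj (f x)) \<in> borel_measurable M"
  by (rule borel_measurable_continuous_on[where f=cnj]) (auto intro!: continuous_intros)

text \<open>Values in \<open>ennreal\<close> keep Tonelli, Fatou and limits free of integrability
  conditions; no root is taken because Plancherel, the average over \<eta> and the final absorption
  are all statements about squares.\<close>

definition l2sq :: "('a::euclidean_space \<Rightarrow> complex) \<Rightarrow> ennreal" where
  "l2sq g = (\<integral>\<^sup>+x. ennreal ((cmod (g x))\<^sup>2) \<partial>lborel)"

lemma l2sq_finite_iff:
  assumes "g \<in> borel_measurable borel"
  shows "l2sq g < top \<longleftrightarrow> integrable lborel (\<lambda>x. (cmod (g x))\<^sup>2)"
  using assms by (simp add: l2sq_def integrable_iff_bounded)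

lemma l2sq_eq_integral:
  assumes "g \<in> borel_measurable borel" "l2sq g < \<infinity>"
  shows "l2sq g = ennreal (LINT x|lborel. (cmod (g x))\<^sup>2)"
  using assms(2) l2sq_finite_iff[OF assms(1)] unfolding l2sq_def infinity_ennreal_def
  by (intro nn_integral_eq_integral) auto

lemma l2sq_translation:
  assumes [measurable]: "g \<in> borel_measurable borel"
  shows "l2sq (\<lambda>x. g (x + t)) = l2sq g"
  unfolding l2sq_def
  by (subst (2) nn_integral_lborel_affine[of _ 1 t]) (auto simp: add.commute)

text \<open>Applied to real and imaginary parts, this reduces continuity of translations in L2 to that in L1.\<close>
lemma square_diff_le_abs_diff:
  fixes a b :: real
  shows "(a - b)\<^sup>2 \<le> 2 * \<bar>a * \<bar>a\<bar> - b * \<bar>b\<bar>\<bar>"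
proof (cases "0 \<le> a * b")
  case True
  have "(a - b)\<^sup>2 = \<bar>a - b\<bar> * \<bar>a - b\<bar>" by (simp add: power2_eq_square)
  also have "\<dots> \<le> \<bar>a - b\<bar> * \<bar>a + b\<bar>"
    using True by (intro mult_left_mono) (auto simp: zero_le_mult_iff)
  also have "\<dots> = \<bar>a * \<bar>a\<bar> - b * \<bar>b\<bar>\<bar>"
    using True by (auto simp: zero_le_mult_iff abs_mult[symmetric] algebra_simps)
  finally have "(a - b)\<^sup>2 \<le> \<bar>a * \<bar>a\<bar> - b * \<bar>b\<bar>\<bar>" .
  then show ?thesis by (rule order_trans) simp
next
  case False
  then have "\<bar>a * \<bar>a\<bar> - b * \<bar>b\<bar>\<bar> = a\<^sup>2 + b\<^sup>2"
    by (auto simp: not_le mult_less_0_iff power2_eq_square)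
  then show ?thesis
    using sum_squares_bound[of a "-b"] by (simp add: power2_diff)
qed

lemma tendsto_l2sq_translation:
  fixes g :: "'a::euclidean_space \<Rightarrow> complex"
  assumes g[measurable]: "g \<in> borel_measurable borel" and fin: "l2sq g < \<infinity>" and h: "h \<longlonglongrightarrow> (0::'a)"
  shows "(\<lambda>n. l2sq (\<lambda>x. g x - g (x + h n))) \<longlonglongrightarrow> 0"
proof -
  \<comment> \<open>Signed squares of the real and imaginary part. They are integrable because their
    absolute values are bounded by the squared modulus of g.\<close>
  define u where "u x = Re (g x) * \<bar>Re (g x)\<bar>" for x
  define v where "v x = Im (g x) * \<bar>Im (g x)\<bar>" for x
  have [measurable]: "u \<in> borel_measurable borel" "v \<in> borel_measurable borel"
    unfolding u_def v_def by measurable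
  have ig: "integrable lborel (\<lambda>x. (cmod (g x))\<^sup>2)" using fin by (simp add: l2sq_finite_iff)
  have iu: "integrable lborel u"
    by (rule Bochner_Integration.integrable_bound[OF ig])
       (auto simp: u_def cmod_power2 abs_mult power2_eq_square[symmetric])
  have iv: "integrable lborel v"
    by (rule Bochner_Integration.integrable_bound[OF ig])
       (auto simp: v_def cmod_power2 abs_mult power2_eq_square[symmetric])
  have tr: "integrable lborel (\<lambda>x. w (x + t))" if "integrable lborel w" for w :: "'a \<Rightarrow> real" and t
    using integrable_lborel_affine[OF that, of 1 t] by (simp add: add.commute)
  let ?b = "\<lambda>n. 2 * (LINT x|lborel. \<bar>u x - u (x + h n)\<bar>) + 2 * (LINT x|lborel. \<bar>v x - v (x + h n)\<bar>)"
  have le: "l2sq (\<lambda>x. g x - g (x + h n)) \<le> ennreal (?b n)" for n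
  proof -
    have i: "integrable lborel (\<lambda>x. \<bar>u x - u (x + h n)\<bar>)" "integrable lborel (\<lambda>x. \<bar>v x - v (x + h n)\<bar>)"
      using iu iv by (intro Bochner_Integration.integrable_diff integrable_abs tr; simp)+
    have "l2sq (\<lambda>x. g x - g (x + h n)) \<le>
       (\<integral>\<^sup>+x. ennreal (2 * \<bar>u x - u (x + h n)\<bar> + 2 * \<bar>v x - v (x + h n)\<bar>) \<partial>lborel)"
      unfolding l2sq_def
    proof (intro nn_integral_mono ennreal_leI)
      fix x
      show "(cmod (g x - g (x + h n)))\<^sup>2 \<le> 2 * \<bar>u x - u (x + h n)\<bar> + 2 * \<bar>v x - v (x + h n)\<bar>"
        using square_diff_le_abs_diff[of "Re (g x)" "Re (g (x + h n))"]
          square_diff_le_abs_diff[of "Im (g x)" "Im (g (x + h n))"]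
        by (simp add: cmod_power2 u_def v_def)
    qed
    also have "\<dots> = ennreal (LINT x|lborel. (2 * \<bar>u x - u (x + h n)\<bar> + 2 * \<bar>v x - v (x + h n)\<bar>))"
      using i by (intro nn_integral_eq_integral) auto
    also have "(LINT x|lborel. (2 * \<bar>u x - u (x + h n)\<bar> + 2 * \<bar>v x - v (x + h n)\<bar>)) = ?b n"
      using i by simp
    finally show ?thesis .
  qed
  have "?b \<longlonglongrightarrow> 2 * 0 + 2 * 0"
    by (intro tendsto_intros tendsto_integral_translation iu iv h)
  then have "(\<lambda>n. ennreal (?b n)) \<longlonglongrightarrow> ennreal 0" by (intro tendsto_ennrealI) simp
  then show ?thesis
    by (intro ennreal_tendsto_0_le[OF _ le]) simp
qed

lemma integrable_mult_l2:
  fixes f g :: "'a::euclidean_space \<Rightarrow> complex"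
  assumes [measurable]: "f \<in> borel_measurable borel" "g \<in> borel_measurable borel"
    and fin: "l2sq f < \<infinity>" "l2sq g < \<infinity>"
  shows "integrable lborel (\<lambda>x. f x * g x)"
    and "cmod (LINT x|lborel. f x * g x)^2 \<le> (LINT x|lborel. (cmod (f x))\<^sup>2) * (LINT x|lborel. (cmod (g x))\<^sup>2)"
proof -
  have i: "integrable lborel (\<lambda>x. (cmod (f x))\<^sup>2)" "integrable lborel (\<lambda>x. (cmod (g x))\<^sup>2)"
    using fin by (simp_all add: l2sq_finite_iff)
  show 1: "integrable lborel (\<lambda>x. f x * g x)"
  proof (rule Bochner_Integration.integrable_bound[OF Bochner_Integration.integrable_add[OF i]])
    show "AE x in lborel. norm (f x * g x) \<le> norm ((cmod (f x))\<^sup>2 + (cmod (g x))\<^sup>2)"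
    proof (intro AE_I2)
      fix x
      have "2 * (cmod (f x) * cmod (g x)) \<le> (cmod (f x))\<^sup>2 + (cmod (g x))\<^sup>2"
        using sum_squares_bound[of "cmod (f x)" "cmod (g x)"] by simp
      moreover have "0 \<le> cmod (f x) * cmod (g x)" by simp
      ultimately show "norm (f x * g x) \<le> norm ((cmod (f x))\<^sup>2 + (cmod (g x))\<^sup>2)"
        unfolding norm_mult real_norm_def by linarith
    qed
  qed auto
  have "ennreal ((LINT x|lborel. cmod (f x * g x))\<^sup>2) = (\<integral>\<^sup>+x. ennreal (cmod (f x)) * ennreal (cmod (g x)) \<partial>lborel)\<^sup>2"
  proof -
    have "(\<integral>\<^sup>+x. ennreal (cmod (f x)) * ennreal (cmod (g x)) \<partial>lborel) = (\<integral>\<^sup>+x. ennreal (cmod (f x * g x)) \<partial>lborel)"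
      by (simp add: norm_mult ennreal_mult)
    also have "\<dots> = ennreal (LINT x|lborel. cmod (f x * g x))"
      using 1 by (intro nn_integral_eq_integral) auto
    finally show ?thesis by (simp add: ennreal_power)
  qed
  also have "\<dots> \<le> (\<integral>\<^sup>+x. ennreal (cmod (f x)) ^ 2 \<partial>lborel) * (\<integral>\<^sup>+x. ennreal (cmod (g x)) ^ 2 \<partial>lborel)"
    by (intro Cauchy_Schwarz_nn_integral) auto
  also have "\<dots> = ennreal ((LINT x|lborel. (cmod (f x))\<^sup>2) * (LINT x|lborel. (cmod (g x))\<^sup>2))"
    using i by (simp add: ennreal_power nn_integral_eq_integral ennreal_mult)
  finally have "(LINT x|lborel. cmod (f x * g x))\<^sup>2 \<le> (LINT x|lborel. (cmod (f x))\<^sup>2) * (LINT x|lborel. (cmod (g x))\<^sup>2)"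
    by (subst (asm) ennreal_le_iff) auto
  moreover have "cmod (LINT x|lborel. f x * g x)^2 \<le> (LINT x|lborel. cmod (f x * g x))\<^sup>2"
    by (intro power_mono) auto
  ultimately show "cmod (LINT x|lborel. f x * g x)^2 \<le> (LINT x|lborel. (cmod (f x))\<^sup>2) * (LINT x|lborel. (cmod (g x))\<^sup>2)"
    by linarith
qed

section \<open>The Fourier transform and convolution of integrable functions\<close>

definition fourier :: "('a::euclidean_space \<Rightarrow> complex) \<Rightarrow> 'a \<Rightarrow> complex" where
  "fourier g \<xi> = (LINT x|lborel. g x * cis (- 2 * pi * (x \<bullet> \<xi>)))"

definition conv :: "('a::euclidean_space \<Rightarrow> complex) \<Rightarrow> ('a \<Rightarrow> complex) \<Rightarrow> 'a \<Rightarrow> complex" where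
  "conv g h x = (LINT y|lborel. g y * h (x - y))"

lemma borel_measurable_fourier [measurable]:
  assumes [measurable]: "g \<in> borel_measurable borel"
  shows "fourier g \<in> borel_measurable borel"
  unfolding fourier_def by measurable

lemma borel_measurable_conv [measurable]:
  assumes [measurable]: "g \<in> borel_measurable borel" "h \<in> borel_measurable borel"
  shows "conv g h \<in> borel_measurable borel"
  unfolding conv_def by measurable

lemma integrable_mult_cis:
  assumes "integrable M g" and [measurable]: "\<theta> \<in> borel_measurable M"
  shows "integrable M (\<lambda>x. g x * cis (\<theta> x))"
  by (rule Bochner_Integration.integrable_bound[OF assms(1)])
     (use borel_measurable_integrable[OF assms(1)] in \<open>auto simp: norm_mult\<close>)

lemma cmod_fourier_le:
  assumes "integrable lborel g"
  shows "cmod (fourier g \<xi>) \<le> (LINT x|lborel. cmod (g x))"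
proof -
  have "cmod (fourier g \<xi>) \<le> (LINT x|lborel. cmod (g x * cis (- 2 * pi * (x \<bullet> \<xi>))))"
    unfolding fourier_def by (rule integral_norm_bound)
  then show ?thesis by (simp add: norm_mult)
qed

lemma integrable_conv_pair:
  fixes g h :: "'a::euclidean_space \<Rightarrow> complex"
  assumes g: "integrable lborel g" and h: "integrable lborel h"
  shows "integrable (lborel \<Otimes>\<^sub>M lborel) (\<lambda>(y, x). g y * h (x - y))"
proof -
  have [measurable]: "g \<in> borel_measurable borel" "h \<in> borel_measurable borel" using g h by auto
  have tr: "integrable lborel (\<lambda>x. h (x - t))" for t
    using integrable_lborel_affine[OF h, of 1 "-t"] by simp
  have e: "(LINT x|lborel. cmod (h (x - t))) = (LINT x|lborel. cmod (h x))" for t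
    by (subst (2) integral_lborel_affine[of _ 1 "-t"]) auto
  show ?thesis
  proof (rule lborel_pair.Fubini_integrable)
    show "integrable lborel (\<lambda>y. LINT x|lborel. norm (case (y, x) of (y, x) \<Rightarrow> g y * h (x - y)))"
      using g by (simp add: norm_mult e)
    show "AE y in lborel. integrable lborel (\<lambda>x. case (y, x) of (y, x) \<Rightarrow> g y * h (x - y))"
      using tr by auto
  qed auto
qed

lemma integrable_conv:
  fixes g h :: "'a::euclidean_space \<Rightarrow> complex"
  assumes g: "integrable lborel g" and h: "integrable lborel h"
  shows "integrable lborel (conv g h)"
  using lborel_pair.integrable_snd[OF integrable_conv_pair[OF g h]] by (simp add: conv_def[abs_def])

lemma fourier_translation:
  assumes [measurable]: "h \<in> borel_measurable borel"
  shows "fourier (\<lambda>x. h (x - t)) \<xi> = cis (- 2 * pi * (t \<bullet> \<xi>)) * fourier h \<xi>"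
proof -
  have "fourier (\<lambda>x. h (x - t)) \<xi> = (LINT x|lborel. h x * cis (- 2 * pi * ((t + x) \<bullet> \<xi>)))"
    unfolding fourier_def by (subst integral_lborel_affine[of _ 1 t]) auto
  also have "\<dots> = (LINT x|lborel. cis (- 2 * pi * (t \<bullet> \<xi>)) * (h x * cis (- 2 * pi * (x \<bullet> \<xi>))))"
    by (intro Bochner_Integration.integral_cong) (auto simp: inner_add_left cis_mult algebra_simps)
  finally show ?thesis by (simp add: fourier_def)
qed

lemma fourier_conv:
  fixes g h :: "'a::euclidean_space \<Rightarrow> complex"
  assumes g: "integrable lborel g" and h: "integrable lborel h"
  shows "fourier (conv g h) \<xi> = fourier g \<xi> * fourier h \<xi>"
proof -
  have [measurable]: "g \<in> borel_measurable borel" "h \<in> borel_measurable borel" using g h by auto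
  let ?c = "\<lambda>x. cis (- 2 * pi * (x \<bullet> \<xi>))"
  have i: "integrable (lborel \<Otimes>\<^sub>M lborel) (\<lambda>(y, x). g y * h (x - y) * ?c x)"
    using integrable_mult_cis[OF integrable_conv_pair[OF g h], of "\<lambda>p. - 2 * pi * (snd p \<bullet> \<xi>)"]
    by (simp add: case_prod_unfold)
  have "fourier (conv g h) \<xi> = (LINT x|lborel. LINT y|lborel. g y * h (x - y) * ?c x)"
    unfolding fourier_def conv_def by (subst integral_mult_left_zero) simp
  also have "\<dots> = (LINT y|lborel. LINT x|lborel. g y * h (x - y) * ?c x)"
    using lborel_pair.Fubini_integral[OF i] by simp
  also have "\<dots> = (LINT y|lborel. g y * fourier (\<lambda>x. h (x - y)) \<xi>)"
    unfolding fourier_def by (subst integral_mult_right_zero[symmetric]) (simp add: mult.assoc)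
  also have "\<dots> = (LINT y|lborel. (g y * ?c y) * fourier h \<xi>)"
    by (simp add: fourier_translation mult.assoc)
  finally show ?thesis by (simp add: fourier_def)
qed

text \<open>Fubini for A(z) k(\<xi>) times the phase, which is symmetric in z and \<xi>. With a
  Gaussian as k it takes the place of an inversion formula.\<close>

lemma fourier_multiplication_formula:
  fixes A k :: "'a::euclidean_space \<Rightarrow> complex"
  assumes A: "integrable lborel A" and k: "integrable lborel k"
  shows "(LINT \<xi>|lborel. fourier A \<xi> * k \<xi>) = (LINT z|lborel. A z * fourier k z)"
proof -
  have [measurable]: "A \<in> borel_measurable borel" "k \<in> borel_measurable borel" using A k by auto
  have i0: "integrable (lborel \<Otimes>\<^sub>M lborel) (\<lambda>(z, \<xi>). A z * k \<xi>)"
    by (rule lborel_pair.Fubini_integrable) (use A k in \<open>auto simp: norm_mult\<close>)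
  have i: "integrable (lborel \<Otimes>\<^sub>M lborel) (\<lambda>(z, \<xi>). A z * k \<xi> * cis (- 2 * pi * (z \<bullet> \<xi>)))"
    using integrable_mult_cis[OF i0, of "\<lambda>p. - 2 * pi * (fst p \<bullet> snd p)"]
    by (simp add: case_prod_unfold)
  have "(LINT \<xi>|lborel. fourier A \<xi> * k \<xi>) = (LINT \<xi>|lborel. LINT z|lborel. A z * k \<xi> * cis (- 2 * pi * (z \<bullet> \<xi>)))"
    unfolding fourier_def by (subst integral_mult_left_zero[symmetric]) (simp add: mult_ac)
  also have "\<dots> = (LINT z|lborel. LINT \<xi>|lborel. A z * k \<xi> * cis (- 2 * pi * (z \<bullet> \<xi>)))"
    using lborel_pair.Fubini_integral[OF i] by simp
  also have "\<dots> = (LINT z|lborel. A z * fourier k z)"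
    unfolding fourier_def by (subst integral_mult_right_zero[symmetric]) (simp add: mult.assoc inner_commute)
  finally show ?thesis .
qed

section \<open>Gaussians and their transforms\<close>

lemma gaussian_fourier_real:
  fixes t :: real
  shows "integrable lborel (\<lambda>x::real. complex_of_real (exp (- pi * x\<^sup>2)) * cis (- 2 * pi * (x * t)))"
    and "(LINT x|lborel. complex_of_real (exp (- pi * x\<^sup>2)) * cis (- 2 * pi * (x * t))) = exp (- pi * t\<^sup>2)"
proof -
  \<comment> \<open>At this scale the standard normal density at c x is exp (- pi x^2) / c, so the
    known characteristic function gives the transform. The frequency - c t and the substitution
    together put c^2 = 2 pi into the phase.\<close>
  define c where "c = sqrt (2 * pi)"
  have c: "c > 0" "c\<^sup>2 = 2 * pi" by (auto simp: c_def)
  have sd: "std_normal_density (c * x) = exp (- pi * x\<^sup>2) / c" for x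
    by (simp add: std_normal_density_def c_def power_mult_distrib)
  have "integrable lborel (\<lambda>x. std_normal_density (0 + c * x))"
    using c by (intro lborel_integrable_real_affine) auto
  then have "integrable lborel (\<lambda>x. c * std_normal_density (0 + c * x))" by simp
  then have ii: "integrable lborel (\<lambda>x. exp (- pi * x\<^sup>2))" using c by (simp add: sd)
  show "integrable lborel (\<lambda>x::real. complex_of_real (exp (- pi * x\<^sup>2)) * cis (- 2 * pi * (x * t)))"
    by (intro integrable_mult_cis integrable_of_real ii) auto
  have "char std_normal_distribution (- c * t) = (LINT x|lborel. std_normal_density x *\<^sub>R iexp (- c * t * x))"
    unfolding char_def by (subst integral_density) auto
  also have "\<dots> = c *\<^sub>R (LINT x|lborel. std_normal_density (0 + c * x) *\<^sub>R iexp (- c * t * (0 + c * x)))"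
    using c by (subst lborel_integral_real_affine[of c _ 0]) auto
  also have "\<dots> = (LINT x|lborel. c *\<^sub>R std_normal_density (c * x) *\<^sub>R iexp (- c * t * (c * x)))"
    by (subst integral_scaleR_right) simp
  also have "\<dots> = (LINT x|lborel. complex_of_real (exp (- pi * x\<^sup>2)) * cis (- 2 * pi * (x * t)))"
  proof (intro Bochner_Integration.integral_cong refl)
    fix x
    have a: "- c * t * (c * x) = - 2 * pi * (x * t)"
      using c(2) by (simp add: power2_eq_square)
    then show "c *\<^sub>R std_normal_density (c * x) *\<^sub>R iexp (- c * t * (c * x)) =
      complex_of_real (exp (- pi * x\<^sup>2)) * cis (- 2 * pi * (x * t))"
      unfolding a sd cis_conv_exp using c by (simp add: scaleR_conv_of_real)
  qed
  finally have "(LINT x|lborel. complex_of_real (exp (- pi * x\<^sup>2)) * cis (- 2 * pi * (x * t))) =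
      char std_normal_distribution (- c * t)" ..
  also have "\<dots> = exp (- pi * t\<^sup>2)"
    using c by (simp add: char_std_normal_distribution power_mult_distrib)
  finally show "(LINT x|lborel. complex_of_real (exp (- pi * x\<^sup>2)) * cis (- 2 * pi * (x * t))) = exp (- pi * t\<^sup>2)" .
qed

definition gaussian :: "'a::euclidean_space \<Rightarrow> real" where
  "gaussian x = exp (- pi * (norm x)\<^sup>2)"

lemma gaussian_mult_cis_eq_prod:
  "complex_of_real (gaussian x) * cis (- 2 * pi * (x \<bullet> \<xi>)) =
   (\<Prod>b\<in>Basis. complex_of_real (exp (- pi * (x \<bullet> b)\<^sup>2)) * cis (- 2 * pi * ((x \<bullet> b) * (\<xi> \<bullet> b))))"
proof -
  have 1: "(norm x)\<^sup>2 = (\<Sum>b\<in>Basis. (x \<bullet> b)\<^sup>2)"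
    by (simp only: power2_norm_eq_inner) (subst euclidean_inner, simp add: power2_eq_square)
  have 2: "x \<bullet> \<xi> = (\<Sum>b\<in>Basis. (x \<bullet> b) * (\<xi> \<bullet> b))" by (rule euclidean_inner)
  have "complex_of_real (gaussian x) = (\<Prod>b\<in>Basis. complex_of_real (exp (- pi * (x \<bullet> b)\<^sup>2)))"
    unfolding gaussian_def 1 by (simp add: sum_distrib_left exp_sum)
  moreover have "cis (- 2 * pi * (x \<bullet> \<xi>)) = (\<Prod>b\<in>Basis. cis (- 2 * pi * ((x \<bullet> b) * (\<xi> \<bullet> b))))"
    unfolding 2 by (simp add: cis_conv_exp sum_distrib_left exp_sum[symmetric])
  ultimately show ?thesis by (simp add: prod.distrib)
qed

text \<open>The factorisation over coordinates reduces both claims to the product measure and the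
  one-dimensional case; integrability is the case \<xi> = 0, where the phase is 1.\<close>

lemma
  shows integrable_gaussian: "integrable lborel (\<lambda>x::'a::euclidean_space. complex_of_real (gaussian x))"
    and fourier_gaussian: "fourier (\<lambda>x::'a. complex_of_real (gaussian x)) \<xi> = gaussian \<xi>"
proof -
  interpret product_sigma_finite "\<lambda>_::'a. lborel :: real measure" ..
  let ?f = "\<lambda>\<xi> (b::'a) (t::real). complex_of_real (exp (- pi * t\<^sup>2)) * cis (- 2 * pi * (t * (\<xi> \<bullet> b)))"
  let ?g = "\<lambda>\<xi> (x::'a). complex_of_real (gaussian x) * cis (- 2 * pi * (x \<bullet> \<xi>))"
  have [measurable]: "(gaussian :: 'a \<Rightarrow> real) \<in> borel_measurable borel" unfolding gaussian_def[abs_def] by measurable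
  have eq: "?g \<xi> (\<Sum>b\<in>Basis. y b *\<^sub>R b) = (\<Prod>b\<in>Basis. ?f \<xi> b (y b))" for y \<xi>
    unfolding gaussian_mult_cis_eq_prod by (intro prod.cong refl) simp
  have "integrable (\<Pi>\<^sub>M b\<in>Basis. lborel) (\<lambda>y. \<Prod>b\<in>Basis. ?f 0 b (y b))"
    by (intro product_integrable_prod gaussian_fourier_real) auto
  then have "integrable lborel (?g 0)"
    unfolding eq[symmetric] by (subst lborel_eq) (subst integrable_distr_eq, auto)
  then show "integrable lborel (\<lambda>x::'a. complex_of_real (gaussian x))" by simp
  have "fourier (\<lambda>x::'a. complex_of_real (gaussian x)) \<xi> = (LINT y|(\<Pi>\<^sub>M b\<in>Basis. lborel). (\<Prod>b\<in>Basis. ?f \<xi> b (y b)))"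
    unfolding fourier_def eq[symmetric] by (subst lborel_eq) (subst integral_distr, auto)
  also have "\<dots> = (\<Prod>b\<in>Basis. complex_of_real (exp (- pi * (\<xi> \<bullet> b)\<^sup>2)))"
    by (subst product_integral_prod) (use gaussian_fourier_real in \<open>auto intro!: prod.cong simp del: mult_minus_left\<close>)
  also have "\<dots> = gaussian \<xi>"
    using gaussian_mult_cis_eq_prod[of \<xi> 0] by simp
  finally show "fourier (\<lambda>x::'a. complex_of_real (gaussian x)) \<xi> = gaussian \<xi>" .
qed

section \<open>Plancherel's theorem\<close>

lemma gaussian_nonneg [simp]: "0 \<le> gaussian x"
  by (simp add: gaussian_def)

lemma borel_measurable_gaussian [measurable]: "gaussian \<in> borel_measurable borel"
  unfolding gaussian_def[abs_def] by measurable

lemma integrable_gaussian_real: "integrable lborel (gaussian :: 'a::euclidean_space \<Rightarrow> real)"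
  using integrable_Re[OF integrable_gaussian] by simp

lemma integral_gaussian: "(LINT x|lborel. gaussian (x::'a::euclidean_space)) = 1"
proof -
  have "complex_of_real (LINT x|lborel. gaussian (x::'a)) = fourier (\<lambda>x::'a. complex_of_real (gaussian x)) 0"
    by (simp add: fourier_def)
  then show ?thesis by (simp add: fourier_gaussian) (simp add: gaussian_def)
qed

text \<open>The multiplication formula for a dilated Gaussian; after the substitution z = s w the
  Jacobian cancels the factor in the dilated transform. For an autocorrelation, as s tends to 0, the
  left side tends to the integral of the transform and the right side to A(0).\<close>

lemma gaussian_summation:
  fixes A :: "'a::euclidean_space \<Rightarrow> complex"
  assumes A: "integrable lborel A" and s: "s > 0"
  shows "(LINT \<xi>|lborel. fourier A \<xi> * gaussian (s *\<^sub>R \<xi>)) = (LINT w|lborel. A (s *\<^sub>R w) * gaussian w)"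
proof -
  have [measurable]: "A \<in> borel_measurable borel" using A by auto
  have i: "integrable lborel (\<lambda>\<xi>::'a. complex_of_real (gaussian (s *\<^sub>R \<xi>)))"
    using integrable_lborel_affine[OF integrable_gaussian, of s 0] s by simp
  have F: "fourier (\<lambda>\<xi>::'a. complex_of_real (gaussian (s *\<^sub>R \<xi>))) (s *\<^sub>R w) * s ^ DIM('a) = gaussian w" for w
  proof -
    have "complex_of_real (gaussian w) = fourier (\<lambda>x. complex_of_real (gaussian x)) w"
      by (simp add: fourier_gaussian)
    also have "\<dots> = s ^ DIM('a) *\<^sub>R (LINT x|lborel. gaussian (s *\<^sub>R x) * cis (- 2 * pi * (s *\<^sub>R x \<bullet> w)))"
      unfolding fourier_def using s by (subst integral_lborel_affine[of _ s 0]) auto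
    finally show ?thesis by (simp add: fourier_def scaleR_conv_of_real)
  qed
  have "(LINT \<xi>|lborel. fourier A \<xi> * gaussian (s *\<^sub>R \<xi>)) =
      (LINT z|lborel. A z * fourier (\<lambda>\<xi>. complex_of_real (gaussian (s *\<^sub>R \<xi>))) z)"
    by (rule fourier_multiplication_formula[OF A i])
  also have "\<dots> = s ^ DIM('a) *\<^sub>R (LINT w|lborel. A (s *\<^sub>R w) * fourier (\<lambda>\<xi>. complex_of_real (gaussian (s *\<^sub>R \<xi>))) (s *\<^sub>R w))"
    using s by (subst integral_lborel_affine[of _ s 0]) auto
  also have "\<dots> = (LINT w|lborel. A (s *\<^sub>R w) * (fourier (\<lambda>\<xi>. complex_of_real (gaussian (s *\<^sub>R \<xi>))) (s *\<^sub>R w) * s ^ DIM('a)))"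
    by (subst integral_scaleR_right[symmetric]) (simp add: scaleR_conv_of_real mult_ac)
  also have "\<dots> = (LINT w|lborel. A (s *\<^sub>R w) * gaussian w)" unfolding F ..
  finally show ?thesis .
qed

lemma fourier_cnj_reflect:
  fixes g :: "'a::euclidean_space \<Rightarrow> complex"
  assumes g: "integrable lborel g"
  shows "integrable lborel (\<lambda>y. cnj (g (- y)))" "fourier (\<lambda>y. cnj (g (- y))) \<xi> = cnj (fourier g \<xi>)"
proof -
  have [measurable]: "g \<in> borel_measurable borel" using g by auto
  show "integrable lborel (\<lambda>y. cnj (g (- y)))"
    using integrable_lborel_affine[OF g, of "-1" 0] by simp
  have "fourier (\<lambda>y. cnj (g (- y))) \<xi> = (LINT x|lborel. cnj (g x * cis (- 2 * pi * (x \<bullet> \<xi>))))"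
    unfolding fourier_def by (subst integral_lborel_affine[of _ "-1" 0]) (auto simp: cis_cnj)
  then show "fourier (\<lambda>y. cnj (g (- y))) \<xi> = cnj (fourier g \<xi>)"
    by (simp only: fourier_def Bochner_Integration.integral_cnj)
qed

text \<open>Its transform is \<open>\<bar>fourier g\<bar>\<^sup>2\<close>, so Plancherel is Fourier inversion at 0, by Gaussian summation.\<close>
definition autocorrelation :: "('a::euclidean_space \<Rightarrow> complex) \<Rightarrow> 'a \<Rightarrow> complex" where
  "autocorrelation g = conv g (\<lambda>y. cnj (g (- y)))"

lemma
  assumes g: "integrable lborel g"
  shows integrable_autocorrelation: "integrable lborel (autocorrelation g)"
    and fourier_autocorrelation: "fourier (autocorrelation g) \<xi> = (cmod (fourier g \<xi>))\<^sup>2"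
proof -
  show "integrable lborel (autocorrelation g)"
    unfolding autocorrelation_def by (intro integrable_conv g fourier_cnj_reflect)
  have "fourier (autocorrelation g) \<xi> = fourier g \<xi> * cnj (fourier g \<xi>)"
    unfolding autocorrelation_def
    by (simp only: fourier_conv[OF g fourier_cnj_reflect(1)[OF g]] fourier_cnj_reflect(2)[OF g])
  then show "fourier (autocorrelation g) \<xi> = (cmod (fourier g \<xi>))\<^sup>2"
    by (simp only: complex_norm_square)
qed

lemma l2sq_cnj_translation:
  assumes [measurable]: "g \<in> borel_measurable borel"
  shows "l2sq (\<lambda>x. cnj (g (x + t))) = l2sq g"
  using l2sq_translation[OF assms, of t] by (simp add: l2sq_def)

text \<open>The autocorrelation is the inner product of g with its translate by z. Cauchy-Schwarz
  against the increment of g controls the oscillation at 0; against the translate it gives the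
  constant that dominates the Gaussian means; z = 0 identifies their limit.\<close>

lemma autocorrelation_diff:
  fixes g :: "'a::euclidean_space \<Rightarrow> complex"
  assumes [measurable]: "g \<in> borel_measurable borel" and fin: "l2sq g < \<infinity>"
  shows "ennreal ((cmod (autocorrelation g z - autocorrelation g 0))\<^sup>2) \<le> l2sq g * l2sq (\<lambda>x. g x - g (x - z))"
    and "cmod (autocorrelation g z) \<le> (LINT x|lborel. (cmod (g x))\<^sup>2)"
    and "autocorrelation g 0 = (LINT x|lborel. (cmod (g x))\<^sup>2)"
proof -
  have e: "autocorrelation g z = (LINT y|lborel. g y * cnj (g (y + - z)))" for z
    unfolding autocorrelation_def conv_def by simp
  have fin2: "l2sq (\<lambda>x. cnj (g (x + t))) < \<infinity>" for t using fin by (simp add: l2sq_cnj_translation)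
  have i: "integrable lborel (\<lambda>y. g y * cnj (g (y + t)))" for t
    by (intro integrable_mult_l2 fin fin2) auto
  have n: "(LINT x|lborel. (cmod (cnj (g (x + t))))\<^sup>2) = (LINT x|lborel. (cmod (g x))\<^sup>2)" for t
    by (subst (2) integral_lborel_affine[of _ 1 t]) (auto simp: add.commute)
  have "cmod (autocorrelation g z)^2 \<le> (LINT x|lborel. (cmod (g x))\<^sup>2) * (LINT x|lborel. (cmod (cnj (g (x + - z))))\<^sup>2)"
    unfolding e by (intro integrable_mult_l2 fin fin2) auto
  then show "cmod (autocorrelation g z) \<le> (LINT x|lborel. (cmod (g x))\<^sup>2)"
    unfolding n power2_eq_square[symmetric] by (rule power2_le_imp_le) auto
  show 0: "autocorrelation g 0 = (LINT x|lborel. (cmod (g x))\<^sup>2)"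
  proof -
    have "autocorrelation g 0 = (LINT y|lborel. complex_of_real ((cmod (g y))\<^sup>2))"
      unfolding e by (simp only: complex_norm_square) simp
    then show ?thesis by (simp only: integral_complex_of_real)
  qed
  have fd: "l2sq (\<lambda>x. cnj (g (x + - z) - g x)) < \<infinity>"
  proof -
    have j: "integrable lborel (\<lambda>x. (cmod (g x))\<^sup>2)" "integrable lborel (\<lambda>x. (cmod (g (x + - z)))\<^sup>2)"
      using fin fin2[of "-z"] by (simp_all add: l2sq_finite_iff)
    have "integrable lborel (\<lambda>x. (cmod (cnj (g (x + - z) - g x)))\<^sup>2)"
    proof (rule Bochner_Integration.integrable_bound)
      show "integrable lborel (\<lambda>x. 2 * (cmod (g x))\<^sup>2 + 2 * (cmod (g (x + - z)))\<^sup>2)"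
        using j by auto
      have "(cmod (cnj (a - b)))\<^sup>2 \<le> 2 * (cmod b)\<^sup>2 + 2 * (cmod a)\<^sup>2" for a b :: complex
      proof -
        have "(cmod (cnj (a - b)))\<^sup>2 \<le> (cmod a + cmod b)\<^sup>2"
          by (intro power_mono) (auto simp: norm_triangle_ineq4 simp del: complex_cnj_diff)
        also have "\<dots> \<le> 2 * (cmod b)\<^sup>2 + 2 * (cmod a)\<^sup>2"
          using sum_squares_bound[of "cmod a" "cmod b"] by (simp add: power2_sum)
        finally show ?thesis .
      qed
      then show "AE x in lborel. norm ((cmod (cnj (g (x + - z) - g x)))\<^sup>2)
          \<le> norm (2 * (cmod (g x))\<^sup>2 + 2 * (cmod (g (x + - z)))\<^sup>2)" by auto
    qed auto
    then show ?thesis by (subst infinity_ennreal_def, subst l2sq_finite_iff) auto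
  qed
  have "autocorrelation g z - autocorrelation g 0 = (LINT y|lborel. g y * cnj (g (y + - z)) - g y * cnj (g (y + 0)))"
    unfolding e using i[of "- z"] i[of 0] by (subst Bochner_Integration.integral_diff) auto
  also have "\<dots> = (LINT y|lborel. g y * cnj (g (y + - z) - g y))"
    by (simp add: algebra_simps)
  finally have d: "autocorrelation g z - autocorrelation g 0 = (LINT y|lborel. g y * cnj (g (y + - z) - g y))" .
  have "(cmod (autocorrelation g z - autocorrelation g 0))\<^sup>2 \<le>
      (LINT x|lborel. (cmod (g x))\<^sup>2) * (LINT x|lborel. (cmod (cnj (g (x + - z) - g x)))\<^sup>2)"
    unfolding d by (intro integrable_mult_l2 fin fd) auto
  then have "ennreal ((cmod (autocorrelation g z - autocorrelation g 0))\<^sup>2) \<le>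
      ennreal (LINT x|lborel. (cmod (g x))\<^sup>2) * ennreal (LINT x|lborel. (cmod (cnj (g (x + - z) - g x)))\<^sup>2)"
    by (subst ennreal_mult[symmetric]) auto
  also have "\<dots> = l2sq g * l2sq (\<lambda>x. cnj (g (x + - z) - g x))"
    using fin fd by (simp add: l2sq_eq_integral)
  also have "l2sq (\<lambda>x. cnj (g (x + - z) - g x)) = l2sq (\<lambda>x. g x - g (x - z))"
    unfolding l2sq_def complex_mod_cnj by (simp add: norm_minus_commute)
  finally show "ennreal ((cmod (autocorrelation g z - autocorrelation g 0))\<^sup>2) \<le> l2sq g * l2sq (\<lambda>x. g x - g (x - z))" .
qed

lemma tendsto_autocorrelation:
  fixes g :: "'a::euclidean_space \<Rightarrow> complex"
  assumes [measurable]: "g \<in> borel_measurable borel" and fin: "l2sq g < \<infinity>" and h: "h \<longlonglongrightarrow> (0::'a)"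
  shows "(\<lambda>n. autocorrelation g (h n)) \<longlonglongrightarrow> autocorrelation g 0"
proof -
  have "(\<lambda>n. - h n) \<longlonglongrightarrow> 0" using tendsto_minus[OF h] by simp
  then have "(\<lambda>n. l2sq (\<lambda>x. g x - g (x + - h n))) \<longlonglongrightarrow> 0"
    by (intro tendsto_l2sq_translation fin) auto
  then have "(\<lambda>n. l2sq g * l2sq (\<lambda>x. g x - g (x - h n))) \<longlonglongrightarrow> l2sq g * 0"
    using fin by (intro tendsto_mult_ennreal tendsto_const) auto
  then have "(\<lambda>n. ennreal ((cmod (autocorrelation g (h n) - autocorrelation g 0))\<^sup>2)) \<longlonglongrightarrow> 0"
    by (intro ennreal_tendsto_0_le[OF _ autocorrelation_diff(1)[OF assms(1) fin]]) simp
  then have "(\<lambda>n. (cmod (autocorrelation g (h n) - autocorrelation g 0))\<^sup>2) \<longlonglongrightarrow> 0"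
    by (simp add: tendsto_ennreal_iff flip: ennreal_0)
  then have "(\<lambda>n. sqrt ((cmod (autocorrelation g (h n) - autocorrelation g 0))\<^sup>2)) \<longlonglongrightarrow> sqrt 0"
    by (rule tendsto_real_sqrt)
  then show ?thesis
    by (simp add: tendsto_norm_zero_iff LIM_zero_iff)
qed

text \<open>The Gaussian means \<open>?J n\<close> of the squared transform are evaluated twice. By
  \<open>gaussian_summation\<close> and dominated convergence they tend to A(0), the square norm of
  g; since the weights increase to 1, monotone convergence makes them tend to
  \<open>l2sq (fourier g)\<close>.\<close>

theorem plancherel:
  fixes g :: "'a::euclidean_space \<Rightarrow> complex"
  assumes g: "integrable lborel g" and fin: "l2sq g < \<infinity>"
  shows "l2sq (fourier g) = l2sq g"
proof -
  have [measurable]: "g \<in> borel_measurable borel" using g by auto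
  define A where "A = autocorrelation g"
  have [measurable]: "A \<in> borel_measurable borel" 
    using integrable_autocorrelation[OF g] unfolding A_def by auto
  define s where "s n = inverse (real (Suc n))" for n
  have s: "s n > 0" for n by (simp add: s_def)
  have s0: "s \<longlonglongrightarrow> 0" unfolding s_def by (rule LIMSEQ_inverse_real_of_nat)
  let ?I = "LINT x|lborel. (cmod (g x))\<^sup>2"
  have A0: "A 0 = ?I" and Ab: "cmod (A z) \<le> ?I" for z
    unfolding A_def using fin by (auto intro: autocorrelation_diff)
  let ?J = "\<lambda>n. LINT \<xi>|lborel. (cmod (fourier g \<xi>))\<^sup>2 * gaussian (s n *\<^sub>R \<xi>)"
  have J: "complex_of_real (?J n) = (LINT w|lborel. A (s n *\<^sub>R w) * gaussian w)" for n
  proof -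
    have "complex_of_real (?J n) = (LINT \<xi>|lborel. fourier A \<xi> * gaussian (s n *\<^sub>R \<xi>))"
      unfolding A_def fourier_autocorrelation[OF g] by (simp only: integral_complex_of_real[symmetric] of_real_mult)
    then show ?thesis
      using gaussian_summation[OF integrable_autocorrelation[OF g] s, of n] by (simp add: A_def)
  qed
  have "(\<lambda>n. LINT w|lborel. A (s n *\<^sub>R w) * gaussian w) \<longlonglongrightarrow> (LINT (w::'a)|lborel. A 0 * gaussian w)"
  proof (rule integral_dominated_convergence[where w="\<lambda>w. ?I * gaussian w"])
    show "integrable lborel (\<lambda>w::'a. ?I * gaussian w)" using integrable_gaussian_real[where 'a='a] by simp
    show "AE w::'a in lborel. (\<lambda>n. A (s n *\<^sub>R w) * gaussian w) \<longlonglongrightarrow> A 0 * gaussian w"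
    proof (intro AE_I2 tendsto_mult tendsto_const)
      fix w :: 'a
      have "(\<lambda>n. s n *\<^sub>R w) \<longlonglongrightarrow> 0 *\<^sub>R w" by (intro tendsto_intros s0)
      then show "(\<lambda>n. A (s n *\<^sub>R w)) \<longlonglongrightarrow> A 0"
        unfolding A_def using fin by (intro tendsto_autocorrelation) auto
    qed
    show "AE w::'a in lborel. norm (A (s n *\<^sub>R w) * gaussian w) \<le> ?I * gaussian w" for n
      using Ab by (auto simp: norm_mult intro!: mult_right_mono)
  qed auto
  also have "(LINT (w::'a)|lborel. A 0 * gaussian w) = complex_of_real ?I"
    using integral_gaussian[where 'a='a] by (simp add: A0)
  finally have "(\<lambda>n. complex_of_real (?J n)) \<longlonglongrightarrow> complex_of_real ?I" unfolding J .
  then have lim: "?J \<longlonglongrightarrow> ?I" by (simp add: tendsto_of_real_iff)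
  \<comment> \<open>The L1 norm bounds the transform, so each Gaussian mean is a finite integral and
    agrees with its \<open>ennreal\<close> version.\<close>
  define B where "B = (LINT x|lborel. cmod (g x))"
  have eq: "(\<integral>\<^sup>+\<xi>. ennreal ((cmod (fourier g \<xi>))\<^sup>2 * gaussian (s n *\<^sub>R \<xi>)) \<partial>lborel) = ennreal (?J n)" for n
  proof (rule nn_integral_eq_integral)
    have ig: "integrable lborel (\<lambda>\<xi>::'a. B\<^sup>2 * gaussian (s n *\<^sub>R \<xi>))"
      using integrable_lborel_affine[OF integrable_gaussian_real[where 'a='a], of "s n" 0] s[of n] by simp
    show "integrable lborel (\<lambda>\<xi>. (cmod (fourier g \<xi>))\<^sup>2 * gaussian (s n *\<^sub>R \<xi>))"
      by (rule Bochner_Integration.integrable_bound[OF ig])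
         (auto simp: abs_mult B_def intro!: mult_right_mono power_mono cmod_fourier_le g)
  qed auto
  have "(\<lambda>n. \<integral>\<^sup>+\<xi>. ennreal ((cmod (fourier g \<xi>))\<^sup>2 * gaussian (s n *\<^sub>R \<xi>)) \<partial>lborel) \<longlonglongrightarrow> l2sq (fourier g)"
    unfolding l2sq_def
  proof (rule nn_integral_LIMSEQ)
    show "incseq (\<lambda>n \<xi>. ennreal ((cmod (fourier g \<xi>))\<^sup>2 * gaussian (s n *\<^sub>R \<xi>)))"
    proof (intro incseq_SucI le_funI ennreal_leI mult_left_mono)
      fix n and \<xi> :: 'a
      have "s (Suc n) \<le> s n" by (simp add: s_def field_simps)
      then have "norm (s (Suc n) *\<^sub>R \<xi>) \<le> norm (s n *\<^sub>R \<xi>)"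
        using s[of n] s[of "Suc n"] by (auto intro!: mult_right_mono)
      then have "(norm (s (Suc n) *\<^sub>R \<xi>))\<^sup>2 \<le> (norm (s n *\<^sub>R \<xi>))\<^sup>2" by (intro power_mono) auto
      then show "gaussian (s n *\<^sub>R \<xi>) \<le> gaussian (s (Suc n) *\<^sub>R \<xi>)"
        unfolding gaussian_def by simp
    qed simp
    show "(\<lambda>n. ennreal ((cmod (fourier g \<xi>))\<^sup>2 * gaussian (s n *\<^sub>R \<xi>))) \<longlonglongrightarrow> ennreal ((cmod (fourier g \<xi>))\<^sup>2)" for \<xi>
    proof (rule tendsto_ennrealI)
      have "(\<lambda>n. (cmod (fourier g \<xi>))\<^sup>2 * exp (- pi * (norm (s n *\<^sub>R \<xi>))\<^sup>2)) \<longlonglongrightarrow>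
         (cmod (fourier g \<xi>))\<^sup>2 * exp (- pi * (norm (0 *\<^sub>R \<xi>))\<^sup>2)"
        by (intro tendsto_intros s0)
      then show "(\<lambda>n. (cmod (fourier g \<xi>))\<^sup>2 * gaussian (s n *\<^sub>R \<xi>)) \<longlonglongrightarrow> (cmod (fourier g \<xi>))\<^sup>2"
        by (simp add: gaussian_def)
    qed
  qed auto
  moreover have "(\<lambda>n. \<integral>\<^sup>+\<xi>. ennreal ((cmod (fourier g \<xi>))\<^sup>2 * gaussian (s n *\<^sub>R \<xi>)) \<partial>lborel) \<longlonglongrightarrow> ennreal ?I"
    unfolding eq by (intro tendsto_ennrealI lim)
  ultimately have "l2sq (fourier g) = ennreal ?I" by (rule LIMSEQ_unique)
  then show ?thesis using fin by (simp add: l2sq_eq_integral)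
qed

section \<open>The L2 Fourier transform\<close>

lemma ennreal_tendsto_zeroI:
  fixes f :: "nat \<Rightarrow> ennreal"
  assumes "\<And>e. 0 < e \<Longrightarrow> \<forall>\<^sub>F n in sequentially. f n \<le> ennreal e"
  shows "f \<longlonglongrightarrow> 0"
proof (rule tendsto_zero_ennreal)
  fix e :: real assume "0 < e"
  then have "\<forall>\<^sub>F n in sequentially. f n \<le> ennreal (e / 2)" "ennreal (e / 2) < ennreal e"
    by (auto intro!: assms ennreal_lessI)
  then show "\<forall>\<^sub>F n in sequentially. f n < ennreal e"
    by (auto elim: eventually_mono)
qed

lemma ennreal_le_suminf:
  fixes a :: "nat \<Rightarrow> ennreal"
  shows "a k \<le> suminf a"
  using sum_le_suminf[of a "{k}"] by simp

lemma nn_integral_fatou_bound: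
  fixes u :: "nat \<Rightarrow> 'a \<Rightarrow> ennreal"
  assumes [measurable]: "\<And>n. u n \<in> borel_measurable M"
    and lim: "AE x in M. (\<lambda>n. u n x) \<longlonglongrightarrow> v x"
    and bd: "\<forall>\<^sub>F n in sequentially. (\<integral>\<^sup>+x. u n x \<partial>M) \<le> b + c n" and c: "c \<longlonglongrightarrow> 0"
  shows "(\<integral>\<^sup>+x. v x \<partial>M) \<le> b"
proof -
  have "(\<integral>\<^sup>+x. v x \<partial>M) = (\<integral>\<^sup>+x. liminf (\<lambda>n. u n x) \<partial>M)"
    by (rule nn_integral_cong_AE) (use lim in \<open>auto dest!: lim_imp_Liminf[rotated]\<close>)
  also have "\<dots> \<le> liminf (\<lambda>n. \<integral>\<^sup>+x. u n x \<partial>M)"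
    by (rule nn_integral_liminf) auto
  also have "\<dots> \<le> liminf (\<lambda>n. b + c n)"
    by (rule Liminf_mono[OF bd])
  also have "\<dots> = b + 0"
    by (intro lim_imp_Liminf tendsto_add tendsto_const c) auto
  finally show ?thesis by simp
qed

lemma cmod_square_le:
  fixes a b :: complex
  shows "(cmod a)\<^sup>2 \<le> 2 * (cmod b)\<^sup>2 + 2 * (cmod (a - b))\<^sup>2"
proof -
  have "cmod a \<le> cmod b + cmod (a - b)"
    using norm_triangle_ineq[of b "a - b"] by simp
  then have "(cmod a)\<^sup>2 \<le> (cmod b + cmod (a - b))\<^sup>2" by (intro power_mono) auto
  also have "\<dots> \<le> 2 * (cmod b)\<^sup>2 + 2 * (cmod (a - b))\<^sup>2"
    using sum_squares_bound[of "cmod b" "cmod (a - b)"] by (simp add: power2_sum)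
  finally show ?thesis .
qed

text \<open>Boundedness of the weight lets the error be measured by the unweighted distance of g and
  h; the price is the factor 2 on the main term.\<close>

lemma nn_integral_weighted_square_le:
  fixes w :: "'a::euclidean_space \<Rightarrow> ennreal"
  assumes [measurable]: "w \<in> borel_measurable borel" "g \<in> borel_measurable borel" "h \<in> borel_measurable borel"
    and w: "\<And>x. w x \<le> W"
  shows "(\<integral>\<^sup>+x. w x * ennreal ((cmod (g x))\<^sup>2) \<partial>lborel) \<le>
    2 * (\<integral>\<^sup>+x. w x * ennreal ((cmod (h x))\<^sup>2) \<partial>lborel) + 2 * W * l2sq (\<lambda>x. g x - h x)"
proof -
  have "(\<integral>\<^sup>+x. w x * ennreal ((cmod (g x))\<^sup>2) \<partial>lborel) \<le>
     (\<integral>\<^sup>+x. 2 * (w x * ennreal ((cmod (h x))\<^sup>2)) + 2 * W * ennreal ((cmod (g x - h x))\<^sup>2) \<partial>lborel)"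
  proof (rule nn_integral_mono)
    fix x
    have "w x * ennreal ((cmod (g x))\<^sup>2) \<le> w x * (2 * ennreal ((cmod (h x))\<^sup>2) + 2 * ennreal ((cmod (g x - h x))\<^sup>2))"
      using cmod_square_le[of "g x" "h x"]
      by (intro mult_left_mono) (auto simp flip: ennreal_plus ennreal_mult' simp: ennreal_mult'[symmetric] ennreal_numeral[symmetric] simp del: ennreal_numeral intro!: ennreal_leI)
    also have "\<dots> = 2 * (w x * ennreal ((cmod (h x))\<^sup>2)) + 2 * (w x * ennreal ((cmod (g x - h x))\<^sup>2))"
      by (simp add: algebra_simps)
    also have "\<dots> \<le> 2 * (w x * ennreal ((cmod (h x))\<^sup>2)) + 2 * (W * ennreal ((cmod (g x - h x))\<^sup>2))"
      by (intro add_left_mono mult_left_mono mult_right_mono w) auto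
    finally show "w x * ennreal ((cmod (g x))\<^sup>2) \<le> 2 * (w x * ennreal ((cmod (h x))\<^sup>2)) + 2 * W * ennreal ((cmod (g x - h x))\<^sup>2)"
      by (simp add: mult.assoc)
  qed
  also have "\<dots> = 2 * (\<integral>\<^sup>+x. w x * ennreal ((cmod (h x))\<^sup>2) \<partial>lborel) + 2 * W * l2sq (\<lambda>x. g x - h x)"
    unfolding l2sq_def by (simp add: nn_integral_add nn_integral_cmult)
  finally show ?thesis .
qed

lemma l2sq_minus_commute: "l2sq (\<lambda>x. g x - h x) = l2sq (\<lambda>x. h x - g x)"
  by (simp add: l2sq_def norm_minus_commute)

lemma l2sq_le:
  assumes [measurable]: "g \<in> borel_measurable borel" "h \<in> borel_measurable borel"
  shows "l2sq g \<le> 2 * l2sq h + 2 * l2sq (\<lambda>x. g x - h x)"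
  using nn_integral_weighted_square_le[of "\<lambda>_. 1" g h 1] by (simp add: l2sq_def)

text \<open>Along a subsequence with rapidly decreasing increments the functions converge almost
  everywhere; Fatou then turns the Cauchy bounds of the whole sequence into convergence in norm to
  that pointwise limit.\<close>

lemma l2sq_complete:
  fixes g :: "nat \<Rightarrow> 'a::euclidean_space \<Rightarrow> complex"
  assumes [measurable]: "\<And>n. g n \<in> borel_measurable borel"
    and cauchy: "\<And>e. 0 < e \<Longrightarrow> \<exists>N. \<forall>m\<ge>N. \<forall>n\<ge>N. l2sq (\<lambda>x. g m x - g n x) \<le> ennreal e"
  obtains G where "G \<in> borel_measurable borel" "(\<lambda>n. l2sq (\<lambda>x. g n x - G x)) \<longlonglongrightarrow> 0"
proof -
  obtain N where N: "\<And>k m n. m \<ge> N k \<Longrightarrow> n \<ge> N k \<Longrightarrow> l2sq (\<lambda>x. g m x - g n x) \<le> ennreal ((1/8) ^ k)"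
    using cauchy[of "(1/8) ^ k" for k] by (simp add: choice_iff) (metis zero_less_power zero_less_divide_1_iff zero_less_numeral)
  define r where "r k = (\<Sum>i\<le>k. N i) + k" for k
  have rN: "N k \<le> r j" if "k \<le> j" for j k
  proof -
    have "N k \<le> (\<Sum>i\<le>j. N i)" using that by (intro member_le_sum) auto
    then show ?thesis by (simp add: r_def)
  qed
  have rk: "k \<le> r k" for k by (simp add: r_def)
  define d where "d k x = g (r (Suc k)) x - g (r k) x" for k x
  have [measurable]: "d k \<in> borel_measurable borel" for k unfolding d_def by measurable
  \<comment> \<open>The weight 4^k against squared increments of size 8^(-k) leaves a convergent
    series, and where the weighted sum is a finite M one has |d k x| \<le> sqrt M 2^(-k), so the
    increments sum absolutely.\<close>
  have "(\<integral>\<^sup>+x. (\<Sum>k. ennreal (4 ^ k * (cmod (d k x))\<^sup>2)) \<partial>lborel) = (\<Sum>k. ennreal (4 ^ k) * l2sq (d k))"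
    by (subst nn_integral_suminf) (auto simp: l2sq_def nn_integral_cmult ennreal_mult)
  also have "\<dots> \<le> (\<Sum>k. ennreal ((1/2) ^ k))"
  proof (intro suminf_le)
    fix k
    have "l2sq (d k) \<le> ennreal ((1/8) ^ k)"
      unfolding d_def by (intro N rN) auto
    then have "ennreal (4 ^ k) * l2sq (d k) \<le> ennreal (4 ^ k) * ennreal ((1/8) ^ k)"
      by (intro mult_left_mono) auto
    also have "\<dots> = ennreal ((1/2) ^ k)"
      by (simp flip: ennreal_mult power_mult_distrib)
    finally show "ennreal (4 ^ k) * l2sq (d k) \<le> ennreal ((1/2) ^ k)" .
  qed auto
  also have "\<dots> = ennreal (\<Sum>k. (1/2) ^ k)"
    by (intro suminf_ennreal2) (auto intro!: summable_geometric)
  finally have "(\<integral>\<^sup>+x. (\<Sum>k. ennreal (4 ^ k * (cmod (d k x))\<^sup>2)) \<partial>lborel) \<noteq> \<infinity>"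
    by (auto simp: top_unique)
  then have fin: "AE x in lborel. (\<Sum>k. ennreal (4 ^ k * (cmod (d k x))\<^sup>2)) \<noteq> \<infinity>"
    by (intro nn_integral_PInf_AE) auto
  define G where "G x = lim (\<lambda>k. g (r k) x)" for x
  have [measurable]: "G \<in> borel_measurable borel" unfolding G_def by measurable
  have conv: "AE x in lborel. (\<lambda>k. g (r k) x) \<longlonglongrightarrow> G x"
    using fin
  proof eventually_elim
    case (elim x)
    define M where "M = enn2real (\<Sum>k. ennreal (4 ^ k * (cmod (d k x))\<^sup>2))"
    have M: "0 \<le> M" "(\<Sum>k. ennreal (4 ^ k * (cmod (d k x))\<^sup>2)) = ennreal M"
      unfolding M_def by (rule enn2real_nonneg, rule ennreal_enn2real[symmetric])
        (use elim in \<open>simp only: infinity_ennreal_def less_top\<close>)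
    have b: "norm (d k x) \<le> sqrt M * (1/2) ^ k" for k
    proof -
      have "ennreal (4 ^ k * (cmod (d k x))\<^sup>2) \<le> ennreal M"
        unfolding M(2)[symmetric] by (rule ennreal_le_suminf)
      then have "4 ^ k * (cmod (d k x))\<^sup>2 \<le> M" using M by simp
      moreover have "((2::real) ^ k)\<^sup>2 = 4 ^ k"
        by (simp add: power2_eq_square flip: power_mult_distrib)
      ultimately have "(2 ^ k * cmod (d k x))\<^sup>2 \<le> M"
        by (simp add: power_mult_distrib)
      then have "2 ^ k * cmod (d k x) \<le> sqrt M" by (rule real_le_rsqrt)
      then show ?thesis by (simp add: field_simps)
    qed
    have "summable (\<lambda>k. sqrt M * (1/2) ^ k)"
      by (intro summable_mult summable_geometric) simp
    then have "summable (\<lambda>k. d k x)"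
      by (rule summable_comparison_test'[where N=0]) (rule b)
    then have "convergent (\<lambda>n. (\<Sum>k<n. d k x))" by (simp add: summable_iff_convergent)
    also have "(\<lambda>n. (\<Sum>k<n. d k x)) = (\<lambda>n. g (r n) x - g (r 0) x)"
      unfolding d_def using sum_lessThan_telescope[of "\<lambda>k. g (r k) x"] by simp
    finally have "convergent (\<lambda>n. g (r n) x - g (r 0) x + g (r 0) x)"
      by (rule convergent_add[OF _ convergent_const])
    then show ?case unfolding G_def by (simp add: convergent_LIMSEQ_iff)
  qed
  have "(\<lambda>n. l2sq (\<lambda>x. g n x - G x)) \<longlonglongrightarrow> 0"
  proof (rule ennreal_tendsto_zeroI)
    fix e :: real assume "0 < e"
    with cauchy obtain N where N: "\<And>m n. m \<ge> N \<Longrightarrow> n \<ge> N \<Longrightarrow> l2sq (\<lambda>x. g m x - g n x) \<le> ennreal e"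
      by blast
    have "l2sq (\<lambda>x. g n x - G x) \<le> ennreal e" if n: "n \<ge> N" for n
      unfolding l2sq_def
    proof (rule nn_integral_fatou_bound[where c="\<lambda>_. 0"])
      show "AE x in lborel. (\<lambda>k. ennreal ((cmod (g n x - g (r k) x))\<^sup>2)) \<longlonglongrightarrow> ennreal ((cmod (g n x - G x))\<^sup>2)"
        using conv by eventually_elim (auto intro!: tendsto_intros)
      show "\<forall>\<^sub>F k in sequentially. (\<integral>\<^sup>+x. ennreal ((cmod (g n x - g (r k) x))\<^sup>2) \<partial>lborel) \<le> ennreal e + 0"
        using eventually_ge_at_top[of N]
      proof eventually_elim
        case (elim k)
        then have "r k \<ge> N" using rk[of k] by linarith
        then show ?case using N[OF n] by (simp add: l2sq_def)
      qed
    qed auto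
    then show "\<forall>\<^sub>F n in sequentially. l2sq (\<lambda>x. g n x - G x) \<le> ennreal e"
      by (auto simp: eventually_sequentially)
  qed
  then show ?thesis by (intro that[of G]) auto
qed

section \<open>Truncations and Borel representatives\<close>

definition trunc :: "nat \<Rightarrow> ('a::euclidean_space \<Rightarrow> complex) \<Rightarrow> 'a \<Rightarrow> complex" where
  "trunc n f x = indicator (ball 0 (real n)) x * f x"

lemma borel_measurable_trunc [measurable]:
  assumes [measurable]: "f \<in> borel_measurable borel"
  shows "trunc n f \<in> borel_measurable borel"
  unfolding trunc_def[abs_def] by (intro borel_measurable_times borel_measurable_indicator assms) simp

lemma cmod_trunc_le: "cmod (trunc n f x) \<le> cmod (f x)"
  by (simp add: trunc_def norm_mult indicator_def)

lemma l2sq_mono: "(\<And>x. cmod (f x) \<le> cmod (g x)) \<Longrightarrow> l2sq f \<le> l2sq g"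
  unfolding l2sq_def by (intro nn_integral_mono ennreal_leI power_mono) auto

text \<open>Cauchy-Schwarz against the indicator of the ball.\<close>

lemma integrable_bounded_support:
  fixes f :: "'a::euclidean_space \<Rightarrow> complex"
  assumes [measurable]: "f \<in> borel_measurable borel" and fin: "l2sq f < \<infinity>"
    and supp: "\<And>x. x \<notin> ball a r \<Longrightarrow> f x = 0"
  shows "integrable lborel f"
proof -
  have "integrable lborel (\<lambda>x. f x * indicator (ball a r) x)"
  proof (intro integrable_mult_l2 fin)
    have "l2sq (indicator (ball a r) :: 'a \<Rightarrow> complex) = (\<integral>\<^sup>+x. indicator (ball a r) x \<partial>lborel)"
      unfolding l2sq_def by (intro nn_integral_cong) (auto simp: indicator_def)
    also have "\<dots> = emeasure lborel (ball a r)" by simp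
    also have "\<dots> < \<infinity>" by (rule emeasure_bounded_finite) simp
    finally show "l2sq (indicator (ball a r) :: 'a \<Rightarrow> complex) < \<infinity>" .
  qed (auto intro!: borel_measurable_indicator)
  also have "(\<lambda>x. f x * indicator (ball a r) x) = f"
    using supp by (auto simp: fun_eq_iff indicator_def)
  finally show ?thesis .
qed

lemma
  fixes f :: "'a::euclidean_space \<Rightarrow> complex"
  assumes [measurable]: "f \<in> borel_measurable borel" and fin: "l2sq f < \<infinity>"
  shows l2sq_trunc_finite: "l2sq (trunc n f) < \<infinity>"
    and integrable_trunc: "integrable lborel (trunc n f)"
    and tendsto_trunc: "(\<lambda>n. l2sq (\<lambda>x. f x - trunc n f x)) \<longlonglongrightarrow> 0"
proof -
  show *: "l2sq (trunc n f) < \<infinity>" for n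
    using l2sq_mono[of "trunc n f" f, OF cmod_trunc_le] fin by (rule order_le_less_trans)
  show "integrable lborel (trunc n f)"
    by (rule integrable_bounded_support[where a=0 and r="real n"]) (use * in \<open>auto simp: trunc_def\<close>)
  have "(\<lambda>n. l2sq (\<lambda>x. f x - trunc n f x)) \<longlonglongrightarrow> (\<integral>\<^sup>+(x::'a). 0 \<partial>lborel)"
    unfolding l2sq_def
  proof (rule nn_integral_dominated_convergence[where w="\<lambda>x. ennreal ((cmod (f x))\<^sup>2)"])
    show "AE x::'a in lborel. (\<lambda>n. ennreal ((cmod (f x - trunc n f x))\<^sup>2)) \<longlonglongrightarrow> 0"
    proof (intro AE_I2 tendsto_eventually)
      fix x :: 'a
      obtain N where "norm x < real N" using reals_Archimedean2 by blast
      then have "\<forall>\<^sub>F n in sequentially. norm x < real n"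
        by (intro eventually_sequentiallyI[of N]) simp
      then show "\<forall>\<^sub>F n in sequentially. ennreal ((cmod (f x - trunc n f x))\<^sup>2) = 0"
        by eventually_elim (simp add: trunc_def)
    qed
    show "AE x in lborel. ennreal ((cmod (f x - trunc n f x))\<^sup>2) \<le> ennreal ((cmod (f x))\<^sup>2)" for n
      by (auto simp: trunc_def indicator_def)
  qed (use fin in \<open>auto simp: l2sq_def\<close>)
  then show "(\<lambda>n. l2sq (\<lambda>x. f x - trunc n f x)) \<longlonglongrightarrow> 0" by simp
qed

lemma borel_representative:
  fixes f :: "'a::euclidean_space \<Rightarrow> complex"
  assumes "f \<in> borel_measurable lebesgue"
  obtains f' where "f' \<in> borel_measurable borel" "AE x in lborel. f x = f' x"
proof -
  have "(\<lambda>x. Re (f x)) \<in> borel_measurable lebesgue" "(\<lambda>x. Im (f x)) \<in> borel_measurable lebesgue"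
    using assms by measurable
  from this[THEN completion_ex_borel_measurable_real] obtain a b where
    ab: "a \<in> borel_measurable lborel" "b \<in> borel_measurable lborel"
      "AE x in lborel. Re (f x) = a x" "AE x in lborel. Im (f x) = b x" by blast
  show ?thesis
  proof
    show "(\<lambda>x. Complex (a x) (b x)) \<in> borel_measurable borel"
      using ab(1,2) unfolding Complex_eq by simp
    show "AE x in lborel. f x = Complex (a x) (b x)"
      using ab(3,4) by eventually_elim (simp add: complex_eq_iff)
  qed
qed

text \<open>\<open>fourier\<close> integrates over \<open>lborel\<close>, \<open>fourier_L1\<close>
  over its completion. Identifying the two on truncations allows the analysis, with its product
  measures, to be done on Borel functions.\<close>

lemma fourier_L1_truncation:
  fixes f f' :: "'a::euclidean_space \<Rightarrow> complex"
  assumes [measurable]: "f \<in> borel_measurable lebesgue" "f' \<in> borel_measurable borel"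
    and eq: "AE x in lborel. f x = f' x"
  shows "fourier_L1 (\<lambda>x. indicator (ball 0 (real n)) x * f x) \<xi> = fourier (trunc n f') \<xi>"
proof -
  have [measurable]: "ball (0::'a) (real n) \<in> sets lebesgue" by simp
  have [measurable]: "f' \<in> borel_measurable lebesgue"
    using measurable_completion[of f' lborel borel] by simp
  have 1: "(\<lambda>x. cis (- 2 * pi * (x \<bullet> \<xi>))) \<in> borel_measurable lebesgue"
    by (intro measurable_completion) simp
  have "fourier_L1 (\<lambda>x. indicator (ball 0 (real n)) x * f x) \<xi> =
      (LINT x|lebesgue. trunc n f' x * cis (- 2 * pi * (x \<bullet> \<xi>)))"
    unfolding fourier_L1_def
  proof (rule integral_cong_AE)
    show "(\<lambda>x. indicator (ball 0 (real n)) x * f x * cis (- 2 * pi * (x \<bullet> \<xi>))) \<in> borel_measurable lebesgue"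
      by (intro borel_measurable_times 1 borel_measurable_indicator) auto
    show "(\<lambda>x. trunc n f' x * cis (- 2 * pi * (x \<bullet> \<xi>))) \<in> borel_measurable lebesgue"
      by (intro measurable_completion) simp
    show "AE x in lebesgue. indicator (ball 0 (real n)) x * f x * cis (- 2 * pi * (x \<bullet> \<xi>)) =
        trunc n f' x * cis (- 2 * pi * (x \<bullet> \<xi>))"
      using AE_completion[OF eq] by eventually_elim (simp add: trunc_def)
  qed
  also have "\<dots> = fourier (trunc n f') \<xi>"
    unfolding fourier_def by (rule integral_completion) simp
  finally show ?thesis .
qed

text \<open>Borel counterpart of \<open>is_fourier_L2\<close>. It is a relation because F is
  determined only almost everywhere, which leaves the representative open.\<close>

definition fourier_pair :: "('a::euclidean_space \<Rightarrow> complex) \<Rightarrow> ('a \<Rightarrow> complex) \<Rightarrow> bool" where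
  "fourier_pair f F \<longleftrightarrow> f \<in> borel_measurable borel \<and> l2sq f < \<infinity> \<and> F \<in> borel_measurable borel \<and>
     (\<lambda>n. l2sq (\<lambda>\<xi>. fourier (trunc n f) \<xi> - F \<xi>)) \<longlonglongrightarrow> 0"

lemma fourier_diff:
  assumes "integrable lborel g" "integrable lborel h"
  shows "fourier (\<lambda>x. g x - h x) \<xi> = fourier g \<xi> - fourier h \<xi>"
proof -
  have "integrable lborel (\<lambda>x. g x * cis (- 2 * pi * (x \<bullet> \<xi>)))" "integrable lborel (\<lambda>x. h x * cis (- 2 * pi * (x \<bullet> \<xi>)))"
    using assms by (auto intro!: integrable_mult_cis)
  then show ?thesis
    unfolding fourier_def left_diff_distrib by (rule Bochner_Integration.integral_diff)
qed

text \<open>Differences of truncations are integrable and square integrable, so Plancherel makes the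
  transforms of the truncations a Cauchy sequence in L2.\<close>

lemma ex_fourier_pair:
  fixes f :: "'a::euclidean_space \<Rightarrow> complex"
  assumes [measurable]: "f \<in> borel_measurable borel" and fin: "l2sq f < \<infinity>"
  shows "\<exists>F. fourier_pair f F"
proof -
  have le: "l2sq (\<lambda>\<xi>. fourier (trunc m f) \<xi> - fourier (trunc n f) \<xi>) \<le>
      2 * l2sq (\<lambda>x. f x - trunc m f x) + 2 * l2sq (\<lambda>x. f x - trunc n f x)" for m n
  proof -
    note i = integrable_trunc[OF assms(1) fin]
    have "l2sq (\<lambda>x. trunc m f x - trunc n f x) \<le> 2 * l2sq (\<lambda>x. trunc m f x - f x)
       + 2 * l2sq (\<lambda>x. (trunc m f x - trunc n f x) - (trunc m f x - f x))"
      by (rule l2sq_le) auto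
    then have a: "l2sq (\<lambda>x. trunc m f x - trunc n f x) \<le>
      2 * l2sq (\<lambda>x. f x - trunc m f x) + 2 * l2sq (\<lambda>x. f x - trunc n f x)"
      by (simp add: l2sq_minus_commute[of f])
    have "l2sq (\<lambda>x. trunc m f x - trunc n f x) \<le> l2sq (\<lambda>x. (\<lambda>x. 2 * cmod (f x)) x)"
    proof (rule l2sq_mono)
      fix x show "cmod (trunc m f x - trunc n f x) \<le> cmod (complex_of_real (2 * cmod (f x)))"
        using norm_triangle_ineq4[of "trunc m f x" "trunc n f x"] cmod_trunc_le[of m f x] cmod_trunc_le[of n f x]
        by simp
    qed
    also have "\<dots> = 4 * l2sq f"
      unfolding l2sq_def by (subst nn_integral_cmult[symmetric])
        (auto simp: norm_mult power_mult_distrib ennreal_mult)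
    also have "\<dots> < \<infinity>" using fin by (simp add: ennreal_mult_less_top)
    finally have "l2sq (fourier (\<lambda>x. trunc m f x - trunc n f x)) = l2sq (\<lambda>x. trunc m f x - trunc n f x)"
      by (intro plancherel Bochner_Integration.integrable_diff i)
    then show ?thesis using a by (simp add: fourier_diff[OF i i, abs_def])
  qed
  obtain F where "F \<in> borel_measurable borel" "(\<lambda>n. l2sq (\<lambda>\<xi>. fourier (trunc n f) \<xi> - F \<xi>)) \<longlonglongrightarrow> 0"
  proof (rule l2sq_complete[of "\<lambda>n. fourier (trunc n f)"])
    fix e :: real assume "0 < e"
    then have "\<forall>\<^sub>F n in sequentially. l2sq (\<lambda>x. f x - trunc n f x) < ennreal (e/4)"
      using tendsto_trunc[OF assms(1) fin] by (auto dest!: order_tendstoD(2)[where a="ennreal (e/4)"])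
    then obtain N where N: "\<And>n. n \<ge> N \<Longrightarrow> l2sq (\<lambda>x. f x - trunc n f x) < ennreal (e/4)"
      by (auto simp: eventually_sequentially)
    have "l2sq (\<lambda>x. fourier (trunc m f) x - fourier (trunc n f) x) \<le> ennreal e" if "m \<ge> N" "n \<ge> N" for m n
    proof -
      have "2 * l2sq (\<lambda>x. f x - trunc m f x) + 2 * l2sq (\<lambda>x. f x - trunc n f x) \<le> 2 * ennreal (e/4) + 2 * ennreal (e/4)"
        using N[OF that(1)] N[OF that(2)] by (intro add_mono mult_left_mono) auto
      also have "\<dots> = ennreal 4 * ennreal (e/4)"
        unfolding ennreal_numeral by (simp only: distrib_right[symmetric]) simp
      also have "\<dots> = ennreal e"
        using \<open>0 < e\<close> by (subst ennreal_mult[symmetric]) auto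
      finally show ?thesis using le[of m n] by simp
    qed
    then show "\<exists>N. \<forall>m\<ge>N. \<forall>n\<ge>N. l2sq (\<lambda>x. fourier (trunc m f) x - fourier (trunc n f) x) \<le> ennreal e"
      by blast
  qed auto
  then show ?thesis using assms unfolding fourier_pair_def by blast
qed

lemma l2sq_fourier_trunc_le:
  assumes "f \<in> borel_measurable borel" "l2sq f < \<infinity>"
  shows "l2sq (fourier (trunc n f)) \<le> l2sq f"
  using plancherel[OF integrable_trunc[OF assms] l2sq_trunc_finite[OF assms]]
  by (simp add: l2sq_mono cmod_trunc_le)

text \<open>Plancherel for the truncations, carried to the limit by the crude square inequality. The
  factor 2 is harmless because the bound serves for finiteness and in an error term.\<close>

lemma fourier_pair_l2sq_le:
  assumes "fourier_pair f F"
  shows "l2sq F \<le> 2 * l2sq f"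
proof -
  have [measurable]: "f \<in> borel_measurable borel" "F \<in> borel_measurable borel"
    and fin: "l2sq f < \<infinity>" and lim: "(\<lambda>n. l2sq (\<lambda>\<xi>. fourier (trunc n f) \<xi> - F \<xi>)) \<longlonglongrightarrow> 0"
    using assms by (auto simp: fourier_pair_def)
  have "(\<lambda>n. 2 * l2sq f + 2 * l2sq (\<lambda>\<xi>. fourier (trunc n f) \<xi> - F \<xi>)) \<longlonglongrightarrow> 2 * l2sq f + 2 * 0"
    by (intro tendsto_add ennreal_tendsto_cmult tendsto_const lim) auto
  moreover have "l2sq F \<le> 2 * l2sq f + 2 * l2sq (\<lambda>\<xi>. fourier (trunc n f) \<xi> - F \<xi>)" for n
  proof -
    have "l2sq F \<le> 2 * l2sq (fourier (trunc n f)) + 2 * l2sq (\<lambda>\<xi>. F \<xi> - fourier (trunc n f) \<xi>)"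
      by (rule l2sq_le) auto
    also have "\<dots> \<le> 2 * l2sq f + 2 * l2sq (\<lambda>\<xi>. fourier (trunc n f) \<xi> - F \<xi>)"
      unfolding l2sq_minus_commute[of F]
      by (intro add_mono mult_left_mono l2sq_fourier_trunc_le fin) auto
    finally show ?thesis .
  qed
  ultimately show ?thesis by (intro LIMSEQ_le_const) auto
qed

lemma is_fourier_L2_iff:
  fixes f f' F :: "'a::euclidean_space \<Rightarrow> complex"
  assumes f: "f \<in> borel_measurable lebesgue" and f': "f' \<in> borel_measurable borel"
    and eq: "AE x in lborel. f x = f' x" and Feq: "AE x in lborel. G x = F x"
  shows "is_fourier_L2 f G \<longleftrightarrow> L2 G \<and> (\<lambda>n. l2sq (\<lambda>\<xi>. fourier (trunc n f') \<xi> - F \<xi>)) \<longlonglongrightarrow> 0"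
proof -
  have "(\<integral>\<^sup>+ \<xi>. ennreal ((cmod (fourier (trunc n f') \<xi> - G \<xi>))\<^sup>2) \<partial>lebesgue) = l2sq (\<lambda>\<xi>. fourier (trunc n f') \<xi> - F \<xi>)" for n
    unfolding l2sq_def nn_integral_completion
    by (rule nn_integral_cong_AE) (use Feq in eventually_elim, simp)
  then show ?thesis
    unfolding is_fourier_L2_def fourier_L1_truncation[OF f f' eq] by simp
qed

lemma L2_representative:
  fixes f :: "'a::euclidean_space \<Rightarrow> complex"
  assumes "L2 f" "f' \<in> borel_measurable borel" and eq: "AE x in lborel. f x = f' x"
  shows "l2sq f' < \<infinity>"
proof -
  have "l2sq f' = (\<integral>\<^sup>+x. ennreal ((cmod (f x))\<^sup>2) \<partial>lebesgue)"
    unfolding l2sq_def nn_integral_completion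
    by (rule nn_integral_cong_AE) (use eq in eventually_elim, simp)
  then show ?thesis using assms(1) by (simp add: L2_def integrable_iff_bounded)
qed

lemma L2_of_borel:
  assumes "F \<in> borel_measurable borel" "l2sq F < \<infinity>"
  shows "L2 F"
proof -
  have "F \<in> borel_measurable lborel" using assms by simp
  moreover have "integrable lborel (\<lambda>x. (cmod (F x))\<^sup>2)" using assms by (simp add: l2sq_finite_iff)
  ultimately show ?thesis
    unfolding L2_def by (auto intro: measurable_completion simp: integrable_completion)
qed

text \<open>\<open>fourier_L2\<close> is a choice, so a witness is required before it means
  anything; completeness supplies \<open>F0\<close>. The F returned is a Borel representative of the
  chosen function, not of \<open>F0\<close>, so uniqueness of L2 limits does not enter.\<close>

lemma fourier_L2_representative:
  fixes f :: "'a::euclidean_space \<Rightarrow> complex"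
  assumes L2: "L2 f"
  obtains f' F where "fourier_pair f' F" "AE x in lborel. f x = f' x" "AE \<xi> in lborel. fourier_L2 f \<xi> = F \<xi>"
    "fourier_L2 f \<in> borel_measurable lebesgue"
proof -
  have f: "f \<in> borel_measurable lebesgue" using L2 by (simp add: L2_def)
  then obtain f' where f': "f' \<in> borel_measurable borel" and eq: "AE x in lborel. f x = f' x"
    by (rule borel_representative)
  have fin: "l2sq f' < \<infinity>" by (rule L2_representative[OF L2 f' eq])
  obtain F0 where F0: "fourier_pair f' F0" using ex_fourier_pair[OF f' fin] by blast
  have "l2sq F0 < \<infinity>"
    using fourier_pair_l2sq_le[OF F0] fin
    by (auto simp: ennreal_mult_less_top intro: order_le_less_trans)
  then have "L2 F0" using F0 by (intro L2_of_borel) (auto simp: fourier_pair_def)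
  then have "is_fourier_L2 f F0"
    using F0 is_fourier_L2_iff[OF f f' eq, of F0 F0] by (simp add: fourier_pair_def)
  then have G: "is_fourier_L2 f (fourier_L2 f)"
    unfolding fourier_L2_def by (rule someI[of "is_fourier_L2 f" F0])
  then have meas: "fourier_L2 f \<in> borel_measurable lebesgue" by (simp add: is_fourier_L2_def L2_def)
  then obtain F where F: "F \<in> borel_measurable borel" and Feq: "AE \<xi> in lborel. fourier_L2 f \<xi> = F \<xi>"
    by (rule borel_representative)
  have "fourier_pair f' F"
    using G is_fourier_L2_iff[OF f f' eq Feq] f' fin F by (simp add: fourier_pair_def)
  then show ?thesis using that eq Feq meas by blast
qed

text \<open>The complement of the support is a union of balls on which g vanishes almost everywhere;
  Lindelof gives a countable subfamily with the same union, so the exceptional set stays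
  null.\<close>

lemma AE_ess_support:
  fixes g :: "'a::euclidean_space \<Rightarrow> complex"
  assumes "g \<in> borel_measurable lebesgue" "ess_support g \<subseteq> K"
  shows "AE x in lborel. x \<notin> K \<longrightarrow> g x = 0"
proof -
  define \<F> where "\<F> = {ball \<xi> \<epsilon> | \<xi> \<epsilon>. \<epsilon> > 0 \<and> emeasure lebesgue {\<eta> \<in> ball \<xi> \<epsilon>. g \<eta> \<noteq> 0} = 0}"
  have "\<And>S. S \<in> \<F> \<Longrightarrow> open S" by (auto simp: \<F>_def)
  then obtain \<F>' where F': "\<F>' \<subseteq> \<F>" "countable \<F>'" "\<Union>\<F>' = \<Union>\<F>"
    by (rule Lindelof)
  have "AE x in lebesgue. \<forall>S\<in>\<F>'. x \<in> S \<longrightarrow> g x = 0"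
  proof (subst AE_ball_countable[OF F'(2)], intro ballI)
    fix S assume "S \<in> \<F>'"
    then obtain \<xi> \<epsilon> where S: "S = ball \<xi> \<epsilon>" "emeasure lebesgue {\<eta> \<in> ball \<xi> \<epsilon>. g \<eta> \<noteq> 0} = 0"
      using F'(1) by (auto simp: \<F>_def)
    have [measurable]: "S \<in> sets lebesgue" "g \<in> borel_measurable lebesgue" using S assms by auto
    have "{\<eta> \<in> space lebesgue. \<eta> \<in> S \<and> g \<eta> \<noteq> 0} \<in> sets lebesgue" by measurable
    then show "AE x in lebesgue. x \<in> S \<longrightarrow> g x = 0"
      using S by (intro AE_I[of _ _ "{\<eta> \<in> S. g \<eta> \<noteq> 0}"]) auto
  qed
  then have "AE x in lborel. \<forall>S\<in>\<F>'. x \<in> S \<longrightarrow> g x = 0" by (simp add: AE_completion_iff)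
  then show ?thesis
  proof eventually_elim
    case (elim x)
    show ?case
    proof
      assume "x \<notin> K"
      then have "x \<notin> ess_support g" using assms by auto
      then obtain \<epsilon> where "\<epsilon> > 0" "emeasure lebesgue {\<eta> \<in> ball x \<epsilon>. g \<eta> \<noteq> 0} = 0"
        by (auto simp: ess_support_def)
      then have "x \<in> \<Union>\<F>" by (auto simp: \<F>_def intro!: exI[of _ "ball x \<epsilon>"])
      then show "g x = 0" using elim F'(3) by auto
    qed
  qed
qed

section \<open>Extrapolation from a sampling window\<close>

text \<open>The sign is opposite to that of the usual forward difference; it makes all coefficients
  of the extrapolation formula natural numbers.\<close>

definition seq_diff :: "(nat \<Rightarrow> complex) \<Rightarrow> nat \<Rightarrow> complex" where
  "seq_diff u i = u i - u (Suc i)"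

text \<open>Abel summation: the sum of (i + n choose n) over i < m is (m + n choose n + 1), and the
  induction step is Pascal's rule.\<close>

lemma summation_by_parts_choose:
  "(\<Sum>i<m. of_nat ((i + n) choose n) * u i) =
   of_nat ((m + n) choose Suc n) * u m + (\<Sum>i<m. of_nat ((i + Suc n) choose Suc n) * seq_diff u i)"
proof (induction m)
  case (Suc m)
  have "(Suc m + n) choose Suc n = ((m + n) choose n) + ((m + n) choose Suc n)" by simp
  then have "of_nat ((Suc m + n) choose Suc n) = (of_nat ((m + n) choose n) :: complex) + of_nat ((m + n) choose Suc n)"
    by (metis of_nat_add)
  then show ?case using Suc by (simp add: seq_diff_def algebra_simps)
qed simp

text \<open>A discrete Taylor formula based at m and evaluated at 0: each summation by parts of the
  remainder splits off one more boundary term at m. The coefficients at m may be anything, but those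
  of the remainder stay explicit because their size is later played against a power of the
  step.\<close>

lemma newton_extrapolation:
  "\<exists>a :: nat \<Rightarrow> nat. \<forall>u. u 0 = (\<Sum>k\<le>n. of_nat (a k) * (seq_diff ^^ k) u m)
      + (\<Sum>i<m. of_nat ((i + n) choose n) * (seq_diff ^^ Suc n) u i)"
proof (induction n)
  case 0
  have "u 0 = u m + (\<Sum>i<m. seq_diff u i)" for u
    unfolding seq_diff_def by (simp add: sum_lessThan_telescope')
  then show ?case by (intro exI[of _ "\<lambda>_. 1"]) simp
next
  case (Suc n)
  then obtain a where a: "u 0 = (\<Sum>k\<le>n. of_nat (a k) * (seq_diff ^^ k) u m)
      + (\<Sum>i<m. of_nat ((i + n) choose n) * (seq_diff ^^ Suc n) u i)" for u by blast
  have "u 0 = (\<Sum>k\<le>Suc n. of_nat ((a(Suc n := (m + n) choose Suc n)) k) * (seq_diff ^^ k) u m)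
      + (\<Sum>i<m. of_nat ((i + Suc n) choose Suc n) * (seq_diff ^^ Suc (Suc n)) u i)" for u
  proof -
    have "(\<Sum>k\<le>n. of_nat ((a(Suc n := (m + n) choose Suc n)) k) * (seq_diff ^^ k) u m) =
        (\<Sum>k\<le>n. of_nat (a k) * (seq_diff ^^ k) u m)"
      by (intro sum.cong) auto
    then show ?thesis
      using a[of u] summation_by_parts_choose[of n "(seq_diff ^^ Suc n) u" m]
      by (simp add: add.assoc del: binomial_Suc_Suc)
  qed
  then show ?case by blast
qed

lemma cmod_seq_diff_le:
  "cmod ((seq_diff ^^ k) u m) \<le> 2 ^ k * (\<Sum>j\<le>k. cmod (u (m + j)))"
proof (induction k arbitrary: m)
  case (Suc k)
  have 1: "(\<Sum>j\<le>k. cmod (u (m + j))) \<le> (\<Sum>j\<le>Suc k. cmod (u (m + j)))" by simp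
  have 2: "(\<Sum>j\<le>k. cmod (u (Suc m + j))) \<le> (\<Sum>j\<le>Suc k. cmod (u (m + j)))"
    by (subst sum.atMost_Suc_shift) simp
  have "cmod ((seq_diff ^^ Suc k) u m) \<le> cmod ((seq_diff ^^ k) u m) + cmod ((seq_diff ^^ k) u (Suc m))"
    by (simp add: seq_diff_def norm_triangle_ineq4)
  also have "\<dots> \<le> 2 ^ k * (\<Sum>j\<le>k. cmod (u (m + j))) + 2 ^ k * (\<Sum>j\<le>k. cmod (u (Suc m + j)))"
    by (intro add_mono Suc)
  also have "\<dots> \<le> 2 ^ k * (\<Sum>j\<le>Suc k. cmod (u (m + j))) + 2 ^ k * (\<Sum>j\<le>Suc k. cmod (u (m + j)))"
    by (intro add_mono mult_left_mono 1 2) auto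
  finally show ?case by simp
qed simp

lemma sum_choose_const: "(\<Sum>i<N. (i + n) choose n) = (N + n) choose Suc n"
  by (induction N) auto

lemma weighted_sum_square_le:
  fixes c x :: "'i \<Rightarrow> real"
  assumes "\<And>i. i \<in> I \<Longrightarrow> 0 \<le> c i"
  shows "(\<Sum>i\<in>I. c i * x i)\<^sup>2 \<le> (\<Sum>i\<in>I. c i) * (\<Sum>i\<in>I. c i * (x i)\<^sup>2)"
proof -
  have "(\<Sum>i\<in>I. c i * x i) = (\<Sum>i\<in>I. sqrt (c i) * (sqrt (c i) * x i))"
    using assms by (intro sum.cong) (auto simp flip: mult.assoc)
  then have "(\<Sum>i\<in>I. c i * x i)\<^sup>2 \<le> (\<Sum>i\<in>I. (sqrt (c i))\<^sup>2) * (\<Sum>i\<in>I. (sqrt (c i) * x i)\<^sup>2)"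
    using Cauchy_Schwarz_ineq_sum[of "\<lambda>i. sqrt (c i)" "\<lambda>i. sqrt (c i) * x i" I] by simp
  also have "\<dots> = (\<Sum>i\<in>I. c i) * (\<Sum>i\<in>I. c i * (x i)\<^sup>2)"
    using assms by (simp add: power_mult_distrib)
  finally show ?thesis .
qed

text \<open>The start m of the window will depend on the point, so the bound is uniform in m: A by
  summing over all m \<le> N, the remainder by extending its range from i < m to i < N.
  Cauchy-Schwarz with the binomial weights costs their total, (N + n choose n + 1); the 2 comes from
  squaring a sum of two terms.\<close>

lemma extrapolation_bound:
  "\<exists>A\<ge>0::real. \<forall>u. \<forall>m\<le>N. (cmod (u 0))\<^sup>2 \<le> A * (\<Sum>j\<le>n. (cmod (u (m + j)))\<^sup>2)
      + 2 * real ((N + n) choose Suc n) * (\<Sum>i<N. real ((i + n) choose n) * (cmod ((seq_diff ^^ Suc n) u i))\<^sup>2)"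
proof -
  have "\<forall>m. \<exists>a :: nat \<Rightarrow> nat. \<forall>u. u 0 = (\<Sum>k\<le>n. of_nat (a k) * (seq_diff ^^ k) u m)
      + (\<Sum>i<m. of_nat ((i + n) choose n) * (seq_diff ^^ Suc n) u i)"
    by (intro allI newton_extrapolation)
  from choice[OF this] obtain a :: "nat \<Rightarrow> nat \<Rightarrow> nat" where
    "\<forall>m u. u 0 = (\<Sum>k\<le>n. of_nat (a m k) * (seq_diff ^^ k) u m)
      + (\<Sum>i<m. of_nat ((i + n) choose n) * (seq_diff ^^ Suc n) u i)" ..
  then have a: "u 0 = (\<Sum>k\<le>n. of_nat (a m k) * (seq_diff ^^ k) u m)
      + (\<Sum>i<m. of_nat ((i + n) choose n) * (seq_diff ^^ Suc n) u i)" for u m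
    by (elim allE)
  define B where "B = (\<Sum>m\<le>N. \<Sum>k\<le>n. real (a m k) * 2 ^ k)"
  let ?S = "real ((N + n) choose Suc n)"
  have "(cmod (u 0))\<^sup>2 \<le> 2 * B\<^sup>2 * real (Suc n) * (\<Sum>j\<le>n. (cmod (u (m + j)))\<^sup>2)
      + 2 * ?S * (\<Sum>i<N. real ((i + n) choose n) * (cmod ((seq_diff ^^ Suc n) u i))\<^sup>2)" if m: "m \<le> N" for u m
  proof -
    let ?X = "\<Sum>j\<le>n. cmod (u (m + j))"
    let ?v = "\<lambda>i. cmod ((seq_diff ^^ Suc n) u i)"
    let ?Y = "\<Sum>i<N. real ((i + n) choose n) * ?v i"
    have X0: "0 \<le> ?X" "0 \<le> ?Y" by (auto intro!: sum_nonneg)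
    have "cmod (u 0) \<le> cmod (\<Sum>k\<le>n. of_nat (a m k) * (seq_diff ^^ k) u m)
       + cmod (\<Sum>i<m. of_nat ((i + n) choose n) * (seq_diff ^^ Suc n) u i)"
      by (subst a[of u m]) (rule norm_triangle_ineq)
    also have "cmod (\<Sum>k\<le>n. of_nat (a m k) * (seq_diff ^^ k) u m) \<le> (\<Sum>k\<le>n. real (a m k) * (2 ^ k * ?X))"
    proof (intro sum_norm_le)
      fix k assume "k \<in> {..n}"
      then have "(\<Sum>j\<le>k. cmod (u (m + j))) \<le> ?X" by (intro sum_mono2) auto
      then have "2 ^ k * (\<Sum>j\<le>k. cmod (u (m + j))) \<le> 2 ^ k * ?X" by (intro mult_left_mono) auto
      then have "cmod ((seq_diff ^^ k) u m) \<le> 2 ^ k * ?X" using cmod_seq_diff_le[of k u m] by linarith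
      then show "cmod (of_nat (a m k) * (seq_diff ^^ k) u m) \<le> real (a m k) * (2 ^ k * ?X)"
        by (simp add: norm_mult mult_left_mono)
    qed
    also have "(\<Sum>k\<le>n. real (a m k) * (2 ^ k * ?X)) = (\<Sum>k\<le>n. real (a m k) * 2 ^ k) * ?X"
      by (simp add: sum_distrib_right mult.assoc)
    also have "\<dots> \<le> B * ?X"
      unfolding B_def using m X0
      by (intro mult_right_mono member_le_sum[of m "{..N}" "\<lambda>m. \<Sum>k\<le>n. real (a m k) * 2 ^ k"]) (auto intro!: sum_nonneg)
    also have "cmod (\<Sum>i<m. of_nat ((i + n) choose n) * (seq_diff ^^ Suc n) u i) \<le>
        (\<Sum>i<m. real ((i + n) choose n) * ?v i)"
      by (intro sum_norm_le) (simp add: norm_mult)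
    also have "\<dots> \<le> ?Y" using m by (intro sum_mono2) auto
    finally have le: "cmod (u 0) \<le> B * ?X + ?Y" by simp
    have "?X\<^sup>2 \<le> real (Suc n) * (\<Sum>j\<le>n. (cmod (u (m + j)))\<^sup>2)"
      using weighted_sum_square_le[of "{..n}" "\<lambda>_. 1" "\<lambda>j. cmod (u (m + j))"] by simp
    then have 1: "B\<^sup>2 * ?X\<^sup>2 \<le> B\<^sup>2 * (real (Suc n) * (\<Sum>j\<le>n. (cmod (u (m + j)))\<^sup>2))"
      by (intro mult_left_mono) auto
    have 2: "?Y\<^sup>2 \<le> ?S * (\<Sum>i<N. real ((i + n) choose n) * (?v i)\<^sup>2)"
      using weighted_sum_square_le[of "{..<N}" "\<lambda>i. real ((i + n) choose n)" ?v]
      by (simp add: sum_choose_const flip: of_nat_sum)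
    have "(cmod (u 0))\<^sup>2 \<le> (B * ?X + ?Y)\<^sup>2" using le by (intro power_mono) auto
    also have "\<dots> \<le> 2 * (B * ?X)\<^sup>2 + 2 * ?Y\<^sup>2"
      using sum_squares_bound[of "B * ?X" ?Y] by (simp add: power2_sum)
    also have "\<dots> \<le> 2 * (B\<^sup>2 * (real (Suc n) * (\<Sum>j\<le>n. (cmod (u (m + j)))\<^sup>2)))
      + 2 * (?S * (\<Sum>i<N. real ((i + n) choose n) * (?v i)\<^sup>2))"
      using 1 2 by (intro add_mono) (simp_all add: power_mult_distrib)
    finally show ?thesis by (simp only: mult.assoc)
  qed
  moreover have "0 \<le> 2 * B\<^sup>2 * real (Suc n)" by simp
  ultimately show ?thesis by blast
qed

text \<open>A difference conjugated by a modulation: its Fourier multiplier 1 - cis (2 pi v . \<xi>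
  - \<theta>) vanishes on the hyperplane 2 pi v . \<xi> = \<theta>, which can be placed in the
  middle of a slab.\<close>

definition twisted_diff :: "real \<Rightarrow> 'a::euclidean_space \<Rightarrow> ('a \<Rightarrow> complex) \<Rightarrow> 'a \<Rightarrow> complex" where
  "twisted_diff \<theta> v h x = h x - cis (- \<theta>) * h (x + v)"

lemma borel_measurable_twisted_diff [measurable]:
  assumes [measurable]: "h \<in> borel_measurable borel"
  shows "twisted_diff \<theta> v h \<in> borel_measurable borel"
  unfolding twisted_diff_def[abs_def] by measurable

lemma borel_measurable_twisted_diff_funpow [measurable]:
  assumes "h \<in> borel_measurable borel"
  shows "(twisted_diff \<theta> v ^^ k) h \<in> borel_measurable borel"
  by (induction k) (use assms in auto)

text \<open>The phases turn plain differences of samples into twisted differences of the function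
  and are invisible to absolute values, so the extrapolation bound applies around any central
  frequency.\<close>

lemma seq_diff_twisted:
  "(seq_diff ^^ k) (\<lambda>i. cis (- (real i * \<theta>)) * h (x + real i *\<^sub>R v)) i =
    cis (- (real i * \<theta>)) * (twisted_diff \<theta> v ^^ k) h (x + real i *\<^sub>R v)"
proof (induction k arbitrary: i)
  case (Suc k)
  have "cis (- (real (Suc i) * \<theta>)) = cis (- (real i * \<theta>)) * cis (- \<theta>)"
    by (simp add: cis_mult algebra_simps)
  moreover have "x + real (Suc i) *\<^sub>R v = x + real i *\<^sub>R v + v" by (simp add: algebra_simps)
  ultimately show ?case using Suc by (simp add: seq_diff_def twisted_diff_def algebra_simps del: of_nat_Suc)
qed simp

lemma nn_integral_translation:
  fixes f :: "'a::euclidean_space \<Rightarrow> ennreal"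
  assumes "f \<in> borel_measurable borel"
  shows "(\<integral>\<^sup>+x. f (x + t) \<partial>lborel) = (\<integral>\<^sup>+x. f x \<partial>lborel)"
  using nn_integral_lborel_affine[OF assms, of 1 t] by (simp add: add.commute)

lemma nn_integral_weighted_sums:
  fixes a b :: ennreal
  assumes [measurable]: "\<And>p. G p \<in> borel_measurable M" "\<And>i. H i \<in> borel_measurable M"
  shows "(\<integral>\<^sup>+x. a * (\<Sum>p\<in>P. G p x) + b * (\<Sum>i\<in>I. c i * H i x) \<partial>M) =
    a * (\<Sum>p\<in>P. \<integral>\<^sup>+x. G p x \<partial>M) + b * (\<Sum>i\<in>I. c i * (\<integral>\<^sup>+x. H i x \<partial>M))"
  by (simp add: nn_integral_add nn_integral_cmult nn_integral_sum)

lemma ennreal_weighted_sums_le: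
  fixes a b y :: real
  assumes "y \<le> a * (\<Sum>p\<in>P. G p) + b * (\<Sum>i\<in>I. c i * H i)"
    and "0 \<le> a" "0 \<le> b" "\<And>p. 0 \<le> G p" "\<And>i. 0 \<le> c i" "\<And>i. 0 \<le> H i"
  shows "ennreal y \<le> ennreal a * (\<Sum>p\<in>P. ennreal (G p)) + ennreal b * (\<Sum>i\<in>I. ennreal (c i) * ennreal (H i))"
proof -
  have "(\<Sum>p\<in>P. ennreal (G p)) = ennreal (\<Sum>p\<in>P. G p)"
    using assms by (intro sum_ennreal) auto
  moreover have "(\<Sum>i\<in>I. ennreal (c i) * ennreal (H i)) = ennreal (\<Sum>i\<in>I. c i * H i)"
    using assms by (subst sum_ennreal[symmetric]) (auto simp: ennreal_mult)
  ultimately have "ennreal a * (\<Sum>p\<in>P. ennreal (G p)) + ennreal b * (\<Sum>i\<in>I. ennreal (c i) * ennreal (H i)) =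
    ennreal (a * (\<Sum>p\<in>P. G p) + b * (\<Sum>i\<in>I. c i * H i))"
    using assms by (simp add: ennreal_mult[symmetric] ennreal_plus[symmetric] sum_nonneg del: ennreal_plus)
  then show ?thesis using assms(1) by (simp add: ennreal_leI del: ennreal_plus)
qed

text \<open>The extrapolation bound is used at every x along the progression of step v and then
  integrated. By translation invariance each sampled term becomes the same integral over U and each
  remainder term the same norm; the binomial weights add up to the binomial coefficient already in
  front, whence its square.\<close>

lemma l2sq_le_sampled:
  "\<exists>A\<ge>0::real. \<forall>(h :: 'a::euclidean_space \<Rightarrow> complex) U v \<theta>.
     h \<in> borel_measurable borel \<longrightarrow> U \<in> sets borel \<longrightarrow>
     (\<forall>x. \<exists>m\<le>N. \<forall>j\<le>n. x + real (m + j) *\<^sub>R v \<in> U) \<longrightarrow>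
     l2sq h \<le> ennreal A * (\<integral>\<^sup>+x. indicator U x * ennreal ((cmod (h x))\<^sup>2) \<partial>lborel)
       + ennreal (2 * (real ((N + n) choose Suc n))\<^sup>2) * l2sq ((twisted_diff \<theta> v ^^ Suc n) h)"
proof -
  obtain A :: real where A: "A \<ge> 0" and le: "\<And>u m. m \<le> N \<Longrightarrow> (cmod (u 0))\<^sup>2 \<le> A * (\<Sum>j\<le>n. (cmod (u (m + j)))\<^sup>2)
      + 2 * real ((N + n) choose Suc n) * (\<Sum>i<N. real ((i + n) choose n) * (cmod ((seq_diff ^^ Suc n) u i))\<^sup>2)"
    using extrapolation_bound[of N n] by blast
  let ?S = "real ((N + n) choose Suc n)"
  have "l2sq h \<le> ennreal (A * real (Suc (N + n))) * (\<integral>\<^sup>+x. indicator U x * ennreal ((cmod (h x))\<^sup>2) \<partial>lborel)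
       + ennreal (2 * ?S\<^sup>2) * l2sq ((twisted_diff \<theta> v ^^ Suc n) h)"
    if [measurable]: "h \<in> borel_measurable borel" "U \<in> sets borel"
      and win: "\<forall>x. \<exists>m\<le>N. \<forall>j\<le>n. x + real (m + j) *\<^sub>R v \<in> U"
    for h :: "'a \<Rightarrow> complex" and U v \<theta>
  proof -
    define D where "D = (twisted_diff \<theta> v ^^ Suc n) h"
    \<comment> \<open>Being nonnegative and cut off to U, \<open>g\<close> can be summed over all p
      \<le> N + n instead of over the window, so no measurable choice of m as a function of x is
      involved.\<close>
    define g where "g x = indicator U x * (cmod (h x))\<^sup>2" for x :: 'a
    have [measurable]: "D \<in> borel_measurable borel" unfolding D_def by measurable
    have [measurable]: "g \<in> borel_measurable borel" unfolding g_def by measurable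
    have g0: "0 \<le> g x" for x by (simp add: g_def)
    have pt: "(cmod (h x))\<^sup>2 \<le> A * (\<Sum>p\<le>N + n. g (x + real p *\<^sub>R v))
       + 2 * ?S * (\<Sum>i<N. real ((i + n) choose n) * (cmod (D (x + real i *\<^sub>R v)))\<^sup>2)" for x
    proof -
      obtain m where m: "m \<le> N" "\<And>j. j \<le> n \<Longrightarrow> x + real (m + j) *\<^sub>R v \<in> U" using win by blast
      define u where "u i = cis (- (real i * \<theta>)) * h (x + real i *\<^sub>R v)" for i
      have c: "cmod (u i) = cmod (h (x + real i *\<^sub>R v))" for i by (simp add: u_def norm_mult)
      have d: "cmod ((seq_diff ^^ Suc n) u i) = cmod (D (x + real i *\<^sub>R v))" for i
        unfolding u_def seq_diff_twisted D_def by (simp add: norm_mult)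
      have "(\<Sum>j\<le>n. (cmod (u (m + j)))\<^sup>2) = (\<Sum>j\<le>n. g (x + real (m + j) *\<^sub>R v))"
        using m(2) by (intro sum.cong) (auto simp: c g_def)
      also have "\<dots> = (\<Sum>p\<in>(+) m ` {..n}. g (x + real p *\<^sub>R v))"
        by (subst sum.reindex) (auto simp: o_def)
      also have "\<dots> \<le> (\<Sum>p\<le>N + n. g (x + real p *\<^sub>R v))"
        using m(1) g0 by (intro sum_mono2) auto
      finally have "A * (\<Sum>j\<le>n. (cmod (u (m + j)))\<^sup>2) \<le> A * (\<Sum>p\<le>N + n. g (x + real p *\<^sub>R v))"
        using A by (intro mult_left_mono)
      then show ?thesis using le[OF m(1), of u] c[of 0] unfolding d by simp
    qed
    have "l2sq h \<le> (\<integral>\<^sup>+x. ennreal A * (\<Sum>p\<le>N + n. ennreal (g (x + real p *\<^sub>R v)))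
       + ennreal (2 * ?S) * (\<Sum>i<N. ennreal (real ((i + n) choose n)) * ennreal ((cmod (D (x + real i *\<^sub>R v)))\<^sup>2)) \<partial>lborel)"
      unfolding l2sq_def
    proof (rule nn_integral_mono)
      fix x
      show "ennreal ((cmod (h x))\<^sup>2) \<le> ennreal A * (\<Sum>p\<le>N + n. ennreal (g (x + real p *\<^sub>R v)))
       + ennreal (2 * ?S) * (\<Sum>i<N. ennreal (real ((i + n) choose n)) * ennreal ((cmod (D (x + real i *\<^sub>R v)))\<^sup>2))"
        by (rule ennreal_weighted_sums_le[OF pt]) (use A g0 in auto)
    qed
    also have "\<dots> = ennreal A * (\<Sum>p\<le>N + n. \<integral>\<^sup>+x. ennreal (g (x + real p *\<^sub>R v)) \<partial>lborel)
       + ennreal (2 * ?S) * (\<Sum>i<N. ennreal (real ((i + n) choose n)) * (\<integral>\<^sup>+x. ennreal ((cmod (D (x + real i *\<^sub>R v)))\<^sup>2) \<partial>lborel))"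
      by (rule nn_integral_weighted_sums) measurable
    also have "(\<lambda>p. \<integral>\<^sup>+x. ennreal (g (x + real p *\<^sub>R v)) \<partial>lborel) = (\<lambda>p. \<integral>\<^sup>+x. ennreal (g x) \<partial>lborel)"
      by (intro ext nn_integral_translation[where f="\<lambda>x. ennreal (g x)"]) measurable
    also have "(\<lambda>i. ennreal (real ((i + n) choose n)) * (\<integral>\<^sup>+x. ennreal ((cmod (D (x + real i *\<^sub>R v)))\<^sup>2) \<partial>lborel)) =
        (\<lambda>i. ennreal (real ((i + n) choose n)) * l2sq D)"
      unfolding l2sq_def
      by (intro ext arg_cong2[where f="(*)"] refl nn_integral_translation[where f="\<lambda>x. ennreal ((cmod (D x))\<^sup>2)"]) measurable
    also have "(\<Sum>i<N. ennreal (real ((i + n) choose n)) * l2sq D) = ennreal ?S * l2sq D"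
    proof -
      have "(\<Sum>i<N. ennreal (real ((i + n) choose n)) * l2sq D) = (\<Sum>i<N. ennreal (real ((i + n) choose n))) * l2sq D"
        by (rule sum_distrib_right[symmetric])
      also have "(\<Sum>i<N. ennreal (real ((i + n) choose n))) = ennreal (\<Sum>i<N. real ((i + n) choose n))"
        by (rule sum_ennreal) simp
      also have "(\<Sum>i<N. real ((i + n) choose n)) = ?S"
        by (simp only: sum_choose_const flip: of_nat_sum)
      finally show ?thesis .
    qed
    also have "(\<lambda>x. ennreal (g x)) = (\<lambda>x. indicator U x * ennreal ((cmod (h x))\<^sup>2))"
      by (auto simp: fun_eq_iff indicator_def g_def)
    also have "ennreal A * (\<Sum>p\<le>N + n. \<integral>\<^sup>+x. indicator U x * ennreal ((cmod (h x))\<^sup>2) \<partial>lborel) =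
        ennreal (A * real (Suc (N + n))) * (\<integral>\<^sup>+x. indicator U x * ennreal ((cmod (h x))\<^sup>2) \<partial>lborel)"
      unfolding ennreal_mult[OF A of_nat_0_le_iff] ennreal_of_nat_eq_real_of_nat[symmetric]
      by (simp only: sum_constant card_atMost mult.assoc)
    also have "ennreal (2 * ?S) * (ennreal ?S * l2sq D) = ennreal (2 * ?S\<^sup>2) * l2sq D"
      by (simp add: ennreal_mult power2_eq_square mult.assoc)
    finally show ?thesis unfolding D_def .
  qed
  moreover have "0 \<le> A * real (Suc (N + n))" using A by simp
  ultimately show ?thesis by blast
qed

section \<open>Windowed Fourier transforms\<close>

text \<open>This class contains the windows, is stable under twisted differences and lies in L1 and
  L2. So its members have a transform given by an integral, and their convolutions with L2 functions
  are defined at every point.\<close>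

definition test_fun :: "('a::euclidean_space \<Rightarrow> complex) \<Rightarrow> bool" where
  "test_fun \<Psi> \<longleftrightarrow> \<Psi> \<in> borel_measurable borel \<and> (\<exists>K. \<forall>x. cmod (\<Psi> x) \<le> K) \<and> (\<exists>r. \<forall>x. r \<le> norm x \<longrightarrow> \<Psi> x = 0)"

lemma test_fun_measurable [measurable_dest]: "test_fun \<Psi> \<Longrightarrow> \<Psi> \<in> borel_measurable borel"
  by (simp add: test_fun_def)

lemma
  fixes \<Psi> :: "'a::euclidean_space \<Rightarrow> complex"
  assumes "test_fun \<Psi>"
  shows test_fun_l2sq: "l2sq \<Psi> < \<infinity>" and test_fun_integrable: "integrable lborel \<Psi>"
proof -
  have [measurable]: "\<Psi> \<in> borel_measurable borel" using assms by measurable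
  obtain K r where K: "\<And>x. cmod (\<Psi> x) \<le> K" and r: "\<And>x. r \<le> norm x \<Longrightarrow> \<Psi> x = 0"
    using assms by (auto simp: test_fun_def)
  have "l2sq \<Psi> \<le> (\<integral>\<^sup>+x. ennreal (K\<^sup>2) * indicator (ball (0::'a) r) x \<partial>lborel)"
    unfolding l2sq_def
  proof (rule nn_integral_mono)
    fix x :: 'a show "ennreal ((cmod (\<Psi> x))\<^sup>2) \<le> ennreal (K\<^sup>2) * indicator (ball (0::'a) r) x"
      using K[of x] r[of x] by (cases "norm x < r") (auto intro!: ennreal_leI power_mono)
  qed
  also have "\<dots> = ennreal (K\<^sup>2) * emeasure lborel (ball (0::'a) r)"
    by (subst nn_integral_cmult_indicator) auto
  also have "\<dots> < \<infinity>"
    using emeasure_bounded_finite[of "ball (0::'a) r"] by (simp add: ennreal_mult_less_top)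
  finally show 1: "l2sq \<Psi> < \<infinity>" .
  show "integrable lborel \<Psi>"
    by (rule integrable_bounded_support[where a=0 and r=r]) (use 1 r in auto)
qed

lemma test_fun_twisted_diff:
  assumes "test_fun \<Psi>"
  shows "test_fun (twisted_diff \<theta> v \<Psi>)"
proof -
  have [measurable]: "\<Psi> \<in> borel_measurable borel" using assms by measurable
  obtain K r where K: "\<And>x. cmod (\<Psi> x) \<le> K" and r: "\<And>x. r \<le> norm x \<Longrightarrow> \<Psi> x = 0"
    using assms by (auto simp: test_fun_def)
  have "cmod (twisted_diff \<theta> v \<Psi> x) \<le> K + K" for x
  proof -
    have "cmod (twisted_diff \<theta> v \<Psi> x) \<le> cmod (\<Psi> x) + cmod (cis (- \<theta>) * \<Psi> (x + v))"
      unfolding twisted_diff_def by (rule norm_triangle_ineq4)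
    also have "\<dots> \<le> K + K" by (intro add_mono) (auto simp: norm_mult K)
    finally show ?thesis .
  qed
  moreover have "twisted_diff \<theta> v \<Psi> x = 0" if "r + norm v \<le> norm x" for x
  proof -
    have "r \<le> norm x" using that by (meson add_increasing2 norm_ge_zero order_refl order_trans)
    moreover have "r \<le> norm (x + v)" using that norm_diff_ineq[of x v] by linarith
    ultimately show ?thesis by (simp add: twisted_diff_def r)
  qed
  ultimately show ?thesis unfolding test_fun_def by (auto simp: borel_measurable_twisted_diff)
qed

lemma test_fun_twisted_diff_funpow:
  "test_fun \<Psi> \<Longrightarrow> test_fun ((twisted_diff \<theta> v ^^ k) \<Psi>)"
  by (induction k) (auto intro: test_fun_twisted_diff)

lemma fourier_twisted_diff:
  assumes "test_fun \<Psi>"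
  shows "fourier (twisted_diff \<theta> v \<Psi>) \<xi> = (1 - cis (2 * pi * (v \<bullet> \<xi>) - \<theta>)) * fourier \<Psi> \<xi>"
proof -
  have [measurable]: "\<Psi> \<in> borel_measurable borel" using assms by measurable
  have i: "integrable lborel \<Psi>" by (rule test_fun_integrable[OF assms])
  have iv: "integrable lborel (\<lambda>x. \<Psi> (x + v))"
    using integrable_lborel_affine[OF i, of 1 v] by (simp add: add.commute)
  have "fourier (twisted_diff \<theta> v \<Psi>) \<xi> = fourier \<Psi> \<xi> - fourier (\<lambda>x. cis (- \<theta>) * \<Psi> (x + v)) \<xi>"
    unfolding twisted_diff_def[abs_def] using i iv by (intro fourier_diff) auto
  also have "fourier (\<lambda>x. cis (- \<theta>) * \<Psi> (x + v)) \<xi> = cis (- \<theta>) * fourier (\<lambda>x. \<Psi> (x - - v)) \<xi>"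
    unfolding fourier_def by (simp add: mult.assoc)
  also have "\<dots> = cis (- \<theta>) * (cis (2 * pi * (v \<bullet> \<xi>)) * fourier \<Psi> \<xi>)"
    by (subst fourier_translation) auto
  also have "\<dots> = cis (2 * pi * (v \<bullet> \<xi>) - \<theta>) * fourier \<Psi> \<xi>"
    unfolding mult.assoc[symmetric] cis_mult by (simp add: algebra_simps)
  finally show ?thesis by (simp add: algebra_simps)
qed

lemma fourier_twisted_diff_funpow:
  assumes "test_fun \<Psi>"
  shows "fourier ((twisted_diff \<theta> v ^^ k) \<Psi>) \<xi> = (1 - cis (2 * pi * (v \<bullet> \<xi>) - \<theta>)) ^ k * fourier \<Psi> \<xi>"
  by (induction k) (simp_all add: fourier_twisted_diff test_fun_twisted_diff_funpow assms)

lemma integrable_conv_test_fun: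
  fixes f \<Psi> :: "'a::euclidean_space \<Rightarrow> complex"
  assumes [measurable]: "f \<in> borel_measurable borel" and fin: "l2sq f < \<infinity>" and \<Psi>: "test_fun \<Psi>"
  shows "integrable lborel (\<lambda>y. f y * \<Psi> (x - y))"
proof (rule integrable_mult_l2)
  have [measurable]: "\<Psi> \<in> borel_measurable borel" using \<Psi> by measurable
  show "(\<lambda>y. \<Psi> (x - y)) \<in> borel_measurable borel" by measurable
  have "l2sq (\<lambda>y. \<Psi> (x - y)) = l2sq \<Psi>"
    unfolding l2sq_def by (subst (2) nn_integral_lborel_affine[of _ "-1" x]) auto
  then show "l2sq (\<lambda>y. \<Psi> (x - y)) < \<infinity>" using test_fun_l2sq[OF \<Psi>] by simp
qed (use fin in auto)

lemma twisted_diff_conv: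
  fixes f \<Psi> :: "'a::euclidean_space \<Rightarrow> complex"
  assumes "f \<in> borel_measurable borel" "l2sq f < \<infinity>" "test_fun \<Psi>"
  shows "twisted_diff \<theta> v (conv f \<Psi>) = conv f (twisted_diff \<theta> v \<Psi>)"
proof
  fix x
  note i = integrable_conv_test_fun[OF assms]
  have "conv f (twisted_diff \<theta> v \<Psi>) x = (LINT y|lborel. f y * \<Psi> (x - y) - cis (- \<theta>) * (f y * \<Psi> (x + v - y)))"
    unfolding conv_def twisted_diff_def by (simp add: algebra_simps)
  also have "\<dots> = twisted_diff \<theta> v (conv f \<Psi>) x"
    using i[of x] i[of "x + v"] unfolding conv_def twisted_diff_def by simp
  finally show "twisted_diff \<theta> v (conv f \<Psi>) x = conv f (twisted_diff \<theta> v \<Psi>) x" ..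
qed

text \<open>The differences move from the piece to its window, so the translation rule is applied to
  the transform of an integrable function and not to the L2 transform of f.\<close>

lemma twisted_diff_funpow_conv:
  fixes f \<Psi> :: "'a::euclidean_space \<Rightarrow> complex"
  assumes "f \<in> borel_measurable borel" "l2sq f < \<infinity>" "test_fun \<Psi>"
  shows "(twisted_diff \<theta> v ^^ k) (conv f \<Psi>) = conv f ((twisted_diff \<theta> v ^^ k) \<Psi>)"
  by (induction k) (simp_all add: twisted_diff_conv[OF assms(1,2)] test_fun_twisted_diff_funpow assms(3))

text \<open>The factor 2 is not optimal; it comes from passing to the limit with the crude bound
  \<open>\<bar>a\<bar>\<^sup>2 \<le> 2 \<bar>b\<bar>\<^sup>2 + 2 \<bar>a - b\<bar>\<^sup>2\<close>.\<close>
lemma l2sq_conv_le: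
  fixes f F \<Psi> :: "'a::euclidean_space \<Rightarrow> complex"
  assumes pair: "fourier_pair f F" and \<Psi>: "test_fun \<Psi>"
  shows "l2sq (conv f \<Psi>) \<le> 2 * (\<integral>\<^sup>+\<xi>. ennreal ((cmod (fourier \<Psi> \<xi>))\<^sup>2) * ennreal ((cmod (F \<xi>))\<^sup>2) \<partial>lborel)"
proof -
  have [measurable]: "f \<in> borel_measurable borel" "F \<in> borel_measurable borel" "\<Psi> \<in> borel_measurable borel"
    and fin: "l2sq f < \<infinity>" and lim: "(\<lambda>n. l2sq (\<lambda>\<xi>. fourier (trunc n f) \<xi> - F \<xi>)) \<longlonglongrightarrow> 0"
    using pair \<Psi> by (auto simp: fourier_pair_def test_fun_def)
  obtain K where K: "\<And>x. cmod (\<Psi> x) \<le> K" using \<Psi> by (auto simp: test_fun_def)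
  note i\<Psi> = test_fun_integrable[OF \<Psi>] and it = integrable_trunc[OF _ fin]
  define W where "W = (LINT x|lborel. cmod (\<Psi> x))"
  have e: "l2sq (conv (trunc n f) \<Psi>) =
      (\<integral>\<^sup>+\<xi>. ennreal ((cmod (fourier \<Psi> \<xi>))\<^sup>2) * ennreal ((cmod (fourier (trunc n f) \<xi>))\<^sup>2) \<partial>lborel)" for n
  proof -
    have ic: "integrable lborel (conv (trunc n f) \<Psi>)" by (intro integrable_conv it i\<Psi>) auto
    \<comment> \<open>The convolution is integrable and bounded by c, hence square integrable, as
      Plancherel demands.\<close>
    define c where "c = (LINT x|lborel. cmod (trunc n f x)) * K"
    have bc: "cmod (conv (trunc n f) \<Psi> x) \<le> c" for x
    proof -
      have "cmod (conv (trunc n f) \<Psi> x) \<le> (LINT y|lborel. cmod (trunc n f y * \<Psi> (x - y)))"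
        unfolding conv_def by (rule integral_norm_bound)
      also have "\<dots> \<le> (LINT y|lborel. cmod (trunc n f y) * K)"
      proof (rule integral_mono)
        show "integrable lborel (\<lambda>y. cmod (trunc n f y * \<Psi> (x - y)))"
          by (intro integrable_norm integrable_conv_test_fun l2sq_trunc_finite fin \<Psi>) auto
        show "integrable lborel (\<lambda>y. cmod (trunc n f y) * K)" using it[of n] by auto
      qed (auto simp: norm_mult K mult_left_mono)
      finally show ?thesis by (simp add: c_def)
    qed
    have "integrable lborel (\<lambda>x. (cmod (conv (trunc n f) \<Psi> x))\<^sup>2)"
    proof (rule Bochner_Integration.integrable_bound)
      show "integrable lborel (\<lambda>x. c * cmod (conv (trunc n f) \<Psi> x))" using ic by auto
      show "AE x in lborel. norm ((cmod (conv (trunc n f) \<Psi> x))\<^sup>2) \<le> norm (c * cmod (conv (trunc n f) \<Psi> x))"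
      proof (intro AE_I2)
        fix x
        have "0 \<le> c" using bc[of x] norm_ge_zero order_trans by blast
        then show "norm ((cmod (conv (trunc n f) \<Psi> x))\<^sup>2) \<le> norm (c * cmod (conv (trunc n f) \<Psi> x))"
          using bc[of x] by (simp add: power2_eq_square mult_right_mono abs_mult)
      qed
    qed auto
    then have "l2sq (conv (trunc n f) \<Psi>) < \<infinity>"
      unfolding infinity_ennreal_def by (subst l2sq_finite_iff) auto
    then have "l2sq (conv (trunc n f) \<Psi>) = l2sq (fourier (conv (trunc n f) \<Psi>))"
      using plancherel[OF ic] by simp
    also have "\<dots> = (\<integral>\<^sup>+\<xi>. ennreal ((cmod (fourier \<Psi> \<xi>))\<^sup>2) * ennreal ((cmod (fourier (trunc n f) \<xi>))\<^sup>2) \<partial>lborel)"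
      unfolding l2sq_def
      by (intro nn_integral_cong) (simp add: fourier_conv it i\<Psi> norm_mult power_mult_distrib ennreal_mult mult.commute)
    finally show ?thesis .
  qed
  have wb: "ennreal ((cmod (fourier \<Psi> \<xi>))\<^sup>2) \<le> ennreal (W\<^sup>2)" for \<xi>
    unfolding W_def by (intro ennreal_leI power_mono cmod_fourier_le i\<Psi>) auto
  show ?thesis
    unfolding l2sq_def[of "conv f \<Psi>"]
  \<comment> \<open>The truncated convolutions converge at every point, and the error on the
    frequency side is controlled by W^2 times the squared distance of the transforms.\<close>
  proof (rule nn_integral_fatou_bound[where c="\<lambda>n. 2 * ennreal (W\<^sup>2) * l2sq (\<lambda>\<xi>. fourier (trunc n f) \<xi> - F \<xi>)"])
    show "(\<lambda>x. ennreal ((cmod (conv (trunc n f) \<Psi> x))\<^sup>2)) \<in> borel_measurable lborel" for n by measurable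
    show "AE x in lborel. (\<lambda>n. ennreal ((cmod (conv (trunc n f) \<Psi> x))\<^sup>2)) \<longlonglongrightarrow> ennreal ((cmod (conv f \<Psi> x))\<^sup>2)"
    proof (intro AE_I2 tendsto_ennrealI tendsto_power tendsto_norm)
      fix x
      show "(\<lambda>n. conv (trunc n f) \<Psi> x) \<longlonglongrightarrow> conv f \<Psi> x"
        unfolding conv_def
      proof (rule integral_dominated_convergence[where w="\<lambda>y. cmod (f y * \<Psi> (x - y))"])
        show "integrable lborel (\<lambda>y. cmod (f y * \<Psi> (x - y)))"
          by (intro integrable_norm integrable_conv_test_fun fin \<Psi>) auto
        show "AE y in lborel. (\<lambda>n. trunc n f y * \<Psi> (x - y)) \<longlonglongrightarrow> f y * \<Psi> (x - y)"
        proof (intro AE_I2 tendsto_eventually)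
          fix y :: 'a
          obtain N where "norm y < real N" using reals_Archimedean2 by blast
          then show "\<forall>\<^sub>F n in sequentially. trunc n f y * \<Psi> (x - y) = f y * \<Psi> (x - y)"
            by (intro eventually_sequentiallyI[of N]) (simp add: trunc_def)
        qed
        show "AE y in lborel. norm (trunc n f y * \<Psi> (x - y)) \<le> cmod (f y * \<Psi> (x - y))" for n
          by (auto simp: norm_mult intro!: mult_right_mono cmod_trunc_le)
      qed auto
    qed
    show "\<forall>\<^sub>F n in sequentially. (\<integral>\<^sup>+x. ennreal ((cmod (conv (trunc n f) \<Psi> x))\<^sup>2) \<partial>lborel) \<le>
       2 * (\<integral>\<^sup>+\<xi>. ennreal ((cmod (fourier \<Psi> \<xi>))\<^sup>2) * ennreal ((cmod (F \<xi>))\<^sup>2) \<partial>lborel)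
       + 2 * ennreal (W\<^sup>2) * l2sq (\<lambda>\<xi>. fourier (trunc n f) \<xi> - F \<xi>)"
      unfolding l2sq_def[of "conv (trunc _ f) \<Psi>", symmetric] e
      by (intro always_eventually allI nn_integral_weighted_square_le wb) auto
    have "(\<lambda>n. 2 * ennreal (W\<^sup>2) * l2sq (\<lambda>\<xi>. fourier (trunc n f) \<xi> - F \<xi>)) \<longlonglongrightarrow> 2 * ennreal (W\<^sup>2) * 0"
      by (intro ennreal_tendsto_cmult lim) (auto simp: ennreal_mult_less_top)
    then show "(\<lambda>n. 2 * ennreal (W\<^sup>2) * l2sq (\<lambda>\<xi>. fourier (trunc n f) \<xi> - F \<xi>)) \<longlonglongrightarrow> 0" by simp
  qed
qed

section \<open>Sharply cut off plane waves\<close>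

definition wave :: "real \<Rightarrow> 'a::euclidean_space \<Rightarrow> 'a \<Rightarrow> complex" where
  "wave r \<eta> z = (if norm z < r then cis (2 * pi * (z \<bullet> \<eta>)) else 0)"

lemma borel_measurable_wave [measurable]: "wave r \<eta> \<in> borel_measurable borel"
  unfolding wave_def[abs_def] by measurable

lemma test_fun_wave: "test_fun (wave r \<eta>)"
  unfolding test_fun_def by (auto simp: wave_def intro: exI[of _ 1] exI[of _ r])

lemma fourier_wave: "fourier (wave r \<eta>) \<xi> = fourier (wave r 0) (\<xi> - \<eta>)"
  unfolding fourier_def
  by (intro Bochner_Integration.integral_cong) (auto simp: wave_def cis_mult inner_diff_right algebra_simps)

lemma l2sq_wave:
  "l2sq (wave r (0::'a::euclidean_space)) = emeasure lborel (ball (0::'a) r)"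
proof -
  have "l2sq (wave r (0::'a)) = (\<integral>\<^sup>+x. indicator (ball (0::'a) r) x \<partial>lborel)"
    unfolding l2sq_def by (intro nn_integral_cong) (simp add: wave_def)
  then show ?thesis by simp
qed

text \<open>For fixed x the value of the piece at x is, as a function of \<eta> and up to a
  unimodular factor, the transform of f restricted to the ball of radius r around x. Plancherel is
  applied in the variable \<eta>.\<close>

lemma nn_integral_conv_wave:
  fixes f :: "'a::euclidean_space \<Rightarrow> complex"
  assumes [measurable]: "f \<in> borel_measurable borel" and fin: "l2sq f < \<infinity>"
  shows "(\<integral>\<^sup>+\<eta>. ennreal ((cmod (conv f (wave r \<eta>) x))\<^sup>2) \<partial>lborel) =
    (\<integral>\<^sup>+y. (if norm (x - y) < r then ennreal ((cmod (f y))\<^sup>2) else 0) \<partial>lborel)"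
proof -
  define g where "g y = (if norm (x - y) < r then f y else 0)" for y
  have [measurable]: "g \<in> borel_measurable borel" unfolding g_def by measurable
  have "l2sq g \<le> l2sq f" by (intro l2sq_mono) (auto simp: g_def)
  then have gfin: "l2sq g < \<infinity>" using fin by (rule order_le_less_trans)
  have gi: "integrable lborel g"
    by (rule integrable_bounded_support[where a=x and r=r]) (use gfin in \<open>auto simp: g_def dist_norm\<close>)
  have "conv f (wave r \<eta>) x = cis (2 * pi * (x \<bullet> \<eta>)) * fourier g \<eta>" for \<eta>
  proof -
    have "conv f (wave r \<eta>) x = (LINT y|lborel. cis (2 * pi * (x \<bullet> \<eta>)) * (g y * cis (- 2 * pi * (y \<bullet> \<eta>))))"
      unfolding conv_def
    proof (intro Bochner_Integration.integral_cong refl)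
      fix y
      have "cis (2 * pi * ((x - y) \<bullet> \<eta>)) = cis (2 * pi * (x \<bullet> \<eta>)) * cis (- 2 * pi * (y \<bullet> \<eta>))"
        unfolding cis_mult by (simp add: inner_diff_left algebra_simps)
      then show "f y * wave r \<eta> (x - y) = cis (2 * pi * (x \<bullet> \<eta>)) * (g y * cis (- 2 * pi * (y \<bullet> \<eta>)))"
        by (simp add: wave_def g_def)
    qed
    then show ?thesis by (simp add: fourier_def)
  qed
  then have "(\<integral>\<^sup>+\<eta>. ennreal ((cmod (conv f (wave r \<eta>) x))\<^sup>2) \<partial>lborel) = l2sq (fourier g)"
    by (simp add: l2sq_def norm_mult)
  also have "\<dots> = l2sq g" by (rule plancherel[OF gi gfin])
  also have "\<dots> = (\<integral>\<^sup>+y. (if norm (x - y) < r then ennreal ((cmod (f y))\<^sup>2) else 0) \<partial>lborel)"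
    unfolding l2sq_def g_def by (intro nn_integral_cong) auto
  finally show ?thesis .
qed

lemma borel_measurable_conv_wave [measurable (raw)]:
  fixes f :: "'a::euclidean_space \<Rightarrow> complex"
  assumes [measurable]: "f \<in> borel_measurable borel" "a \<in> borel_measurable M" "b \<in> borel_measurable M"
  shows "(\<lambda>p. conv f (wave r (a p)) (b p)) \<in> borel_measurable M"
  unfolding conv_def wave_def by measurable

lemma emeasure_ball_eq:
  fixes y :: "'a::euclidean_space"
  shows "(\<integral>\<^sup>+x. (if norm (x - y) < r then 1 else 0) \<partial>lborel) = emeasure lborel (ball (0::'a) r)"
proof -
  have "(\<integral>\<^sup>+x. (if norm (x - y) < r then 1 else 0 :: ennreal) \<partial>lborel) = (\<integral>\<^sup>+x. (if norm (x::'a) < r then 1 else 0) \<partial>lborel)"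
    using nn_integral_translation[of "\<lambda>x::'a. if norm x < r then 1 else 0 :: ennreal" "-y"] by simp
  also have "\<dots> = (\<integral>\<^sup>+x. indicator (ball (0::'a) r) x \<partial>lborel)"
    by (intro nn_integral_cong) simp
  finally show ?thesis by simp
qed

lemma nn_integral_conv_wave_on:
  fixes f :: "'a::euclidean_space \<Rightarrow> complex"
  assumes [measurable]: "f \<in> borel_measurable borel" "S \<in> sets borel" "T \<in> sets borel" and fin: "l2sq f < \<infinity>"
    and ST: "\<And>x y. x \<in> S \<Longrightarrow> norm (x - y) < r \<Longrightarrow> y \<in> T"
  shows "(\<integral>\<^sup>+\<eta>. (\<integral>\<^sup>+x. indicator S x * ennreal ((cmod (conv f (wave r \<eta>) x))\<^sup>2) \<partial>lborel) \<partial>lborel) \<le>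
    emeasure lborel (ball (0::'a) r) * (\<integral>\<^sup>+y. indicator T y * ennreal ((cmod (f y))\<^sup>2) \<partial>lborel)"
    and "(\<integral>\<^sup>+\<eta>. l2sq (conv f (wave r \<eta>)) \<partial>lborel) = emeasure lborel (ball (0::'a) r) * l2sq f"
proof -
  have swap: "(\<integral>\<^sup>+\<eta>. (\<integral>\<^sup>+x. indicator S x * ennreal ((cmod (conv f (wave r \<eta>) x))\<^sup>2) \<partial>lborel) \<partial>lborel) =
    (\<integral>\<^sup>+y. (\<integral>\<^sup>+x. indicator S x * (if norm (x - y) < r then ennreal ((cmod (f y))\<^sup>2) else 0) \<partial>lborel) \<partial>lborel)"
    if [measurable]: "S \<in> sets borel" for S
  proof -
    have "(\<integral>\<^sup>+\<eta>. (\<integral>\<^sup>+x. indicator S x * ennreal ((cmod (conv f (wave r \<eta>) x))\<^sup>2) \<partial>lborel) \<partial>lborel) =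
      (\<integral>\<^sup>+x. (\<integral>\<^sup>+\<eta>. indicator S x * ennreal ((cmod (conv f (wave r \<eta>) x))\<^sup>2) \<partial>lborel) \<partial>lborel)"
      by (rule lborel_pair.Fubini') measurable
    also have "\<dots> = (\<integral>\<^sup>+x. (\<integral>\<^sup>+y. indicator S x * (if norm (x - y) < r then ennreal ((cmod (f y))\<^sup>2) else 0) \<partial>lborel) \<partial>lborel)"
      by (simp add: nn_integral_cmult nn_integral_conv_wave[OF assms(1) fin])
    also have "\<dots> = (\<integral>\<^sup>+y. (\<integral>\<^sup>+x. indicator S x * (if norm (x - y) < r then ennreal ((cmod (f y))\<^sup>2) else 0) \<partial>lborel) \<partial>lborel)"
      by (rule lborel_pair.Fubini') measurable
    finally show ?thesis .
  qed
  have "(\<integral>\<^sup>+\<eta>. (\<integral>\<^sup>+x. indicator S x * ennreal ((cmod (conv f (wave r \<eta>) x))\<^sup>2) \<partial>lborel) \<partial>lborel) \<le>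
    (\<integral>\<^sup>+y. (\<integral>\<^sup>+x. indicator T y * ennreal ((cmod (f y))\<^sup>2) * (if norm (x - y) < r then 1 else 0) \<partial>lborel) \<partial>lborel)"
    \<comment> \<open>The only loss: if x is in S and y within r of x, then y is in T. Over the
      whole space no indicator is exchanged, whence the equality in the second claim.\<close>
    unfolding swap[OF assms(2)] by (intro nn_integral_mono) (auto simp: indicator_def dest: ST)
  also have "\<dots> = (\<integral>\<^sup>+y. indicator T y * ennreal ((cmod (f y))\<^sup>2) * emeasure lborel (ball (0::'a) r) \<partial>lborel)"
    by (subst nn_integral_cmult) (simp_all add: emeasure_ball_eq)
  also have "\<dots> = emeasure lborel (ball (0::'a) r) * (\<integral>\<^sup>+y. indicator T y * ennreal ((cmod (f y))\<^sup>2) \<partial>lborel)"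
    by (subst nn_integral_multc) (simp_all add: mult.commute)
  finally show "(\<integral>\<^sup>+\<eta>. (\<integral>\<^sup>+x. indicator S x * ennreal ((cmod (conv f (wave r \<eta>) x))\<^sup>2) \<partial>lborel) \<partial>lborel) \<le>
    emeasure lborel (ball (0::'a) r) * (\<integral>\<^sup>+y. indicator T y * ennreal ((cmod (f y))\<^sup>2) \<partial>lborel)" .
  have "(\<integral>\<^sup>+\<eta>. l2sq (conv f (wave r \<eta>)) \<partial>lborel) =
     (\<integral>\<^sup>+y. (\<integral>\<^sup>+x. ennreal ((cmod (f y))\<^sup>2) * (if norm (x - y) < r then 1 else 0) \<partial>lborel) \<partial>lborel)"
    using swap[of UNIV] by (simp add: l2sq_def if_distrib[of "\<lambda>c. _ * c"] cong: if_cong)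
  also have "\<dots> = (\<integral>\<^sup>+y. ennreal ((cmod (f y))\<^sup>2) * emeasure lborel (ball (0::'a) r) \<partial>lborel)"
    by (subst nn_integral_cmult) (simp_all add: emeasure_ball_eq)
  also have "\<dots> = emeasure lborel (ball (0::'a) r) * l2sq f"
    by (subst nn_integral_multc) (simp_all add: mult.commute l2sq_def)
  finally show "(\<integral>\<^sup>+\<eta>. l2sq (conv f (wave r \<eta>)) \<partial>lborel) = emeasure lborel (ball (0::'a) r) * l2sq f" .
qed

section \<open>Smallness of tails, multipliers and factorial quotients\<close>

lemma tendsto_tail:
  fixes g :: "'a::euclidean_space \<Rightarrow> complex"
  assumes [measurable]: "g \<in> borel_measurable borel" and fin: "l2sq g < \<infinity>"
  shows "(\<lambda>n. \<integral>\<^sup>+z. (if real n < norm z then ennreal ((cmod (g z))\<^sup>2) else 0) \<partial>lborel) \<longlonglongrightarrow> 0"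
proof -
  have "(\<lambda>n. \<integral>\<^sup>+z. (if real n < norm z then ennreal ((cmod (g z))\<^sup>2) else 0) \<partial>lborel) \<longlonglongrightarrow> (\<integral>\<^sup>+(z::'a). 0 \<partial>lborel)"
  proof (rule nn_integral_dominated_convergence[where w="\<lambda>x. ennreal ((cmod (g x))\<^sup>2)"])
    show "AE z::'a in lborel. (\<lambda>n. if real n < norm z then ennreal ((cmod (g z))\<^sup>2) else 0) \<longlonglongrightarrow> 0"
    proof (intro AE_I2 tendsto_eventually)
      fix z :: 'a
      obtain N where "norm z < real N" using reals_Archimedean2 by blast
      then show "\<forall>\<^sub>F n in sequentially. (if real n < norm z then ennreal ((cmod (g z))\<^sup>2) else 0) = 0"
        by (intro eventually_sequentiallyI[of N]) auto
    qed
  qed (use fin in \<open>auto simp: l2sq_def\<close>)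
  then show ?thesis by simp
qed

text \<open>The first bound serves the frequencies in the slab, where it yields the small factor t
  M; the second serves the far ones.\<close>

lemma cmod_one_minus_cis_le: "cmod (1 - cis t) \<le> \<bar>t\<bar>" "cmod (1 - cis t) \<le> 2"
proof -
  show "cmod (1 - cis t) \<le> 2" using norm_triangle_ineq4[of 1 "cis t"] by simp
  have "(cmod (1 - cis t))\<^sup>2 = (1 - cos t)\<^sup>2 + (sin t)\<^sup>2" by (simp add: cmod_power2)
  also have "\<dots> = 2 - 2 * cos t"
    using sin_cos_squared_add[of t] by (simp add: power2_diff)
  also have "\<dots> = 4 * (sin (t / 2))\<^sup>2"
    using cos_double_sin[of "t / 2"] by simp
  also have "\<dots> \<le> 4 * (t / 2)\<^sup>2"
    using abs_le_square_iff[THEN iffD1, OF abs_sin_x_le_abs_x[of "t / 2"]] by (intro mult_left_mono) auto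
  finally have "(cmod (1 - cis t))\<^sup>2 \<le> t\<^sup>2" by (simp add: power_divide)
  then show "cmod (1 - cis t) \<le> \<bar>t\<bar>" by (simp add: abs_le_square_iff[symmetric])
qed

lemma ex_power_div_fact_less:
  fixes X e :: real
  assumes "e > 0"
  shows "\<exists>n. \<bar>X ^ Suc n / fact (Suc n)\<bar> < e"
proof -
  have "(\<lambda>n. X ^ n / fact n) \<longlonglongrightarrow> 0"
    using summable_LIMSEQ_zero[OF summable_exp[of X]] by (simp add: field_simps)
  then have "(\<lambda>n. X ^ Suc n / fact (Suc n)) \<longlonglongrightarrow> 0" by (rule LIMSEQ_Suc)
  from LIMSEQ_D[OF this assms] show ?thesis by auto
qed

section \<open>The uncertainty principle\<close>

lemma open_nbhd: "open (nbhd r A)"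
  by (auto simp: nbhd_def)

text \<open>The binomial coefficient is at most (N + n)^(n+1) / (n+1)!, while N t \<le> l + t and (n
  + 1) t = r give (N + n) t \<le> l + r. A finer step raises the number of samples at the rate at
  which it lowers the multiplier, and the factorial remains as the gain.\<close>

lemma choose_mult_power_le:
  fixes t M l r :: real and n :: nat
  assumes r: "r > 0" and l: "l \<ge> 0" and M: "M \<ge> 0" and t: "t = r / real (Suc n)" and N: "N = nat \<lceil>l / t\<rceil>"
  shows "real ((N + n) choose Suc n) * (2 * pi * t * M) ^ Suc n \<le> (2 * pi * M * (l + r)) ^ Suc n / fact (Suc n)"
proof -
  have t0: "t > 0" using r t by simp
  have "real N \<le> l / t + 1" unfolding N using l t0 by (simp add: of_nat_nat)
  then have "(real N + real n) * t \<le> (l / t + 1 + real n) * t" using t0 by (intro mult_right_mono) auto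
  also have "\<dots> = l + t * real (Suc n)" using t0 by (simp add: field_simps)
  also have "\<dots> = l + r" by (simp add: t)
  finally have le: "(real N + real n) * t \<le> l + r" .
  have "real ((N + n) choose Suc n) * fact (Suc n) = real (((N + n) choose Suc n) * fact (Suc n))"
    by (simp only: of_nat_mult of_nat_fact)
  also have "\<dots> \<le> real ((N + n) ^ Suc n)"
    using binomial_fact_pow[of "N + n" "Suc n"] by (simp only: of_nat_le_iff)
  finally have "real ((N + n) choose Suc n) * fact (Suc n) * (2 * pi * t * M) ^ Suc n \<le> (real N + real n) ^ Suc n * (2 * pi * t * M) ^ Suc n"
    using t0 M by (intro mult_right_mono) auto
  also have "\<dots> = (2 * pi * M * ((real N + real n) * t)) ^ Suc n"
    unfolding power_mult_distrib[symmetric] by (simp add: mult_ac)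
  also have "\<dots> \<le> (2 * pi * M * (l + r)) ^ Suc n"
    using le t0 M by (intro power_mono mult_left_mono) auto
  finally have "real ((N + n) choose Suc n) * (2 * pi * t * M) ^ Suc n * fact (Suc n) \<le> (2 * pi * M * (l + r)) ^ Suc n"
    by (simp only: mult_ac)
  then show ?thesis by (simp only: pos_le_divide_eq fact_gt_zero)
qed

text \<open>With m the first index such that m t \<ge> s, the n + 1 points from m on lie beyond s by
  less than t + n t = r. This is the reason for t = r / (n + 1).\<close>

lemma ex_sampling_window:
  fixes E :: "'a::euclidean_space set"
  assumes r: "r > 0" and l: "l > 0" and t: "t = r / real (Suc n)" and N: "N = nat \<lceil>l / t\<rceil>"
    and s: "0 \<le> s" "s \<le> l" "x + s *\<^sub>R \<omega> \<in> E" and \<omega>: "norm \<omega> = 1"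
  shows "\<exists>m\<le>N. \<forall>j\<le>n. x + real (m + j) *\<^sub>R (t *\<^sub>R \<omega>) \<in> nbhd r E"
proof -
  have t0: "t > 0" using r t by simp
  define m where "m = nat \<lceil>s / t\<rceil>"
  have "s / t \<le> real m" "real m < s / t + 1"
    unfolding m_def using s t0 by (simp_all add: of_nat_nat) linarith
  then have m: "s \<le> real m * t" "real m * t < s + t" using t0 by (simp_all add: field_simps)
  have "m \<le> N" unfolding m_def N using s t0 by (intro nat_mono ceiling_mono divide_right_mono) auto
  moreover have "x + real (m + j) *\<^sub>R (t *\<^sub>R \<omega>) \<in> nbhd r E" if "j \<le> n" for j
  proof -
    have "real (m + j) * t = real m * t + real j * t" by (simp add: algebra_simps)
    moreover have "real j * t \<le> real n * t" using that t0 by (intro mult_right_mono) auto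
    moreover have "real n * t + t = r"
    proof -
      have "real n * t + t = real (Suc n) * t" by (simp add: algebra_simps)
      then show ?thesis by (simp add: t)
    qed
    moreover have "0 \<le> real j * t" using t0 by simp
    ultimately have "\<bar>s - real (m + j) * t\<bar> < r" using m by linarith
    moreover have "(x + s *\<^sub>R \<omega>) - (x + real (m + j) *\<^sub>R (t *\<^sub>R \<omega>)) = (s - real (m + j) * t) *\<^sub>R \<omega>"
      by (simp add: scaleR_diff_left)
    then have "dist (x + s *\<^sub>R \<omega>) (x + real (m + j) *\<^sub>R (t *\<^sub>R \<omega>)) = \<bar>s - real (m + j) * t\<bar>"
      unfolding dist_norm using \<omega> by (simp only: norm_scaleR mult_1_right real_norm_def)
    ultimately show ?thesis using s(3) unfolding nbhd_def by (intro UN_I[of "x + s *\<^sub>R \<omega>"]) auto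
  qed
  ultimately show ?thesis by blast
qed

text \<open>Averaging over the centres \<eta> replaces the pointwise size of a weight by its
  integral; this is what makes a small L2 tail of \<phi> usable.\<close>

lemma nn_integral_frequency_shift:
  fixes w :: "'a::euclidean_space \<Rightarrow> ennreal"
  assumes [measurable]: "w \<in> borel_measurable borel" "F \<in> borel_measurable borel"
  shows "(\<integral>\<^sup>+\<eta>. (\<integral>\<^sup>+\<xi>. w (\<xi> - \<eta>) * ennreal ((cmod (F \<xi>))\<^sup>2) \<partial>lborel) \<partial>lborel) = (\<integral>\<^sup>+z. w z \<partial>lborel) * l2sq F"
proof -
  have "(\<integral>\<^sup>+\<eta>. (\<integral>\<^sup>+\<xi>. w (\<xi> - \<eta>) * ennreal ((cmod (F \<xi>))\<^sup>2) \<partial>lborel) \<partial>lborel) =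
    (\<integral>\<^sup>+\<xi>. (\<integral>\<^sup>+\<eta>. w (\<xi> - \<eta>) * ennreal ((cmod (F \<xi>))\<^sup>2) \<partial>lborel) \<partial>lborel)"
    by (rule lborel_pair.Fubini') measurable
  also have "\<dots> = (\<integral>\<^sup>+\<xi>. (\<integral>\<^sup>+z. w z \<partial>lborel) * ennreal ((cmod (F \<xi>))\<^sup>2) \<partial>lborel)"
  proof (intro nn_integral_cong)
    fix \<xi> :: 'a
    have "(\<integral>\<^sup>+\<eta>. w (\<xi> - \<eta>) \<partial>lborel) = (\<integral>\<^sup>+z. w z \<partial>lborel)"
      using nn_integral_lborel_affine[of w "-1" \<xi>] by simp
    then show "(\<integral>\<^sup>+\<eta>. w (\<xi> - \<eta>) * ennreal ((cmod (F \<xi>))\<^sup>2) \<partial>lborel) = (\<integral>\<^sup>+z. w z \<partial>lborel) * ennreal ((cmod (F \<xi>))\<^sup>2)"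
      by (subst nn_integral_multc) auto
  qed
  also have "\<dots> = (\<integral>\<^sup>+z. w z \<partial>lborel) * l2sq F"
    unfolding l2sq_def by (rule nn_integral_cmult) measurable
  finally show ?thesis .
qed

text \<open>The error costs at most 8 (1/64 + 1/32) = 3/8 of V a: 1/64 from (S q)^2, 1/32 from the
  choice of e. This is below the half that is moved to the left.\<close>

lemma real_absorb:
  fixes V a A u S q e k :: real
  assumes V: "0 < V" and le: "V * a \<le> A * (V * u) + 4 * S\<^sup>2 * ((q\<^sup>2 * V + k * e) * (2 * a))"
    and Sq: "0 \<le> S * q" "S * q \<le> 1 / 8" and e: "e = V / (32 * (S\<^sup>2 + 1) * k)" and a: "0 \<le> a" and k: "0 < k"
  shows "a \<le> 2 * A * u"
proof -
  have "(S * q)\<^sup>2 \<le> (1/8)\<^sup>2" using Sq by (intro power_mono)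
  then have 1: "S\<^sup>2 * q\<^sup>2 \<le> 1/64" unfolding power_mult_distrib by (simp add: power_divide)
  have S1: "0 < S\<^sup>2 + 1" by (simp add: add_nonneg_pos)
  have ke: "k * e = V / (32 * (S\<^sup>2 + 1))" using k unfolding e by simp
  have "S\<^sup>2 * V \<le> (S\<^sup>2 + 1) * V" using V by simp
  then have 2: "S\<^sup>2 * (k * e) \<le> V / 32" unfolding ke using S1 by (simp add: field_simps)
  have "4 * S\<^sup>2 * ((q\<^sup>2 * V + k * e) * (2 * a)) = 8 * a * ((S\<^sup>2 * q\<^sup>2) * V + S\<^sup>2 * (k * e))"
    by (simp add: algebra_simps)
  also have "\<dots> \<le> 8 * a * ((1/64) * V + V / 32)"
    using 1 2 a V by (intro mult_left_mono add_mono mult_right_mono) auto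
  also have "\<dots> \<le> V * a / 2" using a V by (simp add: field_simps)
  finally have "V * a \<le> V * (2 * A * u)" using le by (simp add: algebra_simps)
  then show ?thesis using V by simp
qed

text \<open>The order of choices is the point: n comes from M, l and r, then t, N, S, q and A, and
  last \<rho> from the tail of \<phi>. None of them depends on K, f, or the direction and centre of
  the slab, which may change with \<eta>. The radius 2 r is r for reaching E from the samples plus r
  for the support of the window.\<close>

lemma l2sq_le_nbhd:
  fixes E :: "'a::euclidean_space set"
  assumes r: "r > 0" and l: "l > 0" and M: "M > 0"
    and hit: "\<And>x \<omega>. norm \<omega> = 1 \<Longrightarrow> \<exists>s. 0 \<le> s \<and> s \<le> l \<and> x + s *\<^sub>R \<omega> \<in> E"
  shows "\<exists>\<rho>>0. \<exists>C\<ge>0. \<forall>K f F. fourier_pair f F \<longrightarrow> (AE \<xi> in lborel. \<xi> \<notin> K \<longrightarrow> F \<xi> = 0) \<longrightarrow>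
    (\<forall>\<eta>. \<exists>\<omega> c. norm \<omega> = 1 \<and> (\<forall>\<xi>\<in>K. norm (\<xi> - \<eta>) \<le> \<rho> \<longrightarrow> \<bar>\<xi> \<bullet> \<omega> - c\<bar> \<le> M)) \<longrightarrow>
    l2sq f \<le> ennreal C * (\<integral>\<^sup>+y. indicator (nbhd (2 * r) E) y * ennreal ((cmod (f y))\<^sup>2) \<partial>lborel)"
proof -
  obtain n where n: "\<bar>(2 * pi * M * (l + r)) ^ Suc n / fact (Suc n)\<bar> < 1 / 8"
    using ex_power_div_fact_less[of "1/8" "2 * pi * M * (l + r)"] by auto
  define t where "t = r / real (Suc n)"
  have t0: "t > 0" using r by (simp add: t_def)
  define N where "N = nat \<lceil>l / t\<rceil>"
  define S where "S = real ((N + n) choose Suc n)"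
  define q where "q = (2 * pi * t * M) ^ Suc n"
  have q0: "q \<ge> 0" using t0 M by (simp add: q_def)
  have "S * q \<le> (2 * pi * M * (l + r)) ^ Suc n / fact (Suc n)"
    unfolding S_def q_def by (rule choose_mult_power_le[OF r less_imp_le[OF l] less_imp_le[OF M] t_def N_def])
  also have "\<dots> \<le> 1 / 8" using n by (rule order_trans[OF abs_ge_self less_imp_le])
  finally have Sq: "0 \<le> S * q" "S * q \<le> 1 / 8" using q0 by (auto simp: S_def)
  obtain A :: real where A: "A \<ge> 0" and samp: "\<And>(h :: 'a \<Rightarrow> complex) U v \<theta>.
     h \<in> borel_measurable borel \<Longrightarrow> U \<in> sets borel \<Longrightarrow>
     (\<forall>x. \<exists>m\<le>N. \<forall>j\<le>n. x + real (m + j) *\<^sub>R v \<in> U) \<Longrightarrow>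
     l2sq h \<le> ennreal A * (\<integral>\<^sup>+x. indicator U x * ennreal ((cmod (h x))\<^sup>2) \<partial>lborel)
       + ennreal (2 * S\<^sup>2) * l2sq ((twisted_diff \<theta> v ^^ Suc n) h)"
    using l2sq_le_sampled[of N n, where 'a='a] unfolding S_def by blast
  define V where "V = measure lborel (ball (0::'a) r)"
  have V: "emeasure lborel (ball (0::'a) r) = ennreal V"
    unfolding V_def using emeasure_bounded_finite[of "ball (0::'a) r"]
    by (intro emeasure_eq_ennreal_measure) (auto simp: less_top)
  have V0: "V > 0" unfolding V_def using content_ball_pos[OF r] by simp
  define \<phi> where "\<phi> = fourier (wave r (0::'a))"
  have [measurable]: "\<phi> \<in> borel_measurable borel" unfolding \<phi>_def by measurable
  have \<phi>: "l2sq \<phi> = ennreal V"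
    unfolding \<phi>_def V[symmetric] l2sq_wave[symmetric]
    by (intro plancherel test_fun_integrable test_fun_l2sq test_fun_wave)
  \<comment> \<open>The square of the trivial bound 2^(n+1) for the multiplier.\<close>
  define k :: real where "k = 4 ^ Suc n"
  have k0: "k > 0" by (simp add: k_def)
  \<comment> \<open>Chosen so that S^2 k e \<le> V / 32; the added 1 keeps the denominator visibly
    positive.\<close>
  define e where "e = V / (32 * (S\<^sup>2 + 1) * k)"
  have e0: "e > 0" unfolding e_def using V0 k0 by (intro divide_pos_pos mult_pos_pos) (auto simp: add_nonneg_pos)
  obtain j where j: "\<And>i. i \<ge> j \<Longrightarrow> (\<integral>\<^sup>+z. (if real i < norm z then ennreal ((cmod (\<phi> z))\<^sup>2) else 0) \<partial>lborel) < ennreal e"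
    using order_tendstoD(2)[OF tendsto_tail[of \<phi>], of "ennreal e"] \<phi> e0 by (auto simp: eventually_sequentially)
  \<comment> \<open>The successor makes \<rho> positive even for j = 0.\<close>
  define \<rho> where "\<rho> = real (Suc j)"
  define \<tau> where "\<tau> = (\<integral>\<^sup>+z. (if \<rho> < norm z then ennreal ((cmod (\<phi> z))\<^sup>2) else 0) \<partial>lborel)"
  have \<tau>: "\<tau> \<le> ennreal e" unfolding \<tau>_def \<rho>_def using j[of "Suc j"] by (intro less_imp_le) auto
  \<comment> \<open>Majorant for the squared transform of the differenced window: the first term
    works within \<rho> of \<eta>, where the slab bounds the multiplier by q, the second
    beyond.\<close>
  define w where "w z = ennreal (q\<^sup>2) * ennreal ((cmod (\<phi> z))\<^sup>2) +
      ennreal k * (if \<rho> < norm z then ennreal ((cmod (\<phi> z))\<^sup>2) else 0)" for z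
  have [measurable]: "w \<in> borel_measurable borel" unfolding w_def by measurable
  have W: "(\<integral>\<^sup>+z. w z \<partial>lborel) \<le> ennreal (q\<^sup>2 * V + k * e)"
  proof -
    have "(\<integral>\<^sup>+z. w z \<partial>lborel) = ennreal (q\<^sup>2) * l2sq \<phi> + ennreal k * \<tau>"
      unfolding w_def \<tau>_def l2sq_def by (subst nn_integral_add) (simp_all add: nn_integral_cmult)
    also have "\<dots> \<le> ennreal (q\<^sup>2) * ennreal V + ennreal k * ennreal e"
      unfolding \<phi> by (intro add_left_mono mult_left_mono \<tau>) auto
    also have "\<dots> = ennreal (q\<^sup>2 * V + k * e)"
      using V0 k0 e0 by (simp add: ennreal_mult)
    finally show ?thesis .
  qed
  have [measurable]: "nbhd d E \<in> sets borel" for d using open_nbhd by (rule borel_open)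
  have "l2sq f \<le> ennreal (2 * A) * (\<integral>\<^sup>+y. indicator (nbhd (2 * r) E) y * ennreal ((cmod (f y))\<^sup>2) \<partial>lborel)"
    if pair: "fourier_pair f F" and supp: "AE \<xi> in lborel. \<xi> \<notin> K \<longrightarrow> F \<xi> = 0"
      and slab: "\<forall>\<eta>. \<exists>\<omega> c. norm \<omega> = 1 \<and> (\<forall>\<xi>\<in>K. norm (\<xi> - \<eta>) \<le> \<rho> \<longrightarrow> \<bar>\<xi> \<bullet> \<omega> - c\<bar> \<le> M)"
    for K f F
  proof -
    have [measurable]: "f \<in> borel_measurable borel" "F \<in> borel_measurable borel" and fin: "l2sq f < \<infinity>"
      using pair by (auto simp: fourier_pair_def)
    let ?H = "\<lambda>\<eta>. conv f (wave r \<eta>)"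
    let ?I = "\<lambda>\<eta>. \<integral>\<^sup>+x. indicator (nbhd r E) x * ennreal ((cmod (?H \<eta> x))\<^sup>2) \<partial>lborel"
    let ?J = "\<lambda>\<eta>. \<integral>\<^sup>+\<xi>. w (\<xi> - \<eta>) * ennreal ((cmod (F \<xi>))\<^sup>2) \<partial>lborel"
    let ?u = "\<integral>\<^sup>+y. indicator (nbhd (2 * r) E) y * ennreal ((cmod (f y))\<^sup>2) \<partial>lborel"
    have key: "l2sq (?H \<eta>) \<le> ennreal A * ?I \<eta> + ennreal (2 * S\<^sup>2) * (2 * ?J \<eta>)" for \<eta>
    proof -
      obtain \<omega> c where \<omega>: "norm \<omega> = 1" and c: "\<And>\<xi>. \<xi> \<in> K \<Longrightarrow> norm (\<xi> - \<eta>) \<le> \<rho> \<Longrightarrow> \<bar>\<xi> \<bullet> \<omega> - c\<bar> \<le> M"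
        using slab by blast
      \<comment> \<open>The twist 2 pi t c puts the zero of the multiplier at the centre c of the
        slab.\<close>
      let ?\<Psi> = "(twisted_diff (2 * pi * t * c) (t *\<^sub>R \<omega>) ^^ Suc n) (wave r \<eta>)"
      have win: "\<forall>x. \<exists>m\<le>N. \<forall>j\<le>n. x + real (m + j) *\<^sub>R (t *\<^sub>R \<omega>) \<in> nbhd r E"
      proof
        fix x
        obtain s where "0 \<le> s" "s \<le> l" "x + s *\<^sub>R \<omega> \<in> E" using hit[OF \<omega>] by blast
        then show "\<exists>m\<le>N. \<forall>j\<le>n. x + real (m + j) *\<^sub>R (t *\<^sub>R \<omega>) \<in> nbhd r E"
          by (rule ex_sampling_window[OF r l t_def N_def _ _ _ \<omega>])
      qed
      have m: "(\<lambda>x. ?H \<eta> x) \<in> borel_measurable borel" by measurable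
      have "(twisted_diff (2 * pi * t * c) (t *\<^sub>R \<omega>) ^^ Suc n) (?H \<eta>) = conv f ?\<Psi>"
        by (rule twisted_diff_funpow_conv) (use fin test_fun_wave in auto)
      then have "l2sq (?H \<eta>) \<le> ennreal A * ?I \<eta> + ennreal (2 * S\<^sup>2) * l2sq (conv f ?\<Psi>)"
        using samp[OF m _ win, of "2 * pi * t * c"] by simp
      also have "l2sq (conv f ?\<Psi>) \<le> 2 * (\<integral>\<^sup>+\<xi>. ennreal ((cmod (fourier ?\<Psi> \<xi>))\<^sup>2) * ennreal ((cmod (F \<xi>))\<^sup>2) \<partial>lborel)"
        by (intro l2sq_conv_le pair test_fun_twisted_diff_funpow test_fun_wave)
      also have "(\<integral>\<^sup>+\<xi>. ennreal ((cmod (fourier ?\<Psi> \<xi>))\<^sup>2) * ennreal ((cmod (F \<xi>))\<^sup>2) \<partial>lborel) \<le> ?J \<eta>"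
      proof (rule nn_integral_mono_AE)
        show "AE \<xi> in lborel. ennreal ((cmod (fourier ?\<Psi> \<xi>))\<^sup>2) * ennreal ((cmod (F \<xi>))\<^sup>2) \<le> w (\<xi> - \<eta>) * ennreal ((cmod (F \<xi>))\<^sup>2)"
          using supp
        proof eventually_elim
          case (elim \<xi>)
          show ?case
          \<comment> \<open>Off K the factor F vanishes, so the multiplier has to be controlled on K
            only.\<close>
          proof (cases "\<xi> \<in> K")
            case True
            let ?d = "1 - cis (2 * pi * (t *\<^sub>R \<omega> \<bullet> \<xi>) - 2 * pi * t * c)"
            have F: "cmod (fourier ?\<Psi> \<xi>) = cmod ?d ^ Suc n * cmod (\<phi> (\<xi> - \<eta>))"
              by (subst fourier_twisted_diff_funpow[OF test_fun_wave], subst fourier_wave)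
                 (simp add: norm_mult norm_power \<phi>_def)
            have "ennreal ((cmod (fourier ?\<Psi> \<xi>))\<^sup>2) \<le> w (\<xi> - \<eta>)"
            proof (cases "norm (\<xi> - \<eta>) \<le> \<rho>")
              case near: True
              have "cmod ?d \<le> \<bar>2 * pi * (t *\<^sub>R \<omega> \<bullet> \<xi>) - 2 * pi * t * c\<bar>" by (rule cmod_one_minus_cis_le)
              also have "\<dots> = 2 * pi * t * \<bar>\<xi> \<bullet> \<omega> - c\<bar>"
                using t0 by (simp add: inner_commute abs_mult flip: right_diff_distrib mult.assoc)
              also have "\<dots> \<le> 2 * pi * t * M"
                using c[OF True near] t0 by (intro mult_left_mono) auto
              finally have "cmod ?d ^ Suc n \<le> q" unfolding q_def by (intro power_mono) auto
              then have "(cmod ?d ^ Suc n)\<^sup>2 \<le> q\<^sup>2" by (intro power_mono) auto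
              then have "(cmod (fourier ?\<Psi> \<xi>))\<^sup>2 \<le> q\<^sup>2 * (cmod (\<phi> (\<xi> - \<eta>)))\<^sup>2"
                unfolding F power_mult_distrib by (intro mult_right_mono) auto
              then have "ennreal ((cmod (fourier ?\<Psi> \<xi>))\<^sup>2) \<le> ennreal (q\<^sup>2) * ennreal ((cmod (\<phi> (\<xi> - \<eta>)))\<^sup>2)"
                by (simp add: ennreal_leI flip: ennreal_mult)
              also have "\<dots> \<le> w (\<xi> - \<eta>)" unfolding w_def by (intro add_increasing2) auto
              finally show ?thesis .
            next
              case far: False
              have "cmod ?d ^ Suc n \<le> 2 ^ Suc n" by (rule power_mono[OF cmod_one_minus_cis_le(2)]) simp
              then have "(cmod ?d ^ Suc n)\<^sup>2 \<le> (2 ^ Suc n)\<^sup>2" by (rule power_mono) simp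
              also have "((2::real) ^ Suc n)\<^sup>2 = k"
                unfolding k_def power2_eq_square power_mult_distrib[symmetric] by simp
              finally have "(cmod (fourier ?\<Psi> \<xi>))\<^sup>2 \<le> k * (cmod (\<phi> (\<xi> - \<eta>)))\<^sup>2"
                unfolding F power_mult_distrib by (intro mult_right_mono) auto
              then have "ennreal ((cmod (fourier ?\<Psi> \<xi>))\<^sup>2) \<le> ennreal k * ennreal ((cmod (\<phi> (\<xi> - \<eta>)))\<^sup>2)"
                using k0 by (simp add: ennreal_leI flip: ennreal_mult)
              also have "\<dots> \<le> w (\<xi> - \<eta>)" unfolding w_def using far by (simp add: add_increasing)
              finally show ?thesis .
            qed
            then show ?thesis by (rule mult_right_mono) simp
          qed (use elim in simp)
        qed
      qed
      finally show ?thesis by (simp add: mult_left_mono add_left_mono)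
    qed
    have [measurable]: "?I \<in> borel_measurable borel" "?J \<in> borel_measurable borel" by measurable
    \<comment> \<open>Empty sets instantiate S and T, as the identity wanted here is the one over
      the whole space.\<close>
    have "ennreal V * l2sq f = (\<integral>\<^sup>+\<eta>. l2sq (?H \<eta>) \<partial>lborel)"
      using nn_integral_conv_wave_on(2)[of f "{}" "{}" r] fin by (simp add: V)
    also have "\<dots> \<le> (\<integral>\<^sup>+\<eta>. ennreal A * ?I \<eta> + ennreal (2 * S\<^sup>2) * (2 * ?J \<eta>) \<partial>lborel)"
      by (intro nn_integral_mono key)
    also have "\<dots> = ennreal A * (\<integral>\<^sup>+\<eta>. ?I \<eta> \<partial>lborel) + ennreal (2 * S\<^sup>2) * (2 * (\<integral>\<^sup>+\<eta>. ?J \<eta> \<partial>lborel))"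
      by (subst nn_integral_add) (simp_all add: nn_integral_cmult)
    also have "\<dots> \<le> ennreal A * (ennreal V * ?u) + ennreal (2 * S\<^sup>2) * (2 * (ennreal (q\<^sup>2 * V + k * e) * (2 * l2sq f)))"
    proof (intro add_mono mult_left_mono)
      have "y \<in> nbhd (2 * r) E" if xy: "x \<in> nbhd r E" "norm (x - y) < r" for x y
      proof -
        obtain z where "z \<in> E" "dist z x < r" using xy(1) by (auto simp: nbhd_def)
        moreover have "dist z y \<le> dist z x + dist x y" by (rule dist_triangle)
        ultimately show ?thesis using xy(2) by (auto simp: nbhd_def dist_norm intro!: bexI[of _ z])
      qed
      then show "(\<integral>\<^sup>+\<eta>. ?I \<eta> \<partial>lborel) \<le> ennreal V * ?u"
        unfolding V[symmetric] using fin by (intro nn_integral_conv_wave_on) auto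
      have "(\<integral>\<^sup>+\<eta>. ?J \<eta> \<partial>lborel) = (\<integral>\<^sup>+z. w z \<partial>lborel) * l2sq F"
        by (rule nn_integral_frequency_shift) measurable
      also have "\<dots> \<le> ennreal (q\<^sup>2 * V + k * e) * (2 * l2sq f)"
        by (intro mult_mono W fourier_pair_l2sq_le[OF pair]) auto
      finally show "(\<integral>\<^sup>+\<eta>. ?J \<eta> \<partial>lborel) \<le> ennreal (q\<^sup>2 * V + k * e) * (2 * l2sq f)" .
    qed auto
    finally have main: "ennreal V * l2sq f \<le> ennreal A * (ennreal V * ?u) + ennreal (2 * S\<^sup>2) * (2 * (ennreal (q\<^sup>2 * V + k * e) * (2 * l2sq f)))" .
    \<comment> \<open>Absorption subtracts a multiple of the square norm of f; both quantities are
      finite, so the inequality can be moved to the reals.\<close>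
    define a where "a = enn2real (l2sq f)"
    define u where "u = enn2real ?u"
    have a: "l2sq f = ennreal a" "0 \<le> a" using fin by (auto simp: a_def ennreal_enn2real)
    have "?u \<le> l2sq f"
      unfolding l2sq_def by (intro nn_integral_mono) (auto simp: indicator_def)
    then have u: "?u = ennreal u" "0 \<le> u" using fin by (auto simp: u_def ennreal_enn2real order_le_less_trans)
    have "ennreal (V * a) \<le> ennreal (A * (V * u) + 2 * S\<^sup>2 * (2 * ((q\<^sup>2 * V + k * e) * (2 * a))))"
    proof -
      have p: "0 \<le> q\<^sup>2 * V + k * e" using V0 k0 e0 by simp
      have "2 * ennreal a = ennreal (2 * a)" by (simp add: ennreal_mult a)
      moreover have "2 * ennreal ((q\<^sup>2 * V + k * e) * (2 * a)) = ennreal (2 * ((q\<^sup>2 * V + k * e) * (2 * a)))"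
        by (subst ennreal_mult) (use p a in auto)
      ultimately show ?thesis
        using main p a(2) u(2) V0 A unfolding a(1) u(1)
        by (simp add: ennreal_mult[symmetric] ennreal_plus[symmetric] del: ennreal_plus)
    qed
    then have "V * a \<le> A * (V * u) + 4 * S\<^sup>2 * ((q\<^sup>2 * V + k * e) * (2 * a))"
      using V0 A k0 e0 a(2) u(2) by (subst (asm) ennreal_le_iff) (auto simp: mult.assoc)
    then have "a \<le> 2 * A * u" by (rule real_absorb[OF V0 _ Sq e_def a(2) k0])
    then show ?thesis
      unfolding a(1) u(1) using A u by (simp add: ennreal_leI flip: ennreal_mult)
  qed
  then show ?thesis
    using A by (intro exI[of _ \<rho>] conjI exI[of _ "2 * A"]) (auto simp: \<rho>_def)
qed

section \<open>From the geometric condition and the annulus to the estimate\<close>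

lemma hausdorff_measure_empty: "hausdorff_measure 1 ({} :: 'a::euclidean_space set) = 0"
proof -
  have "hausdorff_pre 1 \<delta> ({} :: 'a set) = 0" if "0 < \<delta>" for \<delta>
  proof -
    have "hausdorff_pre 1 \<delta> ({} :: 'a set) \<le> (\<Sum>i::nat. ennreal (unit_ball_vol (real 1) * (diameter ({} :: 'a set) / 2) ^ 1))"
      unfolding hausdorff_pre_def using that
      by (intro Inf_lower CollectI exI[of _ "\<lambda>_. {}"]) auto
    then show ?thesis by simp
  qed
  then have "hausdorff_measure 1 ({} :: 'a set) \<le> 0"
    unfolding hausdorff_measure_def by (intro SUP_least) simp
  then show ?thesis by simp
qed

text \<open>The segment from x in direction \<omega> of length l is a one-dimensional cube of
  admissible side, so its intersection with E has measure at least \<gamma> l > 0, whereas the empty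
  set has measure 0.\<close>

lemma GCC_1_segment:
  fixes E :: "'a::euclidean_space set"
  assumes "GCC 1 E"
  obtains l where "l > 0" "\<And>x \<omega>. norm \<omega> = 1 \<Longrightarrow> \<exists>s. 0 \<le> s \<and> s \<le> l \<and> x + s *\<^sub>R \<omega> \<in> E"
proof -
  obtain l \<gamma> where l: "l > 0" "\<gamma> > 0" "GCC_params 1 l \<gamma> E" using assms by (auto simp: GCC_def)
  have "\<exists>s. 0 \<le> s \<and> s \<le> l \<and> x + s *\<^sub>R \<omega> \<in> E" if "norm \<omega> = 1" for x \<omega>
  proof -
    have "orthonormal_family 1 (\<lambda>_. \<omega>)"
      using that by (simp add: orthonormal_family_def norm_eq_1)
    then have "ennreal (\<gamma> * l ^ 1) \<le> hausdorff_measure 1 (k_cube 1 x (\<lambda>_. \<omega>) l \<inter> E)"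
      using l(3) unfolding GCC_params_def by blast
    moreover have "0 < ennreal (\<gamma> * l ^ 1)" using l by simp
    ultimately have "k_cube 1 x (\<lambda>_. \<omega>) l \<inter> E \<noteq> {}"
      using hausdorff_measure_empty[where 'a='a] by auto
    then show ?thesis by (auto simp: k_cube_def)
  qed
  with l(1) that show ?thesis by blast
qed

text \<open>Interface between the real norms over Lebesgue measure and the \<open>ennreal\<close>
  integrals of Borel functions.\<close>

lemma L2_norm_on_representative:
  fixes f f' :: "'a::euclidean_space \<Rightarrow> complex"
  assumes L2: "L2 f" and f': "f' \<in> borel_measurable borel" and eq: "AE x in lborel. f x = f' x"
    and S: "S \<in> sets borel"
  shows "ennreal ((L2_norm_on S f)\<^sup>2) = (\<integral>\<^sup>+y. indicator S y * ennreal ((cmod (f' y))\<^sup>2) \<partial>lborel)"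
proof -
  have i: "integrable lebesgue (\<lambda>x. indicator S x *\<^sub>R (cmod (f x))\<^sup>2)"
    using L2 S by (intro integrable_mult_indicator) (auto simp: L2_def)
  have "0 \<le> (LINT x|lebesgue. indicator S x *\<^sub>R (cmod (f x))\<^sup>2)"
    by (intro integral_nonneg_AE) auto
  then have "ennreal ((L2_norm_on S f)\<^sup>2) = ennreal (LINT x|lebesgue. indicator S x *\<^sub>R (cmod (f x))\<^sup>2)"
    unfolding L2_norm_on_def set_lebesgue_integral_def by (simp del: real_scaleR_def)
  also have "\<dots> = (\<integral>\<^sup>+x. ennreal (indicator S x *\<^sub>R (cmod (f x))\<^sup>2) \<partial>lebesgue)"
    by (rule nn_integral_eq_integral[OF i, symmetric]) auto
  also have "\<dots> = (\<integral>\<^sup>+y. indicator S y * ennreal ((cmod (f' y))\<^sup>2) \<partial>lborel)"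
    unfolding nn_integral_completion
    by (rule nn_integral_cong_AE) (use eq in eventually_elim, simp add: indicator_def)
  finally show ?thesis .
qed

text \<open>Cauchy-Schwarz gives \<xi> . sgn \<eta> \<le> |\<xi>|. Expanding |\<xi> - \<eta>|^2
  \<le> \<rho>^2 shows that the deficit is at most \<rho>^2 / (2 |\<eta>|), which is at most \<beta>
  once |\<eta>| \<ge> \<rho>^2 / (2 \<beta>). The threshold on R guarantees this through |\<eta>|
  \<ge> R - \<beta> - \<rho>, its summand 1 making the inequality strict. Half of the width 2
  \<beta> is thus the thickness of the annulus, half the curvature.\<close>

lemma annulus_cap_in_slab:
  fixes \<eta> \<xi> :: "'a::euclidean_space"
  assumes \<beta>: "\<beta> > 0" and \<rho>: "\<rho> > 0" and R: "\<beta> + \<rho> + \<rho>\<^sup>2 / (2 * \<beta>) + 1 \<le> R"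
    and \<xi>: "R - \<beta> \<le> norm \<xi>" "norm \<xi> \<le> R + \<beta>" and near: "norm (\<xi> - \<eta>) \<le> \<rho>"
  shows "\<bar>\<xi> \<bullet> sgn \<eta> - R\<bar> \<le> 2 * \<beta>" and "\<eta> \<noteq> 0"
proof -
  have "norm \<xi> - \<rho> \<le> norm \<eta>" using near norm_triangle_ineq2[of \<xi> \<eta>] by linarith
  then have \<eta>: "\<rho>\<^sup>2 / (2 * \<beta>) < norm \<eta>" using R \<xi> by linarith
  have "0 \<le> \<rho>\<^sup>2 / (2 * \<beta>)" using \<beta> by simp
  then have \<eta>0: "0 < norm \<eta>" using \<eta> by linarith
  then show "\<eta> \<noteq> 0" by auto
  have sgn: "\<xi> \<bullet> sgn \<eta> = (\<xi> \<bullet> \<eta>) / norm \<eta>" by (simp add: sgn_div_norm divide_inverse_commute)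
  have "\<xi> \<bullet> \<eta> \<le> norm \<xi> * norm \<eta>" by (rule norm_cauchy_schwarz)
  then have "\<xi> \<bullet> sgn \<eta> \<le> norm \<xi>" unfolding sgn using \<eta>0 by (simp add: field_simps)
  moreover have "norm \<xi> - \<beta> \<le> \<xi> \<bullet> sgn \<eta>"
  proof -
    have "(norm (\<xi> - \<eta>))\<^sup>2 \<le> \<rho>\<^sup>2" using near by (intro power_mono) auto
    moreover have "(norm (\<xi> - \<eta>))\<^sup>2 = (norm \<xi>)\<^sup>2 + (norm \<eta>)\<^sup>2 - 2 * (\<xi> \<bullet> \<eta>)"
      by (simp add: power2_norm_eq_inner inner_diff_left inner_diff_right inner_commute)
    ultimately have "2 * (norm \<xi> * norm \<eta>) - \<rho>\<^sup>2 \<le> 2 * (\<xi> \<bullet> \<eta>)"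
      using sum_squares_bound[of "norm \<xi>" "norm \<eta>"] by linarith
    moreover have "\<rho>\<^sup>2 \<le> 2 * \<beta> * norm \<eta>" using \<eta> \<beta> by (simp add: field_simps)
    ultimately have "(norm \<xi> - \<beta>) * norm \<eta> \<le> \<xi> \<bullet> \<eta>" by (simp add: algebra_simps)
    then show ?thesis unfolding sgn using \<eta>0 by (simp add: field_simps)
  qed
  ultimately show "\<bar>\<xi> \<bullet> sgn \<eta> - R\<bar> \<le> 2 * \<beta>" using \<xi> by (simp add: abs_le_iff)
qed

text \<open>The same estimate is used twice: half-width 2 \<beta> yields a radius \<rho>, which
  determines the threshold R0; half-width R0 + \<beta> then settles every smaller R.\<close>

lemma l2sq_le_nbhd_annulus:
  fixes E :: "'a::euclidean_space set"
  assumes GCC: "GCC 1 E" and \<beta>: "\<beta> > 0" and \<delta>: "\<delta> > 0"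
  shows "\<exists>C>0. \<forall>R f F. fourier_pair f F \<longrightarrow>
    (AE \<xi> in lborel. \<not> (R - \<beta> \<le> norm \<xi> \<and> norm \<xi> \<le> R + \<beta>) \<longrightarrow> F \<xi> = 0) \<longrightarrow>
    l2sq f \<le> ennreal C * (\<integral>\<^sup>+y. indicator (nbhd \<delta> E) y * ennreal ((cmod (f y))\<^sup>2) \<partial>lborel)"
proof -
  obtain l where l: "l > 0" and hit: "\<And>x \<omega>. norm \<omega> = 1 \<Longrightarrow> \<exists>s. 0 \<le> s \<and> s \<le> l \<and> x + s *\<^sub>R \<omega> \<in> E"
    using GCC_1_segment[OF GCC] by blast
  \<comment> \<open>The sampling and the window each consume half of \<delta>.\<close>
  have \<delta>2: "\<delta> / 2 > 0" "2 * (\<delta> / 2) = \<delta>" and \<beta>2: "2 * \<beta> > 0" using \<beta> \<delta> by auto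
  define I where "I f = (\<integral>\<^sup>+y. indicator (nbhd \<delta> E) y * ennreal ((cmod (f y))\<^sup>2) \<partial>lborel)" for f :: "'a \<Rightarrow> complex"
  note est = l2sq_le_nbhd[OF \<delta>2(1) l _ hit, unfolded \<delta>2(2), folded I_def]
  obtain \<rho> C1 where \<rho>: "\<rho> > 0" and C1: "C1 \<ge> 0" and large: "\<And>K f F. fourier_pair f F \<Longrightarrow>
      AE \<xi> in lborel. \<xi> \<notin> K \<longrightarrow> F \<xi> = 0 \<Longrightarrow>
      (\<forall>\<eta>. \<exists>\<omega> c. norm \<omega> = 1 \<and> (\<forall>\<xi>\<in>K. norm (\<xi> - \<eta>) \<le> \<rho> \<longrightarrow> \<bar>\<xi> \<bullet> \<omega> - c\<bar> \<le> 2 * \<beta>)) \<Longrightarrow>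
      l2sq f \<le> ennreal C1 * I f"
    using est[OF \<beta>2] by blast
  define R0 where "R0 = \<beta> + \<rho> + \<rho>\<^sup>2 / (2 * \<beta>) + 1"
  have R0: "R0 + \<beta> > 0" unfolding R0_def using \<beta> \<rho> by (intro add_pos_pos add_nonneg_pos) auto
  obtain C2 where C2: "C2 \<ge> 0" and small: "\<And>K f F. fourier_pair f F \<Longrightarrow>
      AE \<xi> in lborel. \<xi> \<notin> K \<longrightarrow> F \<xi> = 0 \<Longrightarrow>
      (\<forall>\<eta>::'a. \<exists>\<omega> c. norm \<omega> = 1 \<and> (\<forall>\<xi>\<in>K. \<bar>\<xi> \<bullet> \<omega> - c\<bar> \<le> R0 + \<beta>)) \<Longrightarrow>
      l2sq f \<le> ennreal C2 * I f"
    \<comment> \<open>The slab bound is demanded on all of K, hence holds for whichever radius the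
      estimate supplies.\<close>
    using est[OF R0] by meson
  obtain e :: 'a where e: "norm e = 1" using vector_choose_size[of 1] by auto
  define C where "C = C1 + C2 + 1"
  have C: "C > 0" "C1 \<le> C" "C2 \<le> C" using C1 C2 by (auto simp: C_def)
  have "l2sq f \<le> ennreal C * I f"
    if pair: "fourier_pair f F" and F0: "AE \<xi> in lborel. \<not> (R - \<beta> \<le> norm \<xi> \<and> norm \<xi> \<le> R + \<beta>) \<longrightarrow> F \<xi> = 0" for R f F
  proof -
    define K where "K = {\<xi>::'a. R - \<beta> \<le> norm \<xi> \<and> norm \<xi> \<le> R + \<beta>}"
    have supp: "AE \<xi> in lborel. \<xi> \<notin> K \<longrightarrow> F \<xi> = 0" using F0 by (simp add: K_def)
    show ?thesis
    proof (cases "R0 \<le> R")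
      case True
      have "\<exists>\<omega> c. norm \<omega> = 1 \<and> (\<forall>\<xi>\<in>K. norm (\<xi> - \<eta>) \<le> \<rho> \<longrightarrow> \<bar>\<xi> \<bullet> \<omega> - c\<bar> \<le> 2 * \<beta>)" for \<eta> :: 'a
      \<comment> \<open>For \<eta> = 0 the vector \<open>sgn \<eta>\<close> is not a unit vector;
        but then no point of K is within \<rho> of \<eta>, so any unit vector serves.\<close>
      proof (cases "\<eta> = 0")
        case True
        then have "\<forall>\<xi>\<in>K. \<not> norm (\<xi> - \<eta>) \<le> \<rho>"
          using annulus_cap_in_slab(2)[OF \<beta> \<rho> \<open>R0 \<le> R\<close>[unfolded R0_def]] unfolding K_def by blast
        then show ?thesis using e by blast
      next
        case False
        then have "norm (sgn \<eta>) = 1" by (simp add: norm_sgn)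
        then show ?thesis
          using annulus_cap_in_slab(1)[OF \<beta> \<rho> \<open>R0 \<le> R\<close>[unfolded R0_def]]
          by (intro exI[of _ "sgn \<eta>"] exI[of _ R]) (auto simp: K_def)
      qed
      then have "l2sq f \<le> ennreal C1 * I f" by (intro large[OF pair supp] allI)
      also have "\<dots> \<le> ennreal C * I f" using C by (intro mult_right_mono ennreal_leI) auto
      finally show ?thesis .
    next
      case False
      have "\<forall>\<xi>\<in>K. \<bar>\<xi> \<bullet> e - 0\<bar> \<le> R0 + \<beta>"
      proof
        fix \<xi> assume "\<xi> \<in> K"
        moreover have "\<bar>\<xi> \<bullet> e\<bar> \<le> norm \<xi> * norm e" by (rule Cauchy_Schwarz_ineq2)
        ultimately show "\<bar>\<xi> \<bullet> e - 0\<bar> \<le> R0 + \<beta>" using e False by (auto simp: K_def)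
      qed
      then have "l2sq f \<le> ennreal C2 * I f" using e by (intro small[OF pair supp]) blast
      also have "\<dots> \<le> ennreal C * I f" using C by (intro mult_right_mono ennreal_leI) auto
      finally show ?thesis .
    qed
  qed
  then show ?thesis using C(1) unfolding I_def by blast
qed

theorem theorem1p1:
  fixes E :: "'a::euclidean_space set" and \<beta> \<delta> :: real
  assumes "E \<in> sets lebesgue"
    and "GCC 1 E"
    and "\<beta> > 0" and "\<delta> > 0"
  shows "\<exists>C>0. \<forall>R>0. \<forall>f :: 'a \<Rightarrow> complex.
           L2 f \<and> spec f \<subseteq> {\<xi>. R - \<beta> \<le> norm \<xi> \<and> norm \<xi> \<le> R + \<beta>} \<longrightarrow>
           L2_norm_on UNIV f \<le> C * L2_norm_on (nbhd \<delta> E) f"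
proof -
  obtain C where C: "C > 0" and est: "\<And>R f F. fourier_pair f F \<Longrightarrow>
      AE \<xi> in lborel. \<not> (R - \<beta> \<le> norm \<xi> \<and> norm \<xi> \<le> R + \<beta>) \<longrightarrow> F \<xi> = 0 \<Longrightarrow>
      l2sq f \<le> ennreal C * (\<integral>\<^sup>+y. indicator (nbhd \<delta> E) y * ennreal ((cmod (f y))\<^sup>2) \<partial>lborel)"
    using l2sq_le_nbhd_annulus[OF assms(2-4)] by blast
  \<comment> \<open>The estimate concerns squared norms, hence the root.\<close>
  have "L2_norm_on UNIV f \<le> sqrt C * L2_norm_on (nbhd \<delta> E) f"
    if L2: "L2 f" and sp: "spec f \<subseteq> {\<xi>. R - \<beta> \<le> norm \<xi> \<and> norm \<xi> \<le> R + \<beta>}"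
    for R and f :: "'a \<Rightarrow> complex"
  proof -
    obtain f' F where pair: "fourier_pair f' F" and eq: "AE x in lborel. f x = f' x"
      and Feq: "AE \<xi> in lborel. fourier_L2 f \<xi> = F \<xi>" and meas: "fourier_L2 f \<in> borel_measurable lebesgue"
      using fourier_L2_representative[OF L2] by blast
    have f': "f' \<in> borel_measurable borel" using pair by (simp add: fourier_pair_def)
    have "AE \<xi> in lborel. \<xi> \<notin> {\<xi>. R - \<beta> \<le> norm \<xi> \<and> norm \<xi> \<le> R + \<beta>} \<longrightarrow> fourier_L2 f \<xi> = 0"
      using sp by (intro AE_ess_support meas) (simp add: spec_def)
    then have "AE \<xi> in lborel. \<not> (R - \<beta> \<le> norm \<xi> \<and> norm \<xi> \<le> R + \<beta>) \<longrightarrow> F \<xi> = 0"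
      using Feq by eventually_elim auto
    then have "l2sq f' \<le> ennreal C * (\<integral>\<^sup>+y. indicator (nbhd \<delta> E) y * ennreal ((cmod (f' y))\<^sup>2) \<partial>lborel)"
      by (rule est[OF pair])
    moreover have "l2sq f' = ennreal ((L2_norm_on UNIV f)\<^sup>2)"
      using L2_norm_on_representative[OF L2 f' eq, of UNIV] by (simp add: l2sq_def)
    ultimately have "ennreal ((L2_norm_on UNIV f)\<^sup>2) \<le> ennreal (C * (L2_norm_on (nbhd \<delta> E) f)\<^sup>2)"
      using C L2_norm_on_representative[OF L2 f' eq borel_open[OF open_nbhd], of \<delta> E] by (simp add: ennreal_mult)
    then have "(L2_norm_on UNIV f)\<^sup>2 \<le> C * (L2_norm_on (nbhd \<delta> E) f)\<^sup>2"
      using C by (subst (asm) ennreal_le_iff) auto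
    also have "\<dots> = (sqrt C * L2_norm_on (nbhd \<delta> E) f)\<^sup>2"
      using C by (simp add: power_mult_distrib)
    finally show ?thesis
      by (rule power2_le_imp_le)
         (use C in \<open>auto simp: L2_norm_on_def set_lebesgue_integral_def intro!: mult_nonneg_nonneg integral_nonneg_AE\<close>)
  qed
  then show ?thesis using C by (intro exI[of _ "sqrt C"]) auto
qed

end
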